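(* Let $m\in\mathbb{Z}^+$ and $$H=\Big\{(x_1,x_2,x_3)\in\mathbb{R}^3:\ x_2^2+x_3^2\le \frac{(\ln(1+x_1))^m}{1+x_1},\ x_1>0\Big\}.$$ Let $\mathbf{p}(\cdot)\in\mathcal{P}(\mathbb{R}^3)$ be a variable exponent satisfying $$3<\mathbf{p}^-_{\mathbb{R}^3\setminus H}\le \mathbf{p}(x)\le \mathbf{p}^+_{\mathbb{R}^3\setminus H}<\tfrac92\quad\text{for a.e. } x\in\mathbb{R}^3\setminus H,\qquad \mathbf{p}(x)=+\infty\quad\text{for } x\in H.$$ Let $u\in L^2_{loc}(\mathbb{R}^3)$ (vector field) and $\pi\in\mathcal{D}'(\mathbb{R}^3)$ be a weak solution of the stationary Navier–Stokes equations $$-\Delta u+(u\cdot\nabla)u+\nabla\pi=0,\qquad \nabla\cdot u=0\quad\text{in }\mathbb{R}^3.$$ If moreover $u\in L^{\mathbf{p}(\cdot)}(\mathbb{R}^3)$ and $\pi\in L^{\mathbf{p}(\cdot)/2}(\mathbb{R}^3)$, then $u\equiv 0$.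
   Context: $\mathcal{P}(\Omega)$ denotes the set of Lebesgue measurable functions $p(\cdot):\Omega\to[1,+\infty]$. For $p(\cdot)\in\mathcal{P}(\Omega)$, the variable Lebesgue space $L^{p(\cdot)}(\Omega)$ consists of measurable $f$ with finite Luxemburg norm $\|f\|_{L^{p(\cdot)}}=\inf\{\lambda>0:\rho_{p(\cdot)}(f/\lambda)\le 1\}$, where the modular is $\rho_{p(\cdot)}(f)=\int_{\{p<\infty\}}|f(x)|^{p(x)}\,dx+\|f\|_{L^\infty(\{p=\infty\})}$ (so on the set where $p=\infty$ the space behaves like $L^\infty$). For a measurable $\Omega\subset\mathbb{R}^3$, $p^-_\Omega=\operatorname{ess\,inf}_{x\in\Omega}p(x)$ and $p^+_\Omega=\operatorname{ess\,sup}_{x\in\Omega}p(x)$. The exponent $\mathbf{p}(\cdot)/2$ denotes $x\mapsto \mathbf{p}(x)/2$ (equal to $+\infty$ on $H$). A weak solution means the equations hold in the sense of distributions on $\mathbb{R}^3$. *)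

theory Defs
  imports "HOL-Analysis.Analysis" "HOL-Probability.Essential_Supremum"
begin

definition partial :: "3 \<Rightarrow> (real^3 \<Rightarrow> real) \<Rightarrow> real^3 \<Rightarrow> real" where
  "partial i f x = frechet_derivative f (at x) (axis i 1)"

coinductive smooth3 :: "(real^3 \<Rightarrow> real) \<Rightarrow> bool" where
  "(\<forall>x. f differentiable (at x)) \<Longrightarrow> (\<forall>i. smooth3 (partial i f)) \<Longrightarrow> smooth3 f"

definition test_fun :: "(real^3 \<Rightarrow> real) \<Rightarrow> bool" where
  "test_fun f \<longleftrightarrow> smooth3 f \<and> compact (closure {x. f x \<noteq> 0})"

definition test_vfield :: "(real^3 \<Rightarrow> real^3) \<Rightarrow> bool" where
  "test_vfield \<phi> \<longleftrightarrow> (\<forall>j. test_fun (\<lambda>x. \<phi> x $ j))"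

definition ess_sup_on :: "(real^3) set \<Rightarrow> (real^3 \<Rightarrow> ereal) \<Rightarrow> ereal" where
  "ess_sup_on S f = esssup (restrict_space lebesgue S) f"

definition ess_inf_on :: "(real^3) set \<Rightarrow> (real^3 \<Rightarrow> ereal) \<Rightarrow> ereal" where
  "ess_inf_on S f = Sup {z. emeasure (restrict_space lebesgue S)
                                {x \<in> space (restrict_space lebesgue S). f x < z} = 0}"

definition var_exponent :: "(real^3 \<Rightarrow> ereal) \<Rightarrow> bool" where
  "var_exponent p \<longleftrightarrow> p \<in> borel_measurable lebesgue \<and> (\<forall>x. 1 \<le> p x)"

text \<open>L-infinity norm on a set S (zero if S is null).\<close>
definition Linf_norm_on :: "(real^3) set \<Rightarrow> (real^3 \<Rightarrow> real) \<Rightarrow> ereal" where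
  "Linf_norm_on S g = max 0 (esssup (restrict_space lebesgue S) (\<lambda>x. ereal \<bar>g x\<bar>))"

definition modular :: "(real^3 \<Rightarrow> ereal) \<Rightarrow> (real^3 \<Rightarrow> real) \<Rightarrow> ereal" where
  "modular p g =
     enn2ereal (\<integral>\<^sup>+ x \<in> {x. p x < \<infinity>}. ennreal (\<bar>g x\<bar> powr real_of_ereal (p x)) \<partial>lebesgue)
     + Linf_norm_on {x. p x = \<infinity>} g"

text \<open>g belongs to L^{p(.)}: measurable with finite Luxemburg norm, i.e. the set
  of admissible lambda in the infimum is nonempty.\<close>
definition in_Lvar :: "(real^3 \<Rightarrow> ereal) \<Rightarrow> (real^3 \<Rightarrow> real) \<Rightarrow> bool" where
  "in_Lvar p g \<longleftrightarrow> g \<in> borel_measurable lebesgue \<and>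
     (\<exists>c>0. modular p (\<lambda>x. g x / c) \<le> 1)"

definition in_Lvar_vec :: "(real^3 \<Rightarrow> ereal) \<Rightarrow> (real^3 \<Rightarrow> real^3) \<Rightarrow> bool" where
  "in_Lvar_vec p u \<longleftrightarrow> u \<in> borel_measurable lebesgue \<and> in_Lvar p (\<lambda>x. norm (u x))"

definition L2_loc_vec :: "(real^3 \<Rightarrow> real^3) \<Rightarrow> bool" where
  "L2_loc_vec u \<longleftrightarrow> u \<in> borel_measurable lebesgue \<and>
     (\<forall>K. compact K \<longrightarrow> set_integrable lebesgue K (\<lambda>x. (norm (u x))\<^sup>2))"

definition L1_loc :: "(real^3 \<Rightarrow> real) \<Rightarrow> bool" where
  "L1_loc f \<longleftrightarrow> f \<in> borel_measurable lebesgue \<and>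
     (\<forall>K. compact K \<longrightarrow> set_integrable lebesgue K f)"

text \<open>Distributional form of  -Delta u + (u.grad)u + grad pi = 0,  div u = 0,
  with (u.grad)u understood as div(u tensor u) (as usual since div u = 0).\<close>
definition weak_stationary_NS :: "(real^3 \<Rightarrow> real^3) \<Rightarrow> (real^3 \<Rightarrow> real) \<Rightarrow> bool" where
  "weak_stationary_NS u \<pi> \<longleftrightarrow>
     (\<forall>\<phi>. test_vfield \<phi> \<longrightarrow>
        (\<integral>x. (\<Sum>j\<in>UNIV. u x $ j * (\<Sum>i\<in>UNIV. partial i (partial i (\<lambda>y. \<phi> y $ j)) x))
             + (\<Sum>i\<in>UNIV. \<Sum>j\<in>UNIV. u x $ i * u x $ j * partial i (\<lambda>y. \<phi> y $ j) x)
             + \<pi> x * (\<Sum>j\<in>UNIV. partial j (\<lambda>y. \<phi> y $ j) x) \<partial>lebesgue) = 0) \<and>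
     (\<forall>\<psi>. test_fun \<psi> \<longrightarrow>
        (\<integral>x. (\<Sum>i\<in>UNIV. u x $ i * partial i \<psi> x) \<partial>lebesgue) = 0)"

definition H_set :: "nat \<Rightarrow> (real^3) set" where
  "H_set m = {x. x $ 1 > 0 \<and> (x $ 2)\<^sup>2 + (x $ 3)\<^sup>2 \<le> (ln (1 + x $ 1)) ^ m / (1 + x $ 1)}"

end

theory Submission
  imports Defs
begin

text \<open>
  The proof has two halves. First, \<open>u\<close> is bounded. Testing the equation with the columns of a truncated,
  regularised Stokes kernel eliminates the pressure and gives, for \<open>v = |u|\<close>,
  \<open>v x \<le> C \<integral>\<^bsub>|x - y| \<le> 1\<^esub> (v y + |x - y|\<^sup>-\<^sup>2 (v y)\<^sup>2) dy\<close>. Since \<open>v\<close> is the sum of a bounded function and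
  a function in \<open>L\<^sup>q\<close> with \<open>q > 3\<close>, the operator with kernel \<open>|x - y|\<^sup>-\<^sup>2 v y\<close> restricted to a small ball
  is a contraction, and the excess of \<open>v\<close> over a large constant is dominated by a contraction of itself.

  Second, for bounded \<open>u\<close> the mollified equation can be tested with \<open>\<phi> u\<close>, because the
  commutator of mollification and product vanishes in \<open>L\<^sup>2\<close> locally. This yields the local energy
  inequality, whose right-hand side for a cutoff \<open>\<phi>\<close> at scale \<open>R\<close> is controlled by
  \<open>R\<^sup>-\<^sup>1\<close> times the integral of \<open>|u| ^ 3 + |\<pi>| powr (3/2)\<close> over an annulus of radius about \<open>R\<close>.
  Outside \<open>H\<close> this tends to zero by Young's inequality, as \<open>3 < p < 9/2\<close>; on \<open>H\<close> the integrand is bounded and \<open>H\<close> meets a ball of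
  radius \<open>R\<close> in volume \<open>o(R)\<close>. So \<open>u\<close> has zero gradient, is constant, and the same decay makes the constant zero.
\<close>

subsection \<open>Calculus of smooth functions\<close>

text \<open>Both thresholds come from scaling. For v in L^q on small balls the kernel
  \<open>|x - y|^-2 v y\<close> is subcritical when q > 3. For u in L^p, Hoelder bounds R^-1 times
  the integral of |u|^3 over a ball of radius R by a multiple of R^(2 - 9/p), which decays for p <
  9/2. With a variable exponent both facts are obtained from pointwise inequalities that trade a
  power of the function for a power of the scale: \<open>singular_product_bound\<close> and
  \<open>cube_le_powr_add\<close>. The obstacle is that u has no gradient to begin with, so the
  equation cannot be tested with u itself. Boundedness is wanted for one reason: the commutator of
  mollification and product is small in L^1 for any locally square integrable field, and a bounded
  quantity that is small in L^1 is small in L^2. This smallness comes with no rate in R, so the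
  mollifier is chosen after the radius. The energy estimate is used only for mollified fields; what
  passes to the limit is the vanishing of the weak gradient.\<close>

lemma smooth3_differentiable: "smooth3 f \<Longrightarrow> f differentiable (at x)"
  by (erule smooth3.cases) simp

lemma smooth3_partial: "smooth3 f \<Longrightarrow> smooth3 (partial i f)"
  by (erule smooth3.cases) simp

lemma smooth3_isCont: "smooth3 f \<Longrightarrow> isCont f x"
  using smooth3_differentiable differentiable_imp_continuous_within by blast

lemma smooth3_continuous_on: "smooth3 f \<Longrightarrow> continuous_on S f"
  by (simp add: smooth3_isCont continuous_at_imp_continuous_on)

lemma smooth3_borel: "smooth3 f \<Longrightarrow> f \<in> borel_measurable borel"
  by (intro borel_measurable_continuous_onI smooth3_continuous_on)

lemma partial_eqI: "(f has_derivative D) (at x) \<Longrightarrow> partial i f x = D (axis i 1)"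
  unfolding partial_def by (metis frechet_derivative_at)

lemma has_derivative_partial:
  assumes "f differentiable (at x)"
  shows "(f has_derivative (\<lambda>h. \<Sum>i\<in>UNIV. h $ i * partial i f x)) (at x)"
proof -
  have d: "(f has_derivative frechet_derivative f (at x)) (at x)"
    using assms frechet_derivative_works by blast
  then have lin: "linear (frechet_derivative f (at x))"
    by (rule has_derivative_linear)
  have "frechet_derivative f (at x) h = (\<Sum>i\<in>UNIV. h $ i * partial i f x)" for h
  proof -
    have "h = (\<Sum>i\<in>UNIV. h $ i *\<^sub>R axis i 1)"
      by (metis basis_expansion scalar_mult_eq_scaleR)
    then have "frechet_derivative f (at x) h
        = (\<Sum>i\<in>UNIV. frechet_derivative f (at x) (h $ i *\<^sub>R axis i 1))"
      by (metis (no_types, lifting) lin linear_sum sum.cong)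
    then show ?thesis
      by (simp add: linear_scale[OF lin] partial_def)
  qed
  then show ?thesis using d by presburger
qed

lemma partial_const [simp]: "partial i (\<lambda>x. c) = (\<lambda>x. 0)"
  by (rule ext, rule partial_eqI[where D = "\<lambda>h. 0", simplified]) simp

lemma partial_coord [simp]: "partial i (\<lambda>x. x $ j) = (\<lambda>x. if i = j then 1 else 0)"
proof
  fix x :: "real^3"
  have "((\<lambda>x::real^3. x $ j) has_derivative (\<lambda>h. h $ j)) (at x)"
    by (intro bounded_linear_imp_has_derivative bounded_linear_vec_nth)
  from partial_eqI[OF this] show "partial i (\<lambda>x. x $ j) x = (if i = j then 1 else 0)"
    by (auto simp: axis_def)
qed

lemma partial_add:
  assumes "f differentiable (at x)" "g differentiable (at x)"
  shows "partial i (\<lambda>x. f x + g x) x = partial i f x + partial i g x"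
  using has_derivative_add[OF assms[unfolded frechet_derivative_works]]
  by (subst partial_eqI) (auto simp: partial_def)

lemma partial_mult:
  assumes "f differentiable (at x)" "g differentiable (at x)"
  shows "partial i (\<lambda>x. f x * g x) x = f x * partial i g x + partial i f x * g x"
  using has_derivative_mult[OF assms[unfolded frechet_derivative_works]]
  by (subst partial_eqI) (auto simp: partial_def)

text \<open>Coinduction for \<^const>\<open>smooth3\<close> up to sums and products: the plain rule is too weak, since the
  derivative of a product is not a product.\<close>

inductive alg :: "(real^3 \<Rightarrow> real) set \<Rightarrow> (real^3 \<Rightarrow> real) \<Rightarrow> bool" for X where
  base: "f \<in> X \<Longrightarrow> alg X f"
| smooth: "smooth3 f \<Longrightarrow> alg X f"
| add: "alg X f \<Longrightarrow> alg X g \<Longrightarrow> alg X (\<lambda>x. f x + g x)"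
| mult: "alg X f \<Longrightarrow> alg X g \<Longrightarrow> alg X (\<lambda>x. f x * g x)"

text \<open>The sum and product rules keep \<open>alg X\<close> stable under partial derivatives
  once the derivatives of the generators lie in it. This stability is the invariant of the
  coinduction in \<open>alg_smooth3\<close>.\<close>

lemma alg_differentiable_partial:
  assumes "\<And>f x. f \<in> X \<Longrightarrow> f differentiable (at x)"
    and "\<And>f i. f \<in> X \<Longrightarrow> alg X (partial i f)"
  shows "alg X f \<Longrightarrow> (\<forall>x. f differentiable (at x)) \<and> (\<forall>i. alg X (partial i f))"
proof (induction rule: alg.induct)
  case (base f)
  then show ?case using assms by auto
next
  case (smooth f)
  then show ?case by (auto intro: alg.smooth smooth3_differentiable smooth3_partial)
next
  case (add f g)
  then have "partial i (\<lambda>x. f x + g x) = (\<lambda>x. partial i f x + partial i g x)" for i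
    by (intro ext partial_add) auto
  with add show ?case by (auto intro: alg.intros)
next
  case (mult f g)
  then have "partial i (\<lambda>x. f x * g x) = (\<lambda>x. f x * partial i g x + partial i f x * g x)" for i
    by (intro ext partial_mult) auto
  moreover have "alg X (\<lambda>x. f x * partial i g x + partial i f x * g x)" for i
    using mult by (intro alg.add alg.mult) auto
  ultimately show ?case using mult by auto
qed

lemma alg_smooth3:
  assumes "\<And>f x. f \<in> X \<Longrightarrow> f differentiable (at x)"
    and "\<And>f i. f \<in> X \<Longrightarrow> alg X (partial i f)"
    and "alg X f"
  shows "smooth3 f"
  using assms(3)
proof (coinduction arbitrary: f)
  case smooth3
  with alg_differentiable_partial[OF assms(1,2)] show ?case by auto
qed

lemma smooth3_add: "smooth3 f \<Longrightarrow> smooth3 g \<Longrightarrow> smooth3 (\<lambda>x. f x + g x)"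
  by (rule alg_smooth3[of "{}"]) (auto intro: alg.intros)

lemma smooth3_mult: "smooth3 f \<Longrightarrow> smooth3 g \<Longrightarrow> smooth3 (\<lambda>x. f x * g x)"
  by (rule alg_smooth3[of "{}"]) (auto intro: alg.intros)

lemma smooth3_const: "smooth3 (\<lambda>x. c)"
  by (rule alg_smooth3[of "range (\<lambda>c x. c)"]) (auto intro: alg.intros)

lemma smooth3_coord: "smooth3 (\<lambda>x. x $ j)"
proof (rule alg_smooth3[of "{\<lambda>x. x $ j}"])
  fix f :: "real^3 \<Rightarrow> real" and x assume "f \<in> {\<lambda>x. x $ j}"
  then show "f differentiable (at x)"
    using bounded_linear_imp_differentiable[OF bounded_linear_vec_nth] by auto
qed (auto intro: alg.intros smooth3_const)

lemma smooth3_cmult: "smooth3 f \<Longrightarrow> smooth3 (\<lambda>x. c * f x)"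
  by (intro smooth3_mult smooth3_const)

lemma smooth3_uminus: "smooth3 f \<Longrightarrow> smooth3 (\<lambda>x. - f x)"
  using smooth3_cmult[of f "-1"] by simp

lemma smooth3_diff: "smooth3 f \<Longrightarrow> smooth3 g \<Longrightarrow> smooth3 (\<lambda>x. f x - g x)"
  using smooth3_add[of f "\<lambda>x. - g x"] smooth3_uminus[of g] by simp

lemma smooth3_sum: "(\<And>a. a \<in> A \<Longrightarrow> smooth3 (f a)) \<Longrightarrow> smooth3 (\<lambda>x. \<Sum>a\<in>A. f a x)"
  by (induction A rule: infinite_finite_induct) (auto intro: smooth3_add smooth3_const)

lemma smooth3_power: "smooth3 f \<Longrightarrow> smooth3 (\<lambda>x. f x ^ n)"
  by (induction n) (auto intro: smooth3_mult smooth3_const)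

lemmas smooth3_intros = smooth3_add smooth3_mult smooth3_const smooth3_coord smooth3_uminus
  smooth3_diff smooth3_sum smooth3_power smooth3_partial

lemma partial_smooth_add:
  "smooth3 f \<Longrightarrow> smooth3 g \<Longrightarrow> partial i (\<lambda>x. f x + g x) = (\<lambda>x. partial i f x + partial i g x)"
  by (intro ext partial_add smooth3_differentiable)

lemma partial_smooth_mult:
  "smooth3 f \<Longrightarrow> smooth3 g \<Longrightarrow>
    partial i (\<lambda>x. f x * g x) = (\<lambda>x. f x * partial i g x + partial i f x * g x)"
  by (intro ext partial_mult smooth3_differentiable)

lemma partial_smooth_cmult: "smooth3 f \<Longrightarrow> partial i (\<lambda>x. c * f x) = (\<lambda>x. c * partial i f x)"
  by (simp add: partial_smooth_mult smooth3_const)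

lemma partial_smooth_uminus: "smooth3 f \<Longrightarrow> partial i (\<lambda>x. - f x) = (\<lambda>x. - partial i f x)"
  using partial_smooth_cmult[of f i "-1"] by simp

lemma partial_smooth_diff:
  "smooth3 f \<Longrightarrow> smooth3 g \<Longrightarrow> partial i (\<lambda>x. f x - g x) = (\<lambda>x. partial i f x - partial i g x)"
  using partial_smooth_add[of f "\<lambda>x. - g x"] by (simp add: partial_smooth_uminus smooth3_uminus)

lemma partial_smooth_sum:
  "(\<And>a. a \<in> A \<Longrightarrow> smooth3 (f a)) \<Longrightarrow>
    partial i (\<lambda>x. \<Sum>a\<in>A. f a x) = (\<lambda>x. \<Sum>a\<in>A. partial i (f a) x)"
proof (induction A rule: infinite_finite_induct)
  case (insert a A)
  then show ?case
    by (simp add: partial_smooth_add smooth3_sum)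
qed auto

section \<open>Affine substitutions and composition with functions of one variable\<close>

lemma has_derivative_affine:
  assumes "f differentiable (at (a *\<^sub>R x + b))"
  shows "((\<lambda>x. f (a *\<^sub>R x + b)) has_derivative
     (\<lambda>h. frechet_derivative f (at (a *\<^sub>R x + b)) (a *\<^sub>R h))) (at x)"
proof -
  have "((\<lambda>x. a *\<^sub>R x + b) has_derivative (\<lambda>h. a *\<^sub>R h)) (at x)"
    by (auto intro!: derivative_eq_intros)
  from has_derivative_compose[OF this] assms show ?thesis
    unfolding frechet_derivative_works by blast
qed

lemma partial_affine:
  assumes "f differentiable (at (a *\<^sub>R x + b))"
  shows "partial i (\<lambda>x. f (a *\<^sub>R x + b)) x = a * partial i f (a *\<^sub>R x + b)"
proof -
  have lin: "linear (frechet_derivative f (at (a *\<^sub>R x + b)))"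
    using assms has_derivative_linear frechet_derivative_works by blast
  show ?thesis
    using partial_eqI[OF has_derivative_affine[OF assms]]
    by (simp add: partial_def linear_scale[OF lin])
qed

lemma smooth3_affine:
  assumes "smooth3 f" shows "smooth3 (\<lambda>x. f (a *\<^sub>R x + b))"
proof (rule alg_smooth3[of "{\<lambda>x. f (a *\<^sub>R x + b) | f. smooth3 f}"])
  fix g x assume "g \<in> {\<lambda>x. f (a *\<^sub>R x + b) | f. smooth3 f}"
  then show "g differentiable (at x)"
    using has_derivative_affine smooth3_differentiable by (force simp: differentiable_def)
next
  fix g i assume "g \<in> {\<lambda>x. f (a *\<^sub>R x + b) | f. smooth3 f}"
  then obtain f where f: "smooth3 f" "g = (\<lambda>x. f (a *\<^sub>R x + b))" by auto
  then have "partial i g = (\<lambda>x. a * partial i f (a *\<^sub>R x + b))"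
    using partial_affine smooth3_differentiable by blast
  moreover have "alg {\<lambda>x. f (a *\<^sub>R x + b) | f. smooth3 f} (\<lambda>x. partial i f (a *\<^sub>R x + b))"
    by (rule alg.base) (use f smooth3_partial in blast)
  ultimately show "alg {\<lambda>x. f (a *\<^sub>R x + b) | f. smooth3 f} (partial i g)"
    using alg.mult[OF alg.smooth[OF smooth3_const]] by simp
qed (use assms in \<open>auto intro: alg.base\<close>)

lemma has_derivative_compose_real:
  assumes "(F has_real_derivative F') (at (f x))" "f differentiable (at x)"
  shows "((\<lambda>x. F (f x)) has_derivative (\<lambda>h. F' * frechet_derivative f (at x) h)) (at x)"
  using has_derivative_compose[OF assms(2)[unfolded frechet_derivative_works]
      assms(1)[unfolded has_field_derivative_def]] by simp

lemma partial_compose: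
  assumes "(F has_real_derivative F') (at (f x))" "f differentiable (at x)"
  shows "partial i (\<lambda>x. F (f x)) x = F' * partial i f x"
  using partial_eqI[OF has_derivative_compose_real[OF assms]] by (simp add: partial_def)

text \<open>\<open>D\<close> lists the successive derivatives of the outer function, so the
  compositions \<open>D n (f x)\<close> generate an algebra closed under differentiation.
  Derivatives are demanded only at values of \<open>f\<close>; this admits real powers of a positive
  function.\<close>

lemma smooth3_compose:
  fixes D :: "nat \<Rightarrow> real \<Rightarrow> real"
  assumes f: "smooth3 f"
    and D: "\<And>n x. (D n has_real_derivative D (Suc n) (f x)) (at (f x))"
  shows "smooth3 (\<lambda>x. D n (f x))"
proof (rule alg_smooth3[of "range (\<lambda>n x. D n (f x))"])
  fix g x assume "g \<in> range (\<lambda>n x. D n (f x))"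
  then show "g differentiable (at x)"
    using has_derivative_compose_real[OF D smooth3_differentiable[OF f]]
    by (force simp: differentiable_def)
next
  fix g i assume "g \<in> range (\<lambda>n x. D n (f x))"
  then obtain n where "g = (\<lambda>x. D n (f x))" by auto
  then have "partial i g = (\<lambda>x. D (Suc n) (f x) * partial i f x)"
    using partial_compose[OF D smooth3_differentiable[OF f]] by blast
  moreover have "alg (range (\<lambda>n x. D n (f x))) (\<lambda>x. D (Suc n) (f x))"
    by (rule alg.base) blast
  ultimately show "alg (range (\<lambda>n x. D n (f x))) (partial i g)"
    using alg.mult[OF _ alg.smooth[OF smooth3_partial[OF f]]] by simp
qed (auto intro: alg.base)

lemma partial_cong_open:
  assumes "open S" "x \<in> S" "\<And>y. y \<in> S \<Longrightarrow> f y = g y"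
    and "f differentiable (at x)"
  shows "partial i f x = partial i g x"
proof -
  have "(f has_derivative frechet_derivative f (at x)) (at x)"
    using assms(4) frechet_derivative_works by blast
  then have "(g has_derivative frechet_derivative f (at x)) (at x)"
    by (rule has_derivative_transform_within_open[OF _ assms(1,2)]) (use assms(3) in auto)
  from partial_eqI[OF this] show ?thesis by (simp add: partial_def)
qed

section \<open>Mean value theorem and symmetry of second derivatives\<close>

lemma has_real_derivative_line:
  assumes "f differentiable (at (x + t *\<^sub>R h))"
  shows "((\<lambda>t. f (x + t *\<^sub>R h)) has_real_derivative (\<Sum>i\<in>UNIV. h $ i * partial i f (x + t *\<^sub>R h))) (at t)"
proof -
  have "((\<lambda>t. x + t *\<^sub>R h) has_derivative (\<lambda>s. s *\<^sub>R h)) (at t)"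
    by (auto intro!: derivative_eq_intros)
  from has_derivative_compose[OF this has_derivative_partial[OF assms]]
  have "((\<lambda>t. f (x + t *\<^sub>R h)) has_derivative
      (\<lambda>s. \<Sum>i\<in>UNIV. (s *\<^sub>R h) $ i * partial i f (x + t *\<^sub>R h))) (at t)" .
  moreover have "(\<lambda>s. \<Sum>i\<in>UNIV. (s *\<^sub>R h) $ i * partial i f (x + t *\<^sub>R h))
      = (*) (\<Sum>i\<in>UNIV. h $ i * partial i f (x + t *\<^sub>R h))"
    by (rule ext) (simp add: sum_distrib_left sum_distrib_right mult_ac)
  ultimately show ?thesis
    unfolding has_field_derivative_def by simp
qed

lemma mvt_partial:
  assumes "smooth3 f"
  obtains t where "0 < t" "t < 1"
    "f (x + h) - f x = (\<Sum>i\<in>UNIV. h $ i * partial i f (x + t *\<^sub>R h))"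
proof -
  have "\<exists>t>0. t < 1 \<and> f (x + 1 *\<^sub>R h) - f (x + 0 *\<^sub>R h)
      = (1 - 0) * (\<Sum>i\<in>UNIV. h $ i * partial i f (x + t *\<^sub>R h))"
    by (rule MVT2) (auto intro!: has_real_derivative_line smooth3_differentiable assms)
  then show ?thesis using that by auto
qed

lemma mvt_axis:
  assumes "smooth3 f"
  obtains t where "0 < t" "t < 1"
    "f (x + s *\<^sub>R axis i 1) - f x = s * partial i f (x + (t * s) *\<^sub>R axis i 1)"
proof -
  obtain t where t: "0 < t" "t < 1" "f (x + s *\<^sub>R axis i 1) - f x
      = (\<Sum>j\<in>UNIV. (s *\<^sub>R axis i 1) $ j * partial j f (x + t *\<^sub>R (s *\<^sub>R axis i 1)))"
    using mvt_partial[OF assms, of x "s *\<^sub>R axis i 1"] by blast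
  have "(\<Sum>j\<in>UNIV. (s *\<^sub>R axis i 1) $ j * partial j f (x + t *\<^sub>R (s *\<^sub>R axis i 1)))
      = (\<Sum>j\<in>UNIV. if j = i then s * partial j f (x + t *\<^sub>R (s *\<^sub>R axis i 1)) else 0)"
    by (rule sum.cong) (auto simp: axis_def)
  with t that show ?thesis by simp
qed

text \<open>The second difference of \<open>f\<close> over a square of side \<open>s\<close> is
  symmetric in the two directions. Two applications of the mean value theorem, in either order,
  express it as \<open>s * s\<close> times a mixed derivative at a point near \<open>x\<close>;
  continuity of both mixed derivatives then forces equality at \<open>x\<close>.\<close>

lemma partial_commute:
  assumes "smooth3 f"
  shows "partial i (partial j f) x = partial j (partial i f) x"
proof -
  define e :: "3 \<Rightarrow> real^3" where "e i = axis i 1" for i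
  define \<Delta> where "\<Delta> s = f (x + s *\<^sub>R e i + s *\<^sub>R e j) - f (x + s *\<^sub>R e i) - f (x + s *\<^sub>R e j) + f x" for s
  have ne: "norm (e i) = 1" for i by (simp add: e_def)
  have key: "\<exists>y. norm (y - x) \<le> 2 * \<bar>s\<bar> \<and>
      f (x + s *\<^sub>R e i + s *\<^sub>R e j) - f (x + s *\<^sub>R e i) - f (x + s *\<^sub>R e j) + f x
        = s * s * partial j (partial i f) y" for s i j
  proof -
    \<comment> \<open>The increment in direction \<open>j\<close>; its increment in direction
      \<open>i\<close> is the second difference. The factor 1 matches the form of the affine
      substitution rule.\<close>
    define g where "g y = f (1 *\<^sub>R y + s *\<^sub>R e j) - f y" for y
    have g: "smooth3 g"
      unfolding g_def by (intro smooth3_diff smooth3_affine assms)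
    have pg: "partial i g y = partial i f (y + s *\<^sub>R e j) - partial i f y" for y
    proof -
      have "partial i g = (\<lambda>x. partial i (\<lambda>x. f (1 *\<^sub>R x + s *\<^sub>R e j)) x - partial i f x)"
        unfolding g_def by (rule partial_smooth_diff[OF smooth3_affine[OF assms] assms])
      then show ?thesis
        by (simp only: partial_affine[OF smooth3_differentiable[OF assms]]) simp
    qed
    obtain t where t: "0 < t" "t < 1"
      "g (x + s *\<^sub>R e i) - g x = s * partial i g (x + (t * s) *\<^sub>R e i)"
      using mvt_axis[OF g] unfolding e_def by metis
    define z where "z = x + (t * s) *\<^sub>R e i"
    obtain r where r: "0 < r" "r < 1"
      "partial i f (z + s *\<^sub>R e j) - partial i f z = s * partial j (partial i f) (z + (r * s) *\<^sub>R e j)"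
      using mvt_axis[OF smooth3_partial[OF assms]] unfolding e_def by metis
    have "norm ((t * s) *\<^sub>R e i + (r * s) *\<^sub>R e j) \<le> \<bar>t * s\<bar> + \<bar>r * s\<bar>"
      by (rule order_trans[OF norm_triangle_ineq]) (simp add: ne)
    also have "\<dots> \<le> \<bar>s\<bar> + \<bar>s\<bar>"
      using t r by (intro add_mono) (auto simp: abs_mult intro!: mult_left_le_one_le)
    finally have "norm ((z + (r * s) *\<^sub>R e j) - x) \<le> 2 * \<bar>s\<bar>"
      by (simp add: z_def)
    moreover have "f (x + s *\<^sub>R e i + s *\<^sub>R e j) - f (x + s *\<^sub>R e i) - f (x + s *\<^sub>R e j) + f x
        = g (x + s *\<^sub>R e i) - g x"
      by (simp add: g_def)
    moreover have "\<dots> = s * s * partial j (partial i f) (z + (r * s) *\<^sub>R e j)"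
      using t(3) r(3) pg by (simp add: z_def)
    ultimately show ?thesis by metis
  qed
  show ?thesis
  proof (rule ccontr)
    assume ne': "\<not> ?thesis"
    define \<epsilon> where "\<epsilon> = \<bar>partial i (partial j f) x - partial j (partial i f) x\<bar> / 2"
    have \<epsilon>: "\<epsilon> > 0" using ne' by (simp add: \<epsilon>_def)
    have ct: "isCont (partial i (partial j f)) x" "isCont (partial j (partial i f)) x"
      by (intro smooth3_isCont smooth3_partial assms)+
    obtain d1 where d1: "d1 > 0" "\<And>y. dist y x < d1 \<Longrightarrow> dist (partial i (partial j f) y) (partial i (partial j f) x) < \<epsilon>"
      using ct(1) \<epsilon> unfolding continuous_at_eps_delta by metis
    obtain d2 where d2: "d2 > 0" "\<And>y. dist y x < d2 \<Longrightarrow> dist (partial j (partial i f) y) (partial j (partial i f) x) < \<epsilon>"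
      using ct(2) \<epsilon> unfolding continuous_at_eps_delta by metis
    define s where "s = min d1 d2 / 4"
    have s: "s > 0" "2 * \<bar>s\<bar> < d1" "2 * \<bar>s\<bar> < d2" using d1(1) d2(1) by (auto simp: s_def)
    obtain y1 where y1: "norm (y1 - x) \<le> 2 * \<bar>s\<bar>"
      "f (x + s *\<^sub>R e i + s *\<^sub>R e j) - f (x + s *\<^sub>R e i) - f (x + s *\<^sub>R e j) + f x = s * s * partial j (partial i f) y1"
      using key by metis
    obtain y2 where y2: "norm (y2 - x) \<le> 2 * \<bar>s\<bar>"
      "f (x + s *\<^sub>R e j + s *\<^sub>R e i) - f (x + s *\<^sub>R e j) - f (x + s *\<^sub>R e i) + f x = s * s * partial i (partial j f) y2"
      using key by metis
    have "s * s * partial j (partial i f) y1 = s * s * partial i (partial j f) y2"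
      using y1(2) y2(2) by (simp add: algebra_simps)
    then have "partial j (partial i f) y1 = partial i (partial j f) y2" using s by simp
    moreover have "dist (partial j (partial i f) y1) (partial j (partial i f) x) < \<epsilon>"
      using y1 s by (intro d2) (auto simp: dist_norm)
    moreover have "dist (partial i (partial j f) y2) (partial i (partial j f) x) < \<epsilon>"
      using y2 s by (intro d1) (auto simp: dist_norm)
    ultimately show False
      unfolding dist_real_def \<epsilon>_def by (smt (verit, best) field_sum_of_halves)
  qed
qed

subsection \<open>A smooth cutoff\<close>

text \<open>Differentiating \<open>q(1/t) exp(-1/t)\<close> gives
  \<open>(1/t)^2 (q - q')(1/t) exp(-1/t)\<close>, so the polynomial in 1/t follows this
  recursion.\<close>

primrec flat_poly :: "nat \<Rightarrow> real poly" where
  "flat_poly 0 = 1"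
| "flat_poly (Suc n) = [:0, 0, 1:] * (flat_poly n - pderiv (flat_poly n))"

text \<open>The \<open>n\<close>-th derivative of the flat function exp(-1/t), extended by zero to t
  \<le> 0.\<close>

definition flat :: "nat \<Rightarrow> real \<Rightarrow> real" where
  "flat n t = (if t > 0 then poly (flat_poly n) (1 / t) * exp (- 1 / t) else 0)"

lemma poly_exp_tendsto_0: "((\<lambda>t. poly q t * exp (- t)) \<longlongrightarrow> 0) (at_top :: real filter)"
proof (induction q)
  case (pCons a q)
  have "((\<lambda>t. poly p t * exp (- t)) \<longlongrightarrow> 0) (at_top :: real filter)" for p :: "real poly"
  proof -
    have "((\<lambda>t. \<Sum>i\<le>degree p. coeff p i * (t ^ i / exp t)) \<longlongrightarrow> (\<Sum>i\<le>degree p. coeff p i * 0)) (at_top :: real filter)"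
      by (intro tendsto_intros tendsto_power_div_exp_0)
    moreover have "(\<Sum>i\<le>degree p. coeff p i * (t ^ i / exp t)) = poly p t * exp (- t)" for t
      by (simp add: poly_altdef sum_distrib_right exp_minus divide_inverse mult.assoc)
    ultimately show ?thesis by simp
  qed
  then show ?case .
qed simp

text \<open>Only t = 0 is delicate: the right difference quotient is again a polynomial in 1/t times
  exp(-1/t), the extra factor 1/t being absorbed into the polynomial, and tends to 0.\<close>

lemma flat_has_derivative: "(flat n has_real_derivative flat (Suc n) t) (at t)"
proof -
  consider "t > 0" | "t < 0" | "t = 0" by linarith
  then show ?thesis
  proof cases
    case 1
    have "((\<lambda>t. poly (flat_poly n) (1 / t) * exp (- 1 / t)) has_real_derivative flat (Suc n) t) (at t)"
    proof -
      have d1: "((\<lambda>t. 1 / t) has_real_derivative - (1 / t)\<^sup>2) (at t)"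
        and d2: "((\<lambda>t. - 1 / t) has_real_derivative (1 / t)\<^sup>2) (at t)"
        using 1 by (auto intro!: derivative_eq_intros simp: power2_eq_square)
      from DERIV_mult[OF DERIV_chain2[OF poly_DERIV[of "flat_poly n"] d1] DERIV_chain2[OF DERIV_exp d2]]
      show ?thesis
        by (rule DERIV_cong) (use 1 in \<open>simp add: flat_def power2_eq_square right_diff_distrib left_diff_distrib mult_ac\<close>)
    qed
    then show ?thesis
      by (rule has_field_derivative_transform_within_open[where S = "{0<..}"])
        (use 1 in \<open>auto simp: flat_def\<close>)
  next
    case 2
    have "((\<lambda>t. 0) has_real_derivative flat (Suc n) t) (at t)"
      using 2 by (auto simp: flat_def)
    then show ?thesis
      by (rule has_field_derivative_transform_within_open[where S = "{..<0}"])
        (use 2 in \<open>auto simp: flat_def\<close>)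
  next
    case 3
    have "((\<lambda>t. flat n t / t) \<longlongrightarrow> 0) (at_right 0)"
    proof -
      have "((\<lambda>t. poly ([:0, 1:] * flat_poly n) (inverse t) * exp (- inverse t)) \<longlongrightarrow> 0) (at_right (0::real))"
        by (rule filterlim_compose[OF poly_exp_tendsto_0 filterlim_inverse_at_top_right])
      moreover have "\<forall>\<^sub>F t in at_right 0. poly ([:0, 1:] * flat_poly n) (inverse t) * exp (- inverse t) = flat n t / t"
        using eventually_at_right_less[of 0]
        by eventually_elim (simp add: flat_def field_simps)
      ultimately show ?thesis by (rule Lim_transform_eventually)
    qed
    moreover have "((\<lambda>t. flat n t / t) \<longlongrightarrow> 0) (at_left 0)"
    proof (rule Lim_transform_eventually)
      show "((\<lambda>t. 0) \<longlongrightarrow> 0) (at_left (0::real))" by simp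
      show "\<forall>\<^sub>F t in at_left 0. 0 = flat n t / t"
        by (auto simp: flat_def eventually_at_filter)
    qed
    ultimately have "((\<lambda>t. flat n t / t) \<longlongrightarrow> 0) (at 0)"
      by (simp add: filterlim_split_at)
    then show ?thesis
      using 3 by (simp add: has_field_derivative_iff flat_def)
  qed
qed

lemma flat_0_pos: "t > 0 \<Longrightarrow> flat 0 t > 0" and flat_0_nonpos: "t \<le> 0 \<Longrightarrow> flat 0 t = 0"
  by (auto simp: flat_def)

lemma flat_0_nonneg: "flat 0 t \<ge> 0"
  by (auto simp: flat_def)

lemma flat_0_mono: "s \<le> t \<Longrightarrow> flat 0 s \<le> flat 0 t"
  by (auto simp: flat_def divide_simps)

lemma smooth3_flat: "smooth3 f \<Longrightarrow> smooth3 (\<lambda>x. flat n (f x))"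
  by (rule smooth3_compose[where D = flat]) (auto intro: flat_has_derivative)

lemma norm_sq3: "(norm (x::real^3))\<^sup>2 = (\<Sum>i\<in>UNIV. (x $ i)\<^sup>2)"
  by (simp add: norm_vec_def L2_set_def real_sqrt_pow2 sum_nonneg)

lemma smooth3_norm_sq: "smooth3 (\<lambda>x. (norm x)\<^sup>2)"
  unfolding norm_sq3 by (intro smooth3_intros)

lemma partial_norm_sq: "partial i (\<lambda>x. (norm x)\<^sup>2) x = 2 * x $ i"
proof -
  have "((\<lambda>x. (norm x)\<^sup>2) has_derivative (\<lambda>h. 2 * (x \<bullet> h))) (at x)"
    unfolding power2_norm_eq_inner
    by (auto intro!: derivative_eq_intros simp: inner_commute)
  from partial_eqI[OF this] show ?thesis by (simp add: inner_axis)
qed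

text \<open>The inner \<open>flat\<close> vanishes for |x| \<le> 1/2, where the quotient is
  therefore 1. At |x| = 1 its argument is 1 - 1/4 = 3/4, so from there on the argument of the outer
  \<open>flat\<close> is nonpositive. The squared norm avoids the singularity of the norm at the
  origin.\<close>

definition cutoff :: "real^3 \<Rightarrow> real" where
  "cutoff x = flat 0 (flat 0 (3/4) - flat 0 ((norm x)\<^sup>2 - 1/4)) / flat 0 (flat 0 (3/4))"

lemma smooth3_cutoff: "smooth3 cutoff"
proof -
  have "smooth3 (\<lambda>x. inverse (flat 0 (flat 0 (3/4))) * flat 0 (flat 0 (3/4) - flat 0 ((norm x)\<^sup>2 - 1/4)))"
    by (intro smooth3_intros smooth3_flat smooth3_norm_sq)
  then show ?thesis by (simp add: cutoff_def[abs_def] field_simps)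
qed

lemma cutoff_eq_1: "norm x \<le> 1/2 \<Longrightarrow> cutoff x = 1"
proof -
  assume "norm x \<le> 1/2"
  then have "(norm x)\<^sup>2 \<le> (1/2)\<^sup>2" by (intro power_mono) auto
  then have "flat 0 ((norm x)\<^sup>2 - 1/4) = 0" by (intro flat_0_nonpos) (simp add: power2_eq_square)
  moreover have "flat 0 (flat 0 (3/4)) > 0" by (intro flat_0_pos) auto
  ultimately show ?thesis by (simp add: cutoff_def)
qed

lemma cutoff_eq_0: "norm x \<ge> 1 \<Longrightarrow> cutoff x = 0"
proof -
  assume "norm x \<ge> 1"
  then have "3/4 \<le> (norm x)\<^sup>2 - 1/4" by (simp add: one_le_power)
  then have "flat 0 (3/4) \<le> flat 0 ((norm x)\<^sup>2 - 1/4)" by (rule flat_0_mono)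
  then show ?thesis by (simp add: cutoff_def flat_0_nonpos)
qed

lemma cutoff_nonneg: "0 \<le> cutoff x" and cutoff_le_1: "cutoff x \<le> 1"
proof -
  have "flat 0 (flat 0 (3/4)) > 0" by (intro flat_0_pos) auto
  then show "0 \<le> cutoff x" "cutoff x \<le> 1"
    by (auto simp: cutoff_def flat_0_nonneg intro!: divide_nonneg_nonneg flat_0_mono)
qed

subsection \<open>Test functions\<close>

lemma test_fun_smooth: "test_fun f \<Longrightarrow> smooth3 f"
  by (simp add: test_fun_def)

lemma test_funI:
  assumes "smooth3 f" "\<And>x. norm x > R \<Longrightarrow> f x = 0"
  shows "test_fun f"
proof -
  have "{x. f x \<noteq> 0} \<subseteq> cball 0 R" using assms(2) by (auto simp: not_less[symmetric])
  then have "bounded {x. f x \<noteq> 0}" using bounded_subset bounded_cball by blast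
  with assms(1) show ?thesis unfolding test_fun_def by (simp add: compact_closure)
qed

lemma test_fun_support:
  assumes "test_fun f" obtains R where "R > 0" "\<And>x. norm x > R \<Longrightarrow> f x = 0"
proof -
  have "bounded {x. f x \<noteq> 0}"
    using assms unfolding test_fun_def by (simp add: compact_closure)
  then obtain R where "R > 0" "\<And>x. f x \<noteq> 0 \<Longrightarrow> norm x \<le> R" unfolding bounded_pos by auto
  then show ?thesis using that by (meson not_less)
qed

lemma test_fun_mult_left: "test_fun f \<Longrightarrow> smooth3 g \<Longrightarrow> test_fun (\<lambda>x. f x * g x)"
proof -
  assume fg: "test_fun f" "smooth3 g"
  obtain R where R: "R > 0" "\<And>x. norm x > R \<Longrightarrow> f x = 0"
    using test_fun_support[OF fg(1)] by metis
  show ?thesis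
    by (rule test_funI[of _ R]) (auto simp: R intro: smooth3_mult test_fun_smooth fg)
qed

lemma test_fun_add:
  assumes "test_fun f" "test_fun g" shows "test_fun (\<lambda>x. f x + g x)"
proof -
  obtain R where R: "R > 0" "\<And>x. norm x > R \<Longrightarrow> f x = 0"
    using test_fun_support[OF assms(1)] by metis
  obtain S where S: "S > 0" "\<And>x. norm x > S \<Longrightarrow> g x = 0"
    using test_fun_support[OF assms(2)] by metis
  show ?thesis
    by (rule test_funI[of _ "max R S"]) (auto simp: R S intro: smooth3_add test_fun_smooth assms)
qed

lemma test_fun_0: "test_fun (\<lambda>x. 0)"
  by (rule test_funI[of _ 0]) (auto intro: smooth3_const)

lemma test_fun_cmult: "test_fun f \<Longrightarrow> test_fun (\<lambda>x. c * f x)"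
  using test_fun_mult_left[of f "\<lambda>x. c"] smooth3_const by (simp add: mult.commute)

lemma test_fun_uminus: "test_fun f \<Longrightarrow> test_fun (\<lambda>x. - f x)"
  using test_fun_cmult[of f "-1"] by simp

lemma test_fun_diff: "test_fun f \<Longrightarrow> test_fun g \<Longrightarrow> test_fun (\<lambda>x. f x - g x)"
  using test_fun_add[of f "\<lambda>x. - g x"] test_fun_uminus by simp

lemma test_fun_sum: "(\<And>a. a \<in> A \<Longrightarrow> test_fun (f a)) \<Longrightarrow> test_fun (\<lambda>x. \<Sum>a\<in>A. f a x)"
  by (induction A rule: infinite_finite_induct) (auto intro: test_fun_add test_fun_0)

lemma partial_eq_0_outside:
  assumes "smooth3 f" "\<And>x. norm x > R \<Longrightarrow> f x = 0" "norm x > R"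
  shows "partial i f x = 0"
proof -
  have "open {x::real^3. norm x > R}" by (intro open_Collect_less continuous_intros)
  then have "partial i f x = partial i (\<lambda>x. 0) x"
    by (rule partial_cong_open) (use assms smooth3_differentiable in auto)
  then show ?thesis by simp
qed

lemma test_fun_partial: "test_fun f \<Longrightarrow> test_fun (partial i f)"
proof -
  assume f: "test_fun f"
  obtain R where R: "R > 0" "\<And>x. norm x > R \<Longrightarrow> f x = 0"
    using test_fun_support[OF f] by metis
  show ?thesis
  proof (rule test_funI)
    show "smooth3 (partial i f)" by (intro smooth3_partial test_fun_smooth f)
    show "partial i f x = 0" if "norm x > R" for x
      using partial_eq_0_outside[OF test_fun_smooth[OF f] R(2) that] .
  qed
qed

lemma test_fun_affine:
  assumes "test_fun f" "a \<noteq> 0"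
  shows "test_fun (\<lambda>x. f (a *\<^sub>R x + b))"
proof -
  obtain R where R: "R > 0" "\<And>x. norm x > R \<Longrightarrow> f x = 0" using test_fun_support assms by metis
  show ?thesis
  proof (rule test_funI[of _ "(R + norm b) / \<bar>a\<bar>"])
    fix x :: "real^3" assume "norm x > (R + norm b) / \<bar>a\<bar>"
    then have "R + norm b < \<bar>a\<bar> * norm x" using assms(2) by (simp add: field_simps)
    moreover have "\<bar>a\<bar> * norm x - norm b \<le> norm (a *\<^sub>R x + b)"
      using norm_diff_ineq[of "a *\<^sub>R x" b] by simp
    ultimately show "f (a *\<^sub>R x + b) = 0" by (intro R(2)) linarith
  qed (intro smooth3_affine test_fun_smooth assms)
qed

lemma test_fun_cutoff: "test_fun cutoff"
  by (rule test_funI[of _ 1]) (auto intro: smooth3_cutoff cutoff_eq_0)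

lemma test_fun_bounded:
  assumes "test_fun f" obtains C where "C > 0" "\<And>x. \<bar>f x\<bar> \<le> C"
proof -
  obtain R where R: "R > 0" "\<And>x. norm x > R \<Longrightarrow> f x = 0" using test_fun_support assms by metis
  have "compact (f ` cball 0 R)"
    by (intro compact_continuous_image smooth3_continuous_on test_fun_smooth assms compact_cball)
  then have "bounded (f ` cball 0 R)" by (rule compact_imp_bounded)
  then obtain C where C: "C > 0" "\<And>y. y \<in> f ` cball 0 R \<Longrightarrow> norm y \<le> C" unfolding bounded_pos by auto
  have "\<bar>f x\<bar> \<le> C" for x
    using C(1) C(2)[of "f x"] R(2)[of x] by (cases "norm x > R") auto
  with C(1) that show ?thesis by blast
qed

lemma abs_component_le_norm: "\<bar>h $ i\<bar> \<le> norm (h :: real^3)"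
  by (rule component_le_norm_cart)

lemma test_fun_lipschitz:
  assumes "test_fun f" obtains C where "C > 0" "\<And>x h. \<bar>f (x + h) - f x\<bar> \<le> C * norm h"
proof -
  have "\<forall>i. \<exists>C>0. \<forall>x. \<bar>partial i f x\<bar> \<le> C"
    using test_fun_bounded[OF test_fun_partial[OF assms]] by metis
  then obtain C where C: "\<And>i. C i > 0" "\<And>i x. \<bar>partial i f x\<bar> \<le> C i" by metis
  have bd: "\<bar>f (x + h) - f x\<bar> \<le> (\<Sum>i\<in>UNIV. C i) * norm h" for x h
  proof -
    obtain t where "f (x + h) - f x = (\<Sum>i\<in>UNIV. h $ i * partial i f (x + t *\<^sub>R h))"
      using mvt_partial[OF test_fun_smooth[OF assms]] by metis
    then have "\<bar>f (x + h) - f x\<bar> \<le> (\<Sum>i\<in>UNIV. \<bar>h $ i * partial i f (x + t *\<^sub>R h)\<bar>)" by auto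
    also have "\<dots> \<le> (\<Sum>i\<in>UNIV. norm h * C i)"
      unfolding abs_mult by (intro sum_mono mult_mono abs_component_le_norm C) auto
    also have "\<dots> = (\<Sum>i\<in>UNIV. C i) * norm h"
      unfolding sum_distrib_right by (intro sum.cong) auto
    finally show ?thesis .
  qed
  have "(\<Sum>i\<in>UNIV. C i) > 0" by (intro sum_pos C) auto
  from that[OF this bd] show ?thesis .
qed

text \<open>The constant is independent of the base point, so the remainder can be integrated in
  \<open>x\<close>. This serves both the vanishing integral of a derivative and differentiation
  under a convolution.\<close>

lemma test_fun_taylor:
  assumes "test_fun f"
  obtains C where "C > 0"
    "\<And>x h. \<bar>f (x + h) - f x - (\<Sum>i\<in>UNIV. h $ i * partial i f x)\<bar> \<le> C * (norm h)\<^sup>2"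
proof -
  have "\<forall>i. \<exists>C>0. \<forall>x h. \<bar>partial i f (x + h) - partial i f x\<bar> \<le> C * norm h"
    using test_fun_lipschitz[OF test_fun_partial[OF assms]] by metis
  then obtain C where C: "\<And>i. C i > 0" "\<And>i x h. \<bar>partial i f (x + h) - partial i f x\<bar> \<le> C i * norm h" by metis
  have bd: "\<bar>f (x + h) - f x - (\<Sum>i\<in>UNIV. h $ i * partial i f x)\<bar> \<le> (\<Sum>i\<in>UNIV. C i) * (norm h)\<^sup>2" for x h
  proof -
    obtain t where t: "0 < t" "t < 1" "f (x + h) - f x = (\<Sum>i\<in>UNIV. h $ i * partial i f (x + t *\<^sub>R h))"
      using mvt_partial[OF test_fun_smooth[OF assms]] by metis
    have "\<bar>f (x + h) - f x - (\<Sum>i\<in>UNIV. h $ i * partial i f x)\<bar>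
        = \<bar>\<Sum>i\<in>UNIV. h $ i * (partial i f (x + t *\<^sub>R h) - partial i f x)\<bar>"
      unfolding t(3) by (simp add: sum_subtractf right_diff_distrib)
    also have "\<dots> \<le> (\<Sum>i\<in>UNIV. \<bar>h $ i * (partial i f (x + t *\<^sub>R h) - partial i f x)\<bar>)" by auto
    also have "\<dots> \<le> (\<Sum>i\<in>UNIV. norm h * (C i * norm h))"
    proof (intro sum_mono)
      fix i
      have "\<bar>partial i f (x + t *\<^sub>R h) - partial i f x\<bar> \<le> C i * norm (t *\<^sub>R h)" by (rule C)
      also have "\<dots> \<le> C i * norm h"
        using t C(1)[of i] by (intro mult_left_mono) (auto intro!: mult_left_le_one_le)
      finally show "\<bar>h $ i * (partial i f (x + t *\<^sub>R h) - partial i f x)\<bar> \<le> norm h * (C i * norm h)"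
        unfolding abs_mult by (intro mult_mono abs_component_le_norm) auto
    qed
    also have "\<dots> = (\<Sum>i\<in>UNIV. C i) * (norm h)\<^sup>2"
      unfolding sum_distrib_right by (intro sum.cong) (auto simp: power2_eq_square)
    finally show ?thesis .
  qed
  have "(\<Sum>i\<in>UNIV. C i) > 0" by (intro sum_pos C) auto
  from that[OF this bd] show ?thesis .
qed

subsection \<open>Local integrability and convolution\<close>

text \<open>Borel rather than Lebesgue measurability is built in, since translation, reflection and
  Fubini arguments on \<open>lborel\<close> need it. The given Lebesgue measurable fields are
  replaced by Borel representatives in the final proof.\<close>

definition locint :: "(real^3 \<Rightarrow> real) \<Rightarrow> bool" where
  "locint f \<longleftrightarrow> f \<in> borel_measurable borel \<and> (\<forall>R. integrable lborel (\<lambda>x. indicator (cball 0 R) x * f x))"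

lemma locint_borel: "locint f \<Longrightarrow> f \<in> borel_measurable borel"
  by (simp add: locint_def)

lemma integral_translate:
  fixes f :: "'a::euclidean_space \<Rightarrow> real"
  assumes "f \<in> borel_measurable borel"
  shows "(\<integral>x. f (c + x) \<partial>lborel) = (\<integral>x. f x \<partial>lborel)"
proof -
  have "(\<integral>x. f x \<partial>lborel) = (\<integral>x. f x \<partial>distr lborel borel ((+) c))"
    by (simp add: lborel_distr_plus)
  also have "\<dots> = (\<integral>x. f (c + x) \<partial>lborel)"
    using assms by (subst integral_distr) auto
  finally show ?thesis by simp
qed

lemma nn_integral_translate:
  fixes f :: "'a::euclidean_space \<Rightarrow> ennreal"
  assumes "f \<in> borel_measurable borel"
  shows "(\<integral>\<^sup>+x. f (c + x) \<partial>lborel) = (\<integral>\<^sup>+x. f x \<partial>lborel)"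
proof -
  have "(\<integral>\<^sup>+x. f x \<partial>lborel) = (\<integral>\<^sup>+x. f x \<partial>distr lborel borel ((+) c))"
    by (simp add: lborel_distr_plus)
  also have "\<dots> = (\<integral>\<^sup>+x. f (c + x) \<partial>lborel)"
    using assms by (subst nn_integral_distr) auto
  finally show ?thesis by simp
qed

lemma lborel_distr_reflect: "distr lborel borel (\<lambda>x. c - x) = (lborel :: 'a::euclidean_space measure)"
proof -
  have "density (distr lborel borel (\<lambda>x. c + (-1) *\<^sub>R x)) (\<lambda>_. ennreal (\<bar>-1\<bar> ^ DIM('a))) = (lborel :: 'a measure)"
    by (rule lborel_affine[symmetric]) simp
  moreover have "density M (\<lambda>_. 1) = M" for M :: "'a measure"
    by (intro measure_eqI) (auto simp: emeasure_density)
  ultimately show ?thesis by simp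
qed

lemma integral_reflect:
  fixes f :: "'a::euclidean_space \<Rightarrow> real"
  assumes "f \<in> borel_measurable borel"
  shows "(\<integral>x. f (c - x) \<partial>lborel) = (\<integral>x. f x \<partial>lborel)"
proof -
  have "(\<integral>x. f x \<partial>lborel) = (\<integral>x. f x \<partial>distr lborel borel (\<lambda>x. c - x))"
    by (simp add: lborel_distr_reflect)
  also have "\<dots> = (\<integral>x. f (c - x) \<partial>lborel)"
    using assms by (subst integral_distr) auto
  finally show ?thesis by simp
qed

lemma nn_integral_reflect:
  fixes f :: "'a::euclidean_space \<Rightarrow> ennreal"
  assumes "f \<in> borel_measurable borel"
  shows "(\<integral>\<^sup>+x. f (c - x) \<partial>lborel) = (\<integral>\<^sup>+x. f x \<partial>lborel)"
proof -
  have "(\<integral>\<^sup>+x. f x \<partial>lborel) = (\<integral>\<^sup>+x. f x \<partial>distr lborel borel (\<lambda>x. c - x))"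
    by (simp add: lborel_distr_reflect)
  also have "\<dots> = (\<integral>\<^sup>+x. f (c - x) \<partial>lborel)"
    using assms by (subst nn_integral_distr) auto
  finally show ?thesis by simp
qed

lemma integrable_indicator_cball: "integrable lborel (indicator (cball (a::real^3) R) :: _ \<Rightarrow> real)"
  using emeasure_lborel_cball_finite[of a R] by (intro integrable_real_indicator) auto

lemma locint_mult_integrable:
  assumes "locint f" "k \<in> borel_measurable borel" "\<And>x. \<bar>k x\<bar> \<le> C" "\<And>x. norm x > R \<Longrightarrow> k x = 0"
  shows "integrable lborel (\<lambda>x. k x * f x)"
proof (rule Bochner_Integration.integrable_bound)
  show "integrable lborel (\<lambda>x. C * (indicator (cball 0 R) x * f x))"
    using assms(1) by (auto simp: locint_def)
  show "(\<lambda>x. k x * f x) \<in> borel_measurable lborel"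
    using assms(2) locint_borel[OF assms(1)] by simp
  show "AE x in lborel. norm (k x * f x) \<le> norm (C * (indicator (cball 0 R) x * f x))"
  proof (rule AE_I2)
    fix x
    have "\<bar>k x\<bar> \<le> \<bar>C\<bar>" using assms(3)[of x] by linarith
    then show "norm (k x * f x) \<le> norm (C * (indicator (cball 0 R) x * f x))"
      using assms(4)[of x] by (cases "norm x > R") (auto simp: abs_mult mult_right_mono)
  qed
qed

lemma locint_test_integrable:
  assumes "locint f" "test_fun k" shows "integrable lborel (\<lambda>x. k x * f x)"
proof -
  obtain R where "R > 0" "\<And>x. norm x > R \<Longrightarrow> k x = 0" using test_fun_support[OF assms(2)] by metis
  moreover obtain C where "C > 0" "\<And>x. \<bar>k x\<bar> \<le> C" using test_fun_bounded[OF assms(2)] by metis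
  ultimately show ?thesis
    using assms smooth3_borel test_fun_smooth by (intro locint_mult_integrable) auto
qed

lemma locint_bounded:
  assumes "f \<in> borel_measurable borel" "\<And>x. \<bar>f x\<bar> \<le> C"
  shows "locint f"
  unfolding locint_def
proof (intro conjI allI assms)
  fix R :: real
  show "integrable lborel (\<lambda>x. indicator (cball 0 R) x * f x)"
  proof (rule Bochner_Integration.integrable_bound)
    show "integrable lborel (\<lambda>x. C * indicator (cball (0::real^3) R) x :: real)"
      by (intro integrable_mult_right integrable_indicator_cball)
    show "AE x in lborel. norm (indicator (cball 0 R) x * f x) \<le> norm (C * indicator (cball 0 R) x :: real)"
      using assms(2) by (auto simp: indicator_def intro: order_trans[OF _ abs_ge_self])
    show "(\<lambda>x. indicator (cball 0 R) x * f x) \<in> borel_measurable lborel"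
      using assms(1) by (intro borel_measurable_times borel_measurable_indicator) auto
  qed
qed

lemma test_fun_integrable: "test_fun k \<Longrightarrow> integrable lborel k"
  using locint_test_integrable[of "\<lambda>x. 1" k] locint_bounded[of "\<lambda>x. 1" 1] by simp

lemma smooth3_locint: 
  assumes "smooth3 f" shows "locint f"
  unfolding locint_def
proof (intro conjI allI smooth3_borel assms)
  fix R :: real
  have "integrable lborel (\<lambda>x. indicator (cball 0 R) x *\<^sub>R f x)"
    by (intro borel_integrable_compact smooth3_continuous_on assms compact_cball)
  then show "integrable lborel (\<lambda>x. indicator (cball 0 R) x * f x)"
    by simp
qed

text \<open>By translation invariance \<open>f(x + s e) - f(x)\<close> has integral zero, while by
  Taylor it equals \<open>s\<close> times the derivative up to \<open>C s^2\<close> on a fixed ball.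
  Hence \<open>s |I|\<close> is at most \<open>C V s^2\<close> for all small \<open>s\<close>, which
  forces I = 0.\<close>

lemma integral_partial_eq_0:
  assumes "test_fun f"
  shows "(\<integral>x. partial i f x \<partial>lborel) = 0"
proof (rule ccontr)
  define I where "I = (\<integral>x. partial i f x \<partial>lborel)"
  assume "\<not> ?thesis"
  then have I: "\<bar>I\<bar> > 0" by (simp add: I_def)
  obtain R where R: "R > 0" "\<And>x. norm x > R \<Longrightarrow> f x = 0" using test_fun_support[OF assms] by metis
  obtain C where C: "C > 0"
    "\<And>x h. \<bar>f (x + h) - f x - (\<Sum>i\<in>UNIV. h $ i * partial i f x)\<bar> \<le> C * (norm h)\<^sup>2"
    using test_fun_taylor[OF assms] by metis
  \<comment> \<open>Shifts have length at most 1, so the ball of radius R + 1 contains everything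
    for all admissible \<open>s\<close>.\<close>
  define V where "V = (\<integral>x. indicator (cball (0::real^3) (R + 1)) x \<partial>lborel :: real)"
  have V: "V \<ge> 0" unfolding V_def by simp
  have key: "s * \<bar>I\<bar> \<le> C * s\<^sup>2 * V" if s: "0 < s" "s \<le> 1" for s
  proof -
    define g where "g x = f (s *\<^sub>R axis i 1 + x) - f x - s * partial i f x" for x
    have tf: "test_fun (\<lambda>x. f (s *\<^sub>R axis i 1 + x))"
      using test_fun_affine[OF assms, of 1 "s *\<^sub>R axis i 1"] by (simp add: add.commute)
    have ints: "integrable lborel (\<lambda>x. f (s *\<^sub>R axis i 1 + x))" "integrable lborel f"
       "integrable lborel (partial i f)"
      using tf assms by (auto intro: test_fun_integrable test_fun_partial)
    have "(\<integral>x. g x \<partial>lborel) = - s * I"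
      unfolding g_def I_def using ints integral_translate[of f "s *\<^sub>R axis i 1"]
      by (simp add: smooth3_borel test_fun_smooth assms)
    moreover have "\<bar>\<integral>x. g x \<partial>lborel\<bar> \<le> (\<integral>x. C * s\<^sup>2 * indicator (cball (0::real^3) (R + 1)) x \<partial>lborel)"
    proof (rule order_trans[OF integral_abs_bound], rule integral_mono)
      show "integrable lborel (\<lambda>x. \<bar>g x\<bar>)" unfolding g_def using ints by auto
      show "integrable lborel (\<lambda>x. C * s\<^sup>2 * indicator (cball (0::real^3) (R + 1)) x :: real)"
        by (intro integrable_mult_right integrable_indicator_cball)
      fix x :: "real^3"
      have ax: "(\<Sum>j\<in>UNIV. (s *\<^sub>R axis i 1 :: real^3) $ j * partial j f x) = s * partial i f x"
      proof -
        have "(\<Sum>j\<in>UNIV. (s *\<^sub>R axis i 1 :: real^3) $ j * partial j f x) = (\<Sum>j\<in>UNIV. if j = i then s * partial j f x else 0)"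
          by (rule sum.cong) (auto simp: axis_def)
        then show ?thesis by simp
      qed
      show "\<bar>g x\<bar> \<le> C * s\<^sup>2 * indicator (cball 0 (R + 1)) x"
      proof (cases "norm x \<le> R + 1")
        case True
        then show ?thesis
          using C(2)[of x "s *\<^sub>R axis i 1"] s unfolding ax by (simp add: g_def add.commute)
      next
        case False
        have "norm x - s \<le> norm (s *\<^sub>R axis i 1 + x)"
          using norm_triangle_ineq2[of x "- (s *\<^sub>R axis i 1)"] s by (simp add: add.commute)
        then have "f (s *\<^sub>R axis i 1 + x) = 0" "f x = 0"
          using False s by (auto intro!: R(2))
        moreover have "partial i f x = 0"
          using partial_eq_0_outside[OF test_fun_smooth[OF assms] R(2)] False by auto
        ultimately show ?thesis using C(1) by (simp add: g_def)
      qed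
    qed
    ultimately show ?thesis using s by (simp add: V_def abs_mult)
  qed
  \<comment> \<open>Makes \<open>s * (C * V)\<close> at most |I|/2; the added 1 keeps the
    denominator positive.\<close>
  define s where "s = min 1 (\<bar>I\<bar> / (2 * (C * V + 1)))"
  have CV: "C * V + 1 > 0" using C V by (auto intro!: add_nonneg_pos)
  then have s: "0 < s" "s \<le> 1" "s \<le> \<bar>I\<bar> / (2 * (C * V + 1))" unfolding s_def using I by auto
  have "s * \<bar>I\<bar> \<le> s * (s * (C * V))" using key[OF s(1,2)] by (simp add: power2_eq_square mult_ac)
  then have "\<bar>I\<bar> \<le> s * (C * V)" using s(1) by simp
  also have "\<dots> \<le> \<bar>I\<bar> / (2 * (C * V + 1)) * (C * V + 1)"
    using s V C CV by (intro mult_mono) auto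
  also have "\<dots> = \<bar>I\<bar> / 2"
  proof -
    have "\<bar>I\<bar> / (2 * D) * D = \<bar>I\<bar> / 2" if "D > 0" for D using that by simp
    from this[OF CV] show ?thesis .
  qed
  finally show False using I by simp
qed

lemma integral_by_parts:
  assumes "test_fun f" "smooth3 g"
  shows "(\<integral>x. f x * partial i g x \<partial>lborel) = - (\<integral>x. partial i f x * g x \<partial>lborel)"
proof -
  have sf: "smooth3 f" using assms(1) by (rule test_fun_smooth)
  have "0 = (\<integral>x. f x * partial i g x + partial i f x * g x \<partial>lborel)"
    using integral_partial_eq_0[OF test_fun_mult_left[OF assms], of i]
    by (simp add: partial_smooth_mult[OF sf assms(2)])
  also have "\<dots> = (\<integral>x. f x * partial i g x \<partial>lborel) + (\<integral>x. partial i f x * g x \<partial>lborel)"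
    by (intro Bochner_Integration.integral_add test_fun_integrable test_fun_mult_left test_fun_partial
        smooth3_partial assms)
  finally show ?thesis by simp
qed

section \<open>Convolution with a test function\<close>

definition conv :: "(real^3 \<Rightarrow> real) \<Rightarrow> (real^3 \<Rightarrow> real) \<Rightarrow> real^3 \<Rightarrow> real" where
  "conv k f x = (\<integral>y. k (x - y) * f y \<partial>lborel)"

lemma conv_integrable:
  assumes "test_fun k" "locint f"
  shows "integrable lborel (\<lambda>y. k (x - y) * f y)"
  using locint_test_integrable[OF assms(2) test_fun_affine[OF assms(1), of "-1" x]] by simp

text \<open>The Taylor remainder of the kernel is integrated against |f|. The result is quadratic in
  the increment because, for increments below 1, the integrand lives on one ball on which
  \<open>f\<close> is integrable.\<close>

lemma conv_has_derivative:
  assumes k: "test_fun k" and f: "locint f"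
  shows "(conv k f has_derivative (\<lambda>h. \<Sum>i\<in>UNIV. h $ i * conv (partial i k) f x)) (at x)"
proof -
  obtain R where R: "R > 0" "\<And>x. norm x > R \<Longrightarrow> k x = 0" using test_fun_support[OF k] by metis
  obtain C where C: "C > 0"
    "\<And>x h. \<bar>k (x + h) - k x - (\<Sum>i\<in>UNIV. h $ i * partial i k x)\<bar> \<le> C * (norm h)\<^sup>2"
    using test_fun_taylor[OF k] by metis
  define V where "V = (\<integral>y. \<bar>indicator (cball 0 (norm x + 1 + R)) y * f y\<bar> \<partial>lborel)"
  have key: "\<bar>conv k f y - conv k f x - (\<Sum>i\<in>UNIV. (y - x) $ i * conv (partial i k) f x)\<bar> \<le> C * (norm (y - x))\<^sup>2 * V"
    if "dist y x < 1" for y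
  proof -
    define h where "h = y - x"
    have h: "norm h \<le> 1" using that by (simp add: h_def dist_norm)
    define g where "g z = k (x - z + h) - k (x - z) - (\<Sum>i\<in>UNIV. h $ i * partial i k (x - z))" for z
    have e: "k (y - z) = k (x - z + h)" for z by (simp add: h_def algebra_simps)
    have "conv k f y - conv k f x - (\<Sum>i\<in>UNIV. h $ i * conv (partial i k) f x)
       = (\<integral>z. k (y - z) * f z - k (x - z) * f z - (\<Sum>i\<in>UNIV. h $ i * (partial i k (x - z) * f z)) \<partial>lborel)"
      unfolding conv_def using conv_integrable[OF k f] conv_integrable[OF test_fun_partial[OF k] f] by simp
    also have "\<dots> = (\<integral>z. g z * f z \<partial>lborel)"
      unfolding g_def e by (simp add: left_diff_distrib sum_distrib_right mult.assoc)
    finally have eq: "conv k f y - conv k f x - (\<Sum>i\<in>UNIV. h $ i * conv (partial i k) f x) = (\<integral>z. g z * f z \<partial>lborel)" .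
    have "\<bar>\<integral>z. g z * f z \<partial>lborel\<bar> \<le> (\<integral>z. C * (norm h)\<^sup>2 * \<bar>indicator (cball 0 (norm x + 1 + R)) z * f z\<bar> \<partial>lborel)"
    proof (rule integral_abs_bound_integral)
      have "integrable lborel (\<lambda>z. k (y - z) * f z - k (x - z) * f z - (\<Sum>i\<in>UNIV. h $ i * (partial i k (x - z) * f z)))"
        using conv_integrable[OF k f] conv_integrable[OF test_fun_partial[OF k] f] by simp
      moreover have "k (y - z) * f z - k (x - z) * f z - (\<Sum>i\<in>UNIV. h $ i * (partial i k (x - z) * f z)) = g z * f z" for z
        unfolding g_def e by (simp add: left_diff_distrib sum_distrib_right mult.assoc)
      ultimately show "integrable lborel (\<lambda>z. g z * f z)" by simp
      show "integrable lborel (\<lambda>z. C * (norm h)\<^sup>2 * \<bar>indicator (cball 0 (norm x + 1 + R)) z * f z\<bar>)"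
        using f by (intro integrable_mult_right integrable_abs) (auto simp: locint_def)
      fix z
      show "\<bar>g z * f z\<bar> \<le> C * (norm h)\<^sup>2 * \<bar>indicator (cball 0 (norm x + 1 + R)) z * f z\<bar>"
      proof (cases "norm z \<le> norm x + 1 + R")
        case True
        then show ?thesis using C(2)[of "x - z" h] by (auto simp: abs_mult g_def intro: mult_right_mono)
      next
        case False
        have "norm (x - z) > R" "norm (x - z + h) > R"
          using False h norm_triangle_ineq2[of z x] norm_triangle_ineq2[of "z - x" h]
          by (auto simp: norm_minus_commute algebra_simps)
        then have "g z = 0"
          unfolding g_def using R(2) partial_eq_0_outside[OF test_fun_smooth[OF k] R(2)] by simp
        then show ?thesis using C(1) by simp
      qed
    qed
    then show ?thesis using eq by (simp add: h_def V_def)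
  qed
  show ?thesis
  proof (rule has_derivativeI_sandwich[where e = 1 and H = "\<lambda>y. C * V * norm (y - x)"])
    show "bounded_linear (\<lambda>h. \<Sum>i\<in>UNIV. h $ i * conv (partial i k) f x)"
      by (intro bounded_linear_sum bounded_linear_mult_const bounded_linear_vec_nth)
    have "((\<lambda>y. C * V * norm (y - x)) \<longlongrightarrow> C * V * norm (x - x)) (at x)"
      by (intro tendsto_intros)
    then show "((\<lambda>y. C * V * norm (y - x)) \<longlongrightarrow> 0) (at x)" by simp
    fix y assume "y \<noteq> x" "dist y x < 1"
    with key[of y] show "norm (conv k f y - conv k f x - (\<Sum>i\<in>UNIV. (y - x) $ i * conv (partial i k) f x)) / norm (y - x)
       \<le> C * V * norm (y - x)"
      by (simp add: divide_simps power2_eq_square mult_ac)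
  qed simp
qed

lemma partial_conv:
  assumes "test_fun k" "locint f"
  shows "partial i (conv k f) = conv (partial i k) f"
proof
  fix x
  have "(\<Sum>j\<in>UNIV. axis i 1 $ j * conv (partial j k) f x) = (\<Sum>j\<in>UNIV. if j = i then conv (partial j k) f x else 0)"
    by (rule sum.cong) (auto simp: axis_def)
  with partial_eqI[OF conv_has_derivative[OF assms]]
  show "partial i (conv k f) x = conv (partial i k) f x" by simp
qed

text \<open>Derivatives fall on the kernel, so the convolutions of \<open>f\<close> with arbitrary
  test functions form a set closed under partial derivatives, which is the generating set used
  here.\<close>

lemma smooth3_conv:
  assumes "test_fun k" "locint f"
  shows "smooth3 (conv k f)"
proof (rule alg_smooth3[of "{conv k f | k. test_fun k}"])
  fix g x assume "g \<in> {conv k f | k. test_fun k}"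
  then show "g differentiable (at x)"
    using conv_has_derivative[OF _ assms(2)] by (auto simp: differentiable_def)
next
  fix g i assume "g \<in> {conv k f | k. test_fun k}"
  then obtain k where "g = conv k f" "test_fun k" by auto
  then show "alg {conv k f | k. test_fun k} (partial i g)"
    by (auto simp: partial_conv assms intro!: alg.base test_fun_partial)
qed (use assms in \<open>auto intro: alg.base\<close>)

subsection \<open>Approximate identities\<close>

lemma cball_measurable [measurable]: "cball (c :: 'a::euclidean_space) r \<in> sets borel"
  by simp

text \<open>First \<open>f\<close> is cut off in space by \<open>tent\<close> and in height by
  \<open>clip\<close>. The truncation is then approximated pointwise by continuous functions, and
  truncating these in the same way supplies the domination needed for convergence in L^1.\<close>

lemma exists_continuous_approx_L1:
  fixes f :: "real^3 \<Rightarrow> real"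
  assumes f: "integrable lborel f" and e: "e > 0"
  obtains g R where "continuous_on UNIV g" "\<And>x. norm x > R \<Longrightarrow> g x = 0" "R > 0"
    "integrable lborel g" "(\<integral>x. \<bar>f x - g x\<bar> \<partial>lborel) < e"
proof -
  have fb: "f \<in> borel_measurable borel" using f by auto
  define tent where "tent T x = max 0 (min 1 (T - norm x))" for T and x :: "real^3"
  define clip where "clip T y = max (-T) (min T y)" for T y :: real
  have clip_le: "\<bar>clip T y\<bar> \<le> T" if "T \<ge> 0" for T y using that by (auto simp: clip_def)
  have clip_le': "\<bar>clip T y\<bar> \<le> \<bar>y\<bar>" if "T \<ge> 0" for T y using that by (auto simp: clip_def)
  have tent01: "0 \<le> tent T x" "tent T x \<le> 1" for T x by (auto simp: tent_def)
  have tent0: "tent T x = 0" if "norm x > T" for T x using that by (auto simp: tent_def)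
  have "(\<lambda>n. \<integral>x. \<bar>f x - tent (real n) x * clip (real n) (f x)\<bar> \<partial>lborel) \<longlonglongrightarrow> integral\<^sup>L lborel (\<lambda>x::real^3. 0 :: real)"
  proof (rule integral_dominated_convergence[where w = "\<lambda>x. 2 * \<bar>f x\<bar>"])
    show "(\<lambda>x. \<bar>f x - tent (real n) x * clip (real n) (f x)\<bar>) \<in> borel_measurable lborel" for n
      using fb unfolding tent_def clip_def by measurable
    show "AE x in lborel. (\<lambda>n. \<bar>f x - tent (real n) x * clip (real n) (f x)\<bar>) \<longlonglongrightarrow> 0"
    proof (rule AE_I2, rule tendsto_eventually)
      fix x
      obtain N where N: "real N > norm x + 1 + \<bar>f x\<bar>" using reals_Archimedean2 by blast
      show "\<forall>\<^sub>F n in sequentially. \<bar>f x - tent (real n) x * clip (real n) (f x)\<bar> = 0"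
        unfolding eventually_sequentially
      proof (intro exI[of _ N] allI impI)
        fix n assume "N \<le> n"
        then have n': "real n > norm x + 1 + \<bar>f x\<bar>" using N by linarith
        have "tent (real n) x = 1" "clip (real n) (f x) = f x"
        proof -
          have "- real n \<le> f x" "f x \<le> real n" "1 \<le> real n - norm x"
            using norm_ge_zero[of x] abs_ge_self[of "f x"] abs_ge_minus_self[of "f x"] n' by linarith+
          then show "tent (real n) x = 1" "clip (real n) (f x) = f x"
            by (auto simp: tent_def clip_def)
        qed
        then show "\<bar>f x - tent (real n) x * clip (real n) (f x)\<bar> = 0" by simp
      qed
    qed
    show "AE x in lborel. norm \<bar>f x - tent (real n) x * clip (real n) (f x)\<bar> \<le> 2 * \<bar>f x\<bar>" for n
    proof (rule AE_I2)
      fix x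
      have "\<bar>tent (real n) x * clip (real n) (f x)\<bar> \<le> 1 * \<bar>f x\<bar>"
        unfolding abs_mult using tent01[of "real n" x] clip_le' by (intro mult_mono) auto
      then show "norm \<bar>f x - tent (real n) x * clip (real n) (f x)\<bar> \<le> 2 * \<bar>f x\<bar>"
        by simp
    qed
  qed (use f in auto)
  then have "\<forall>\<^sub>F n in sequentially. (\<integral>x. \<bar>f x - tent (real n) x * clip (real n) (f x)\<bar> \<partial>lborel) < e / 2"
    using e by (intro order_tendstoD) auto
  then obtain n where n0: "n > 0" "(\<integral>x. \<bar>f x - tent (real n) x * clip (real n) (f x)\<bar> \<partial>lborel) < e / 2"
    by (metis (no_types, lifting) eventually_conj eventually_gt_at_top eventually_happens' trivial_limit_sequentially)
  define T where "T = real n"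
  have T: "T > 0" "(\<integral>x. \<bar>f x - tent T x * clip T (f x)\<bar> \<partial>lborel) < e / 2"
    using n0 by (auto simp: T_def)
  \<comment> \<open>This notion of measurability yields continuous functions converging to
    \<open>f\<close> off a negligible set, but without any dominating function.\<close>
  have "f measurable_on UNIV"
  proof (rule lebesgue_measurable_imp_measurable_on_real)
    show "f \<in> borel_measurable lebesgue" using fb by (intro measurable_completion) simp
  qed (use sets.top[of "lebesgue :: (real^3) measure"] in simp)
  then obtain N g where g: "negligible N" "\<And>n. continuous_on UNIV (g n)" "\<And>x. x \<notin> N \<Longrightarrow> (\<lambda>n. g n x) \<longlonglongrightarrow> f x"
    unfolding measurable_on_def by auto
  have contT: "continuous_on UNIV (\<lambda>x. tent T x * clip T (g n x))" for n
    unfolding tent_def clip_def by (intro continuous_intros g(2))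
  have bdT: "\<bar>tent T x * clip T y\<bar> \<le> T * indicator (cball 0 T) x" for x y
  proof -
    have "\<bar>tent T x * clip T y\<bar> \<le> 1 * T"
      unfolding abs_mult using tent01[of T x] clip_le[of T] T by (intro mult_mono) auto
    then show ?thesis using tent0[of T x] by (cases "norm x > T") auto
  qed
  have intT: "integrable lborel (\<lambda>x. T * indicator (cball 0 T) (x::real^3) :: real)"
    by (intro integrable_mult_right integrable_indicator_cball)
  have itf: "integrable lborel (\<lambda>x. tent T x * clip T (f x))"
    by (rule Bochner_Integration.integrable_bound[OF intT])
      (use fb bdT in \<open>auto simp: tent_def clip_def intro!: order_trans[OF bdT[unfolded tent_def clip_def]]\<close>)
  have itg: "integrable lborel (\<lambda>x. tent T x * clip T (g n x))" for n
  proof (rule Bochner_Integration.integrable_bound[OF intT])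
    show "(\<lambda>x. tent T x * clip T (g n x)) \<in> borel_measurable lborel"
      using borel_measurable_continuous_onI[OF contT] by simp
  qed (auto intro!: order_trans[OF bdT])
  have "(\<lambda>n. \<integral>x. \<bar>tent T x * clip T (f x) - tent T x * clip T (g n x)\<bar> \<partial>lborel) \<longlonglongrightarrow> integral\<^sup>L lborel (\<lambda>x::real^3. 0 :: real)"
  proof (rule integral_dominated_convergence[where w = "\<lambda>x. 2 * (T * indicator (cball 0 T) x)"])
    show "(\<lambda>x. \<bar>tent T x * clip T (f x) - tent T x * clip T (g n x)\<bar>) \<in> borel_measurable lborel" for n
      using itf itg[of n] by auto
    have "AE x in lebesgue. x \<notin> N"
      using g(1) by (intro AE_not_in) (simp add: negligible_iff_null_sets)
    then have "AE x in lborel. x \<notin> N"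
      by (simp add: AE_completion_iff)
    then show "AE x in lborel. (\<lambda>n. \<bar>tent T x * clip T (f x) - tent T x * clip T (g n x)\<bar>) \<longlonglongrightarrow> 0"
    proof eventually_elim
      fix x assume "x \<notin> N"
      then have "(\<lambda>n. \<bar>tent T x * clip T (f x) - tent T x * clip T (g n x)\<bar>) \<longlonglongrightarrow> \<bar>tent T x * clip T (f x) - tent T x * clip T (f x)\<bar>"
        unfolding clip_def by (intro tendsto_intros g(3))
      then show "(\<lambda>n. \<bar>tent T x * clip T (f x) - tent T x * clip T (g n x)\<bar>) \<longlonglongrightarrow> 0" by simp
    qed
    show "AE x in lborel. norm \<bar>tent T x * clip T (f x) - tent T x * clip T (g n x)\<bar> \<le> 2 * (T * indicator (cball 0 T) x)" for n
    proof (rule AE_I2)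
      fix x
      show "norm \<bar>tent T x * clip T (f x) - tent T x * clip T (g n x)\<bar> \<le> 2 * (T * indicator (cball 0 T) x)"
        using bdT[of x "f x"] bdT[of x "g n x"] by (simp only: real_norm_def abs_idempotent)
    qed
  qed (use intT in auto)
  then have "\<forall>\<^sub>F n in sequentially. (\<integral>x. \<bar>tent T x * clip T (f x) - tent T x * clip T (g n x)\<bar> \<partial>lborel) < e / 2"
    using e by (intro order_tendstoD) auto
  then obtain n where n: "(\<integral>x. \<bar>tent T x * clip T (f x) - tent T x * clip T (g n x)\<bar> \<partial>lborel) < e / 2"
    by (metis (no_types, lifting) eventually_happens' trivial_limit_sequentially)
  define h where "h x = tent T x * clip T (g n x)" for x
  have "(\<integral>x. \<bar>f x - h x\<bar> \<partial>lborel) \<le> (\<integral>x. \<bar>f x - tent T x * clip T (f x)\<bar> + \<bar>tent T x * clip T (f x) - h x\<bar> \<partial>lborel)"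
    by (intro integral_mono) (use f itf itg[of n] in \<open>auto simp: h_def\<close>)
  also have "\<dots> = (\<integral>x. \<bar>f x - tent T x * clip T (f x)\<bar> \<partial>lborel) + (\<integral>x. \<bar>tent T x * clip T (f x) - h x\<bar> \<partial>lborel)"
    by (intro Bochner_Integration.integral_add) (use f itf itg[of n] in \<open>auto simp: h_def\<close>)
  also have "\<dots> < e" using T(2) n by (simp add: h_def)
  finally have "(\<integral>x. \<bar>f x - h x\<bar> \<partial>lborel) < e" .
  then show ?thesis
    using that[of h T] contT[of n] itg[of n] tent0 T(1) by (auto simp: h_def[abs_def])
qed

text \<open>A three-term estimate through a continuous \<open>g\<close> with compact support: the
  two approximation errors coincide by translation invariance. Shifts of length at most 1 keep the
  difference of \<open>g\<close> in the ball of radius R + 1, hence uniform continuity on radius R +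
  2.\<close>

lemma translation_continuous_L1:
  fixes f :: "real^3 \<Rightarrow> real"
  assumes f: "integrable lborel f" and e: "e > 0"
  obtains d where "d > 0" "\<And>z. norm z < d \<Longrightarrow> (\<integral>\<^sup>+x. ennreal \<bar>f (x - z) - f x\<bar> \<partial>lborel) \<le> ennreal e"
proof -
  obtain g R where g: "continuous_on UNIV g" "\<And>x. norm x > R \<Longrightarrow> g x = 0" "R > 0"
    "integrable lborel g" "(\<integral>x. \<bar>f x - g x\<bar> \<partial>lborel) < e / 3"
    using exists_continuous_approx_L1[OF f, of "e / 3"] e by auto
  have fb: "f \<in> borel_measurable borel" and gb: "g \<in> borel_measurable borel" using f g(4) by auto
  define V where "V = measure lborel (cball (0::real^3) (R + 1))"
  have V: "V \<ge> 0" "emeasure lborel (cball (0::real^3) (R + 1)) = ennreal V"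
    unfolding V_def using emeasure_lborel_cball_finite[of "0::real^3" "R + 1"]
    by (auto intro!: emeasure_eq_ennreal_measure)
  define e' where "e' = e / (3 * (V + 1))"
  have e': "e' > 0" "e' * V \<le> e / 3" using e V(1) by (auto simp: e'_def divide_simps)
  have "uniformly_continuous_on (cball 0 (R + 2)) g"
    by (intro compact_uniformly_continuous continuous_on_subset[OF g(1)]) auto
  then obtain d0 where d0: "d0 > 0" "\<And>x y. norm x \<le> R + 2 \<Longrightarrow> norm y \<le> R + 2 \<Longrightarrow> dist y x < d0 \<Longrightarrow> dist (g y) (g x) < e'"
    unfolding uniformly_continuous_on_def using e'(1) by (metis mem_cball_0)
  have b: "(\<integral>\<^sup>+x. ennreal \<bar>f x - g x\<bar> \<partial>lborel) \<le> ennreal (e / 3)"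
    using g(5) f g(4) by (subst nn_integral_eq_integral) (auto intro!: ennreal_leI)
  show ?thesis
  proof (rule that[of "min d0 1"])
    fix z :: "real^3" assume z: "norm z < min d0 1"
    have pw: "\<bar>g (x - z) - g x\<bar> \<le> e' * indicator (cball 0 (R + 1)) x" for x
    proof (cases "norm x \<le> R + 1")
      case True
      then have "norm (x - z) \<le> R + 2" using norm_triangle_ineq4[of x z] z by linarith
      then have "dist (g (x - z)) (g x) < e'" using True z by (intro d0(2)) (auto simp: dist_norm)
      then show ?thesis using True by (simp add: dist_real_def)
    next
      case False
      then have "norm (x - z) > R" "norm x > R" using norm_triangle_ineq2[of x z] z g(3) by linarith+
      then show ?thesis using g(2) e'(1) by simp
    qed
    have "(\<integral>\<^sup>+x. ennreal \<bar>f (x - z) - f x\<bar> \<partial>lborel)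
      \<le> (\<integral>\<^sup>+x. ennreal \<bar>f (x - z) - g (x - z)\<bar> + (ennreal e' * indicator (cball 0 (R + 1)) x + ennreal \<bar>f x - g x\<bar>) \<partial>lborel)"
    proof (intro nn_integral_mono)
      fix x
      have "\<bar>f (x - z) - f x\<bar> \<le> \<bar>f (x - z) - g (x - z)\<bar> + (e' * indicator (cball 0 (R + 1)) x + \<bar>f x - g x\<bar>)"
        using pw[of x] by linarith
      then have "ennreal \<bar>f (x - z) - f x\<bar> \<le> ennreal (\<bar>f (x - z) - g (x - z)\<bar> + (e' * indicator (cball 0 (R + 1)) x + \<bar>f x - g x\<bar>))"
        by (rule ennreal_leI)
      also have "\<dots> = ennreal \<bar>f (x - z) - g (x - z)\<bar> + (ennreal e' * indicator (cball 0 (R + 1)) x + ennreal \<bar>f x - g x\<bar>)"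
        using e'(1) by (simp add: ennreal_plus ennreal_mult' ennreal_indicator)
      finally show "ennreal \<bar>f (x - z) - f x\<bar> \<le> \<dots>" .
    qed
    also have "\<dots> = (\<integral>\<^sup>+x. ennreal \<bar>f (x - z) - g (x - z)\<bar> \<partial>lborel) + (ennreal e' * emeasure lborel (cball (0::real^3) (R + 1)) + (\<integral>\<^sup>+x. ennreal \<bar>f x - g x\<bar> \<partial>lborel))"
    proof -
      have [measurable]: "(\<lambda>x. ennreal \<bar>f (x - z) - g (x - z)\<bar>) \<in> borel_measurable lborel"
        "(\<lambda>x. ennreal \<bar>f x - g x\<bar>) \<in> borel_measurable lborel"
        "(\<lambda>x. ennreal e' * indicator (cball (0::real^3) (R + 1)) x) \<in> borel_measurable lborel"
        using fb gb by measurable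
      show ?thesis
        by (subst nn_integral_add, measurable)
          (subst nn_integral_add, measurable, simp add: nn_integral_cmult_indicator)
    qed
    also have "(\<integral>\<^sup>+x. ennreal \<bar>f (x - z) - g (x - z)\<bar> \<partial>lborel) = (\<integral>\<^sup>+x. ennreal \<bar>f x - g x\<bar> \<partial>lborel)"
      using nn_integral_translate[of "\<lambda>x. ennreal \<bar>f x - g x\<bar>" "- z"] fb gb by simp
    also have "\<dots> + (ennreal e' * emeasure lborel (cball (0::real^3) (R + 1)) + (\<integral>\<^sup>+x. ennreal \<bar>f x - g x\<bar> \<partial>lborel))
       \<le> ennreal (e / 3) + (ennreal (e / 3) + ennreal (e / 3))"
      using b e' V by (intro add_mono) (auto simp: ennreal_mult'[symmetric] intro!: ennreal_leI)
    also have "\<dots> = ennreal e" using e by (simp add: ennreal_plus[symmetric])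
    finally show "(\<integral>\<^sup>+x. ennreal \<bar>f (x - z) - f x\<bar> \<partial>lborel) \<le> ennreal e" .
  qed (use d0 in auto)
qed

text \<open>The error is at most the integral of \<open>k z\<close> times the L^1 modulus of
  continuity of \<open>f\<close> at \<open>z\<close>. Kernels are only asked to have little mass
  outside radius \<open>d\<close>, not small support: the kernel arising from the bilaplacian has
  tails. The radius \<open>d\<close> does not depend on the kernel.\<close>

lemma approximate_identity_L1:
  fixes f :: "real^3 \<Rightarrow> real"
  assumes f: "integrable lborel f" and e: "e > 0"
  obtains d where "d > 0"
    "\<And>k C. k \<in> borel_measurable borel \<Longrightarrow> (\<And>x. 0 \<le> k x) \<Longrightarrow> (\<And>x. k x \<le> C) \<Longrightarrow>
      (\<integral>\<^sup>+x. ennreal (k x) \<partial>lborel) = 1 \<Longrightarrow>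
      (\<integral>\<^sup>+x. ennreal (k x) * indicator {x. d \<le> norm x} x \<partial>lborel) \<le> ennreal d \<Longrightarrow>
      (\<integral>\<^sup>+x. ennreal \<bar>conv k f x - f x\<bar> \<partial>lborel) \<le> ennreal e"
proof -
  have fb [measurable]: "f \<in> borel_measurable borel" using f by auto
  obtain d0 where d0: "d0 > 0" "\<And>z. norm z < d0 \<Longrightarrow> (\<integral>\<^sup>+x. ennreal \<bar>f (x - z) - f x\<bar> \<partial>lborel) \<le> ennreal (e / 2)"
    using translation_continuous_L1[OF f, of "e / 2"] e by auto
  define F where "F = (\<integral>x. \<bar>f x\<bar> \<partial>lborel)"
  have F: "F \<ge> 0" "(\<integral>\<^sup>+x. ennreal \<bar>f x\<bar> \<partial>lborel) = ennreal F"
    using f by (auto simp: F_def nn_integral_eq_integral)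
  \<comment> \<open>The modulus of continuity is at most \<open>2 * F\<close> everywhere, so tails
    of mass \<open>d\<close> must satisfy \<open>2 * F * d \<le> e / 2\<close>.\<close>
  define d where "d = min d0 (e / (4 * (F + 1)))"
  have "e / (4 * (F + 1)) > 0" using e F by auto
  then have d: "d > 0" "d \<le> d0" "d \<le> e / (4 * (F + 1))" using d0 by (auto simp: d_def)
  have d2: "2 * F * d \<le> e / 2"
  proof -
    have "2 * F * d \<le> 2 * (F + 1) * (e / (4 * (F + 1)))" using d F by (intro mult_mono) auto
    also have "\<dots> = e / 2" using F by (simp add: field_simps)
    finally show ?thesis .
  qed
  define \<omega> where "\<omega> z = (\<integral>\<^sup>+x. ennreal \<bar>f (x - z) - f x\<bar> \<partial>lborel)" for z
  have \<omega>m [measurable]: "\<omega> \<in> borel_measurable borel" unfolding \<omega>_def by measurable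
  have \<omega>F: "\<omega> z \<le> ennreal (2 * F)" for z
  proof -
    have "\<omega> z \<le> (\<integral>\<^sup>+x. ennreal \<bar>f (x - z)\<bar> + ennreal \<bar>f x\<bar> \<partial>lborel)"
      unfolding \<omega>_def by (intro nn_integral_mono) (auto simp: ennreal_plus[symmetric] simp del: ennreal_plus intro!: ennreal_leI)
    also have "\<dots> = (\<integral>\<^sup>+x. ennreal \<bar>f (x - z)\<bar> \<partial>lborel) + (\<integral>\<^sup>+x. ennreal \<bar>f x\<bar> \<partial>lborel)"
      by (intro nn_integral_add) auto
    also have "(\<integral>\<^sup>+x. ennreal \<bar>f (x - z)\<bar> \<partial>lborel) = (\<integral>\<^sup>+x. ennreal \<bar>f x\<bar> \<partial>lborel)"
      using nn_integral_translate[of "\<lambda>x. ennreal \<bar>f x\<bar>" "- z"] by simp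
    finally show ?thesis using F by (simp add: ennreal_plus[symmetric] del: ennreal_plus)
  qed
  show ?thesis
  proof (rule that[OF d(1)])
    fix k :: "real^3 \<Rightarrow> real" and C
    assume [measurable]: "k \<in> borel_measurable borel" and k: "\<And>x. 0 \<le> k x" "\<And>x. k x \<le> C"
      and k1: "(\<integral>\<^sup>+x. ennreal (k x) \<partial>lborel) = 1"
      and kd: "(\<integral>\<^sup>+x. ennreal (k x) * indicator {x. d \<le> norm x} x \<partial>lborel) \<le> ennreal d"
    have ki: "integrable lborel k"
      using k k1 by (intro integrableI_nonneg) auto
    have kI: "(\<integral>x. k x \<partial>lborel) = 1"
      using k k1 by (subst integral_eq_nn_integral) auto
    have pw: "ennreal \<bar>conv k f x - f x\<bar> \<le> (\<integral>\<^sup>+z. ennreal (k z) * ennreal \<bar>f (x - z) - f x\<bar> \<partial>lborel)" for x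
    proof -
      have "integrable lborel (\<lambda>z. f (x - z))"
      proof -
        have "integrable (distr lborel borel (\<lambda>z. x - z)) f" using f by (simp add: lborel_distr_reflect)
        then show ?thesis by (subst (asm) integrable_distr_eq) auto
      qed
      then have i1: "integrable lborel (\<lambda>z. k z * f (x - z))"
      proof (rule Bochner_Integration.integrable_bound[OF integrable_mult_right[of C]])
        show "AE z in lborel. norm (k z * f (x - z)) \<le> norm (C * f (x - z))"
        proof (rule AE_I2)
          fix z
          have "\<bar>k z\<bar> \<le> \<bar>C\<bar>" using k(1)[of z] k(2)[of z] by linarith
          then show "norm (k z * f (x - z)) \<le> norm (C * f (x - z))" by (simp add: abs_mult mult_right_mono)
        qed
      qed auto
      have "conv k f x = (\<integral>z. k z * f (x - z) \<partial>lborel)"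
        unfolding conv_def using integral_reflect[of "\<lambda>z. k z * f (x - z)" x] by simp
      then have "conv k f x - f x = (\<integral>z. k z * f (x - z) \<partial>lborel) - (\<integral>z. k z * f x \<partial>lborel)"
        by (simp add: kI)
      also have "\<dots> = (\<integral>z. k z * (f (x - z) - f x) \<partial>lborel)"
        using i1 ki by (subst Bochner_Integration.integral_diff[symmetric]) (auto simp: algebra_simps)
      finally have eq: "conv k f x - f x = (\<integral>z. k z * (f (x - z) - f x) \<partial>lborel)" .
      have i2: "integrable lborel (\<lambda>z. k z * (f (x - z) - f x))"
        using i1 ki by (simp add: right_diff_distrib)
      have "ennreal \<bar>conv k f x - f x\<bar> \<le> (\<integral>\<^sup>+z. ennreal (norm (k z * (f (x - z) - f x))) \<partial>lborel)"
        unfolding eq using integral_norm_bound_ennreal[OF i2] by simp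
      also have "\<dots> = (\<integral>\<^sup>+z. ennreal (k z) * ennreal \<bar>f (x - z) - f x\<bar> \<partial>lborel)"
        using k(1) by (intro nn_integral_cong) (simp add: abs_mult ennreal_mult')
      finally show ?thesis .
    qed
    have "(\<integral>\<^sup>+x. ennreal \<bar>conv k f x - f x\<bar> \<partial>lborel) \<le> (\<integral>\<^sup>+x. \<integral>\<^sup>+z. ennreal (k z) * ennreal \<bar>f (x - z) - f x\<bar> \<partial>lborel \<partial>lborel)"
      by (intro nn_integral_mono pw)
    also have "\<dots> = (\<integral>\<^sup>+z. \<integral>\<^sup>+x. ennreal (k z) * ennreal \<bar>f (x - z) - f x\<bar> \<partial>lborel \<partial>lborel)"
      by (rule lborel_pair.Fubini') measurable
    also have "\<dots> = (\<integral>\<^sup>+z. ennreal (k z) * \<omega> z \<partial>lborel)"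
      unfolding \<omega>_def by (intro nn_integral_cong nn_integral_cmult) measurable
    also have "\<dots> \<le> (\<integral>\<^sup>+z. ennreal (e / 2) * ennreal (k z) + ennreal (2 * F) * (ennreal (k z) * indicator {x. d \<le> norm x} z) \<partial>lborel)"
    proof (intro nn_integral_mono)
      fix z
      show "ennreal (k z) * \<omega> z \<le> ennreal (e / 2) * ennreal (k z) + ennreal (2 * F) * (ennreal (k z) * indicator {x. d \<le> norm x} z)"
      proof (cases "norm z < d")
        case True
        then have "\<omega> z \<le> ennreal (e / 2)" unfolding \<omega>_def using d by (intro d0) auto
        then show ?thesis
          using mult_left_mono[of "\<omega> z" "ennreal (e / 2)" "ennreal (k z)"] True by (simp add: mult.commute)
      next
        case False
        then show ?thesis
          using \<omega>F[of z] by (simp add: mult.commute[of _ "ennreal (k z)"] add_increasing mult_left_mono)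
      qed
    qed
    also have "\<dots> = ennreal (e / 2) * (\<integral>\<^sup>+z. ennreal (k z) \<partial>lborel) + ennreal (2 * F) * (\<integral>\<^sup>+z. ennreal (k z) * indicator {x. d \<le> norm x} z \<partial>lborel)"
      by (subst nn_integral_add) (auto simp: nn_integral_cmult)
    also have "\<dots> \<le> ennreal (e / 2) * 1 + ennreal (2 * F) * ennreal d"
      using kd k1 by (intro add_mono mult_left_mono) auto
    also have "\<dots> = ennreal (e / 2 + 2 * F * d)"
      using e F d by (simp add: ennreal_plus ennreal_mult')
    also have "\<dots> \<le> ennreal e" using d2 by (intro ennreal_leI) auto
    finally show "(\<integral>\<^sup>+x. ennreal \<bar>conv k f x - f x\<bar> \<partial>lborel) \<le> ennreal e" .
  qed
qed

text \<open>A kernel supported in the unit ball sees, from the ball of radius \<open>R\<close>, only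
  values of \<open>f\<close> on radius R + 1. Restricting \<open>f\<close> to that ball reduces the
  claim to the integrable case.\<close>

lemma approximate_identity_local:
  fixes f :: "real^3 \<Rightarrow> real"
  assumes f: "locint f" and e: "e > 0"
  obtains d where "d > 0"
    "\<And>k C. k \<in> borel_measurable borel \<Longrightarrow> (\<And>x. 0 \<le> k x) \<Longrightarrow> (\<And>x. k x \<le> C) \<Longrightarrow>
      (\<And>x. norm x > 1 \<Longrightarrow> k x = 0) \<Longrightarrow>
      (\<integral>\<^sup>+x. ennreal (k x) \<partial>lborel) = 1 \<Longrightarrow>
      (\<integral>\<^sup>+x. ennreal (k x) * indicator {x. d \<le> norm x} x \<partial>lborel) \<le> ennreal d \<Longrightarrow>
      (\<integral>\<^sup>+x. ennreal \<bar>conv k f x - f x\<bar> * indicator (cball 0 R) x \<partial>lborel) \<le> ennreal e"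
proof -
  define g where "g x = indicator (cball 0 (R + 1)) x * f x" for x
  have "integrable lborel g" using f by (simp add: locint_def g_def[abs_def])
  from approximate_identity_L1[OF this e] obtain d where d: "d > 0"
    "\<And>k C. k \<in> borel_measurable borel \<Longrightarrow> (\<And>x. 0 \<le> k x) \<Longrightarrow> (\<And>x. k x \<le> C) \<Longrightarrow>
      (\<integral>\<^sup>+x. ennreal (k x) \<partial>lborel) = 1 \<Longrightarrow>
      (\<integral>\<^sup>+x. ennreal (k x) * indicator {x. d \<le> norm x} x \<partial>lborel) \<le> ennreal d \<Longrightarrow>
      (\<integral>\<^sup>+x. ennreal \<bar>conv k g x - g x\<bar> \<partial>lborel) \<le> ennreal e" by blast
  show ?thesis
  proof (rule that[OF d(1)])
    fix k :: "real^3 \<Rightarrow> real" and C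
    assume k: "k \<in> borel_measurable borel" "\<And>x. 0 \<le> k x" "\<And>x. k x \<le> C"
      "(\<integral>\<^sup>+x. ennreal (k x) \<partial>lborel) = 1"
      "(\<integral>\<^sup>+x. ennreal (k x) * indicator {x. d \<le> norm x} x \<partial>lborel) \<le> ennreal d"
      and supp: "\<And>x. norm x > 1 \<Longrightarrow> k x = 0"
    have "conv k f x = conv k g x" if "norm x \<le> R" for x
      unfolding conv_def
    proof (rule Bochner_Integration.integral_cong[OF refl])
      fix y
      show "k (x - y) * f y = k (x - y) * g y"
      proof (cases "norm y \<le> R + 1")
        case False
        then have "norm (x - y) > 1" using that norm_triangle_ineq2[of y x] by (simp add: norm_minus_commute)
        then show ?thesis using supp by simp
      qed (simp add: g_def)
    qed
    then have "ennreal \<bar>conv k f x - f x\<bar> * indicator (cball 0 R) x \<le> ennreal \<bar>conv k g x - g x\<bar>" for x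
      by (cases "norm x \<le> R") (auto simp: g_def)
    then have "(\<integral>\<^sup>+x. ennreal \<bar>conv k f x - f x\<bar> * indicator (cball 0 R) x \<partial>lborel) \<le> (\<integral>\<^sup>+x. ennreal \<bar>conv k g x - g x\<bar> \<partial>lborel)"
      by (intro nn_integral_mono)
    also have "\<dots> \<le> ennreal e" by (rule d(2)[OF k])
    finally show "(\<integral>\<^sup>+x. ennreal \<bar>conv k f x - f x\<bar> * indicator (cball 0 R) x \<partial>lborel) \<le> ennreal e" .
  qed
qed

subsection \<open>The truncated Stokes kernel\<close>

definition lap :: "(real^3 \<Rightarrow> real) \<Rightarrow> real^3 \<Rightarrow> real" where
  "lap f x = (\<Sum>i\<in>UNIV. partial i (partial i f) x)"

lemma smooth3_lap: "smooth3 f \<Longrightarrow> smooth3 (lap f)"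
  unfolding lap_def[abs_def] by (intro smooth3_intros)

lemma test_fun_lap: "test_fun f \<Longrightarrow> test_fun (lap f)"
  unfolding lap_def[abs_def] by (intro test_fun_sum test_fun_partial)

lemma lap_add: "smooth3 f \<Longrightarrow> smooth3 g \<Longrightarrow> lap (\<lambda>x. f x + g x) = (\<lambda>x. lap f x + lap g x)"
  by (simp add: lap_def[abs_def] partial_smooth_add smooth3_partial sum.distrib)

lemma lap_diff: "smooth3 f \<Longrightarrow> smooth3 g \<Longrightarrow> lap (\<lambda>x. f x - g x) = (\<lambda>x. lap f x - lap g x)"
  by (simp add: lap_def[abs_def] partial_smooth_diff smooth3_partial sum_subtractf)

lemma lap_cmult: "smooth3 f \<Longrightarrow> lap (\<lambda>x. c * f x) = (\<lambda>x. c * lap f x)"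
  by (simp add: lap_def[abs_def] partial_smooth_cmult smooth3_partial sum_distrib_left)

lemma lap_0: "lap (\<lambda>x. 0) = (\<lambda>x. 0)"
  by (simp add: lap_def[abs_def])

lemma partial_commute_fun: "smooth3 f \<Longrightarrow> partial i (partial j f) = partial j (partial i f)"
  by (rule ext) (rule partial_commute)

lemma lap_partial: "smooth3 f \<Longrightarrow> lap (partial i f) = partial i (lap f)"
proof -
  assume f: "smooth3 f"
  have "partial j (partial j (partial i f)) = partial i (partial j (partial j f))" for j
    using partial_commute_fun[OF f, of j i] partial_commute_fun[OF smooth3_partial[OF f], of j i j] by simp
  then show ?thesis
    unfolding lap_def[abs_def] by (subst partial_smooth_sum) (auto intro: smooth3_partial f)
qed

lemma partial_reflect:
  assumes "smooth3 f"
  shows "partial i (\<lambda>y. f (x - y)) = (\<lambda>y. - partial i f (x - y))"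
proof
  fix y
  show "partial i (\<lambda>y. f (x - y)) y = - partial i f (x - y)"
    using partial_affine[OF smooth3_differentiable[OF assms], where a = "-1" and b = x and x = y and i = i]
    by simp
qed

lemma smooth3_reflect: "smooth3 f \<Longrightarrow> smooth3 (\<lambda>y. f (x - y))"
  using smooth3_affine[of f "-1" x] by simp

lemma test_fun_reflect: "test_fun f \<Longrightarrow> test_fun (\<lambda>y. f (x - y))"
  using test_fun_affine[of f "-1" x] by simp

lemma lap_reflect:
  assumes "smooth3 f"
  shows "lap (\<lambda>y. f (x - y)) = (\<lambda>y. lap f (x - y))"
proof -
  have "partial i (partial i (\<lambda>y. f (x - y))) = (\<lambda>y. partial i (partial i f) (x - y))" for i
    using assms
    by (simp add: partial_reflect smooth3_partial partial_smooth_uminus smooth3_reflect)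
  then show ?thesis by (simp add: lap_def[abs_def])
qed

section \<open>Regularised powers of the norm\<close>

text \<open>A smooth substitute for |x|^k: the singularity at the origin is removed at scale
  \<open>d\<close>.\<close>

definition rp :: "real \<Rightarrow> real \<Rightarrow> real^3 \<Rightarrow> real" where
  "rp k d x = ((norm x)\<^sup>2 + d\<^sup>2) powr (k / 2)"

lemma rp_base_pos: "d > 0 \<Longrightarrow> (norm x)\<^sup>2 + d\<^sup>2 > 0"
  by (simp add: add_nonneg_pos)

lemma rp_pos: "d > 0 \<Longrightarrow> rp k d x > 0"
  using rp_base_pos[of d x] by (simp add: rp_def)

lemma rp_mult: "d > 0 \<Longrightarrow> rp k d x * rp l d x = rp (k + l) d x"
  by (simp add: rp_def powr_add[symmetric] add_divide_distrib)

lemma rp_0: "d > 0 \<Longrightarrow> rp 0 d x = 1"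
  using rp_base_pos[of d x] by (simp add: rp_def)

lemma rp_2: "d > 0 \<Longrightarrow> rp 2 d x = (norm x)\<^sup>2 + d\<^sup>2"
  using rp_base_pos[of d x] by (simp add: rp_def)

lemma rp_deriv:
  assumes "t + d\<^sup>2 > 0"
  shows "((\<lambda>t. (t + d\<^sup>2) powr a) has_real_derivative a * (t + d\<^sup>2) powr (a - 1)) (at t)"
  using assms by (auto intro!: derivative_eq_intros simp: powr_diff)

lemma smooth3_rp:
  assumes d: "d > 0" shows "smooth3 (rp k d)"
proof -
  \<comment> \<open>The \<open>n\<close>-th derivative of
    \<open>t \<mapsto> (t + d^2) powr (k/2)\<close>; the product is the falling factorial of
    k/2.\<close>
  define D where "D n t = (\<Prod>i<n. k / 2 - real i) * (t + d\<^sup>2) powr (k / 2 - real n)" for n t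
  have "smooth3 (\<lambda>x. D 0 ((norm x)\<^sup>2))"
  proof (rule smooth3_compose[OF smooth3_norm_sq])
    fix n and x :: "real^3"
    show "(D n has_real_derivative D (Suc n) ((norm x)\<^sup>2)) (at ((norm x)\<^sup>2))"
      unfolding D_def
      by (rule DERIV_cong[OF DERIV_cmult[OF rp_deriv[OF rp_base_pos[OF d]]]])
        (simp add: algebra_simps)
  qed
  then show ?thesis by (simp add: D_def rp_def[abs_def])
qed

lemma partial_rp:
  assumes d: "d > 0" shows "partial i (rp k d) = (\<lambda>x. k * (x $ i * rp (k - 2) d x))"
proof
  fix x
  have "partial i (\<lambda>x. ((norm x)\<^sup>2 + d\<^sup>2) powr (k / 2)) x
      = (k / 2 * ((norm x)\<^sup>2 + d\<^sup>2) powr (k / 2 - 1)) * partial i (\<lambda>x. (norm x)\<^sup>2) x"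
    by (rule partial_compose[OF rp_deriv[OF rp_base_pos[OF d]] smooth3_differentiable[OF smooth3_norm_sq]])
  then show "partial i (rp k d) x = k * (x $ i * rp (k - 2) d x)"
    by (simp add: rp_def[abs_def] partial_norm_sq diff_divide_distrib)
qed

text \<open>Writing \<open>|x|^2 = rp 2 d x - d^2\<close> turns the quadratic factor into
  regularised powers again, so that the formula can be iterated. The dimension enters as the sum of
  three identical terms.\<close>

lemma lap_rp:
  assumes d: "d > 0"
  shows "lap (rp k d) = (\<lambda>x. k * (k + 1) * rp (k - 2) d x - k * (k - 2) * d\<^sup>2 * rp (k - 4) d x)"
proof
  fix x :: "real^3"
  have s: "smooth3 (\<lambda>x. x $ i * rp (k - 2) d x)" for i
    by (intro smooth3_intros smooth3_rp d)
  have "partial i (partial i (rp k d)) x = k * ((k - 2) * (x $ i)\<^sup>2 * rp (k - 4) d x + rp (k - 2) d x)" for i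
    unfolding partial_rp[OF d] partial_smooth_cmult[OF s]
      partial_smooth_mult[OF smooth3_coord smooth3_rp[OF d]]
    by (simp add: power2_eq_square)
  then have "lap (rp k d) x = k * ((k - 2) * (norm x)\<^sup>2 * rp (k - 4) d x + 3 * rp (k - 2) d x)"
    by (simp add: lap_def norm_sq3 sum_distrib_left[symmetric] sum_distrib_right[symmetric] sum.distrib)
  moreover have "(norm x)\<^sup>2 * rp (k - 4) d x = rp (k - 2) d x - d\<^sup>2 * rp (k - 4) d x"
    using rp_mult[OF d, of 2 x "k - 4"] rp_2[OF d, of x] by (simp add: algebra_simps)
  ultimately have "lap (rp k d) x = k * ((k - 2) * (rp (k - 2) d x - d\<^sup>2 * rp (k - 4) d x) + 3 * rp (k - 2) d x)"
    by (simp add: mult.assoc)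
  then show "lap (rp k d) x = k * (k + 1) * rp (k - 2) d x - k * (k - 2) * d\<^sup>2 * rp (k - 4) d x"
    by (simp add: algebra_simps)
qed

text \<open>\<open>- rp 1 d\<close> is, up to the factor \<open>8 \<pi>\<close>, a regularised fundamental solution of the bilaplacian.\<close>

lemma bilap_rp:
  assumes d: "d > 0" shows "lap (lap (rp 1 d)) = (\<lambda>x. - 15 * d ^ 4 * rp (-7) d x)"
proof -
  have "lap (rp 1 d) = (\<lambda>x. 2 * rp (-1) d x + d\<^sup>2 * rp (-3) d x)"
    by (simp add: lap_rp[OF d])
  then have "lap (lap (rp 1 d)) = (\<lambda>x. 2 * lap (rp (-1) d) x + d\<^sup>2 * lap (rp (-3) d) x)"
    by (simp add: lap_add lap_cmult smooth3_cmult smooth3_rp[OF d])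
  then show ?thesis
    by (simp add: lap_rp[OF d] algebra_simps power2_eq_square power4_eq_xxxx)
qed

text \<open>Families of functions of size \<open>O(rp k d)\<close> on the unit ball, uniformly in \<open>0 < d \<le> 1\<close>; by
  construction each derivative lowers the order by one.\<close>

inductive graded :: "(real \<Rightarrow> real^3 \<Rightarrow> real) \<Rightarrow> real \<Rightarrow> bool" where
  test: "test_fun f \<Longrightarrow> graded (\<lambda>d. f) 0"
| const: "graded (\<lambda>d x. c) 0"
| coord: "graded (\<lambda>d x. x $ i) 1"
| rp: "graded (rp k) k"
| mult: "graded f k \<Longrightarrow> graded g l \<Longrightarrow> graded (\<lambda>d x. f d x * g d x) (k + l)"
| add: "graded f k \<Longrightarrow> graded g k \<Longrightarrow> graded (\<lambda>d x. f d x + g d x) k"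
| weaken: "graded f k \<Longrightarrow> l \<le> k \<Longrightarrow> graded f l"
| cong: "graded f k \<Longrightarrow> (\<And>d. 0 < d \<Longrightarrow> d \<le> 1 \<Longrightarrow> f d = g d) \<Longrightarrow> graded g k"

lemma graded_smooth3: "graded f k \<Longrightarrow> 0 < d \<Longrightarrow> d \<le> 1 \<Longrightarrow> smooth3 (f d)"
proof (induction rule: graded.induct)
  case (cong f k g)
  then show ?case by metis
qed (auto intro: smooth3_intros smooth3_rp test_fun_smooth)

text \<open>The derivative formula for \<open>rp\<close> requires positive \<open>d\<close>; the
  rule \<open>cong\<close> exists so that identities valid only for 0 < d \<le> 1 can be used in the
  induction.\<close>

lemma graded_partial: "graded f k \<Longrightarrow> graded (\<lambda>d. partial i (f d)) (k - 1)"
proof (induction rule: graded.induct)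
  case (test f)
  then show ?case by (intro graded.weaken[OF graded.test[OF test_fun_partial]]) auto
next
  case (const c)
  show ?case by (simp add: graded.weaken[OF graded.const])
next
  case (coord j)
  show ?case by (simp add: graded.const)
next
  case (rp k)
  have "graded (\<lambda>d x. k * (x $ i * rp (k - 2) d x)) (0 + (1 + (k - 2)))"
    by (intro graded.intros)
  then have "graded (\<lambda>d x. k * (x $ i * rp (k - 2) d x)) (k - 1)" by simp
  then show ?case by (rule graded.cong) (simp add: partial_rp)
next
  case (mult f k g l)
  have "graded (\<lambda>d x. f d x * partial i (g d) x + partial i (f d) x * g d x) (k + l - 1)"
    using graded.mult[OF mult.hyps(1) mult.IH(2)] graded.mult[OF mult.IH(1) mult.hyps(2)]
    by (intro graded.add) (simp_all add: algebra_simps)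
  then show ?case
    by (rule graded.cong) (simp add: partial_smooth_mult graded_smooth3[OF mult.hyps(1)] graded_smooth3[OF mult.hyps(2)])
next
  case (add f k g)
  have "graded (\<lambda>d x. partial i (f d) x + partial i (g d) x) (k - 1)"
    by (intro graded.add add.IH)
  then show ?case
    by (rule graded.cong) (simp add: partial_smooth_add graded_smooth3[OF add.hyps(1)] graded_smooth3[OF add.hyps(2)])
next
  case (weaken f k l)
  from graded.weaken[OF weaken.IH, of "l - 1"] weaken.hyps show ?case by simp
next
  case (cong f k g)
  show ?case by (rule graded.cong[OF cong.IH]) (simp add: cong.hyps)
qed

lemma graded_bound:
  "graded f k \<Longrightarrow> \<exists>C\<ge>0. \<forall>d x. 0 < d \<longrightarrow> d \<le> 1 \<longrightarrow> norm x \<le> 1 \<longrightarrow> \<bar>f d x\<bar> \<le> C * rp k d x"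
proof (induction rule: graded.induct)
  case (test f)
  then obtain C where C: "C > 0" "\<And>x. \<bar>f x\<bar> \<le> C" using test_fun_bounded by metis
  then show ?case by (intro exI[of _ C]) (auto simp: rp_0)
next
  case (const c)
  show ?case by (intro exI[of _ "\<bar>c\<bar>"]) (auto simp: rp_0)
next
  case (coord i)
  have "\<bar>x $ i\<bar> \<le> rp 1 d x" for d and x :: "real^3"
  proof -
    have "\<bar>x $ i\<bar> \<le> sqrt ((norm x)\<^sup>2)" using abs_component_le_norm[of x i] by simp
    also have "\<dots> \<le> sqrt ((norm x)\<^sup>2 + d\<^sup>2)" by (intro real_sqrt_le_mono) simp
    also have "\<dots> = rp 1 d x" by (simp add: rp_def powr_half_sqrt)
    finally show ?thesis .
  qed
  then show ?case by (intro exI[of _ 1]) auto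
next
  case (rp k)
  show ?case by (intro exI[of _ 1]) (simp add: less_imp_le[OF rp_pos])
next
  case (mult f k g l)
  then obtain C D where C: "C \<ge> 0" "\<And>d x. 0 < d \<Longrightarrow> d \<le> 1 \<Longrightarrow> norm x \<le> 1 \<Longrightarrow> \<bar>f d x\<bar> \<le> C * rp k d x"
    and D: "D \<ge> 0" "\<And>d x. 0 < d \<Longrightarrow> d \<le> 1 \<Longrightarrow> norm x \<le> 1 \<Longrightarrow> \<bar>g d x\<bar> \<le> D * rp l d x"
    by metis
  show ?case
  proof (intro exI[of _ "C * D"] conjI allI impI)
    fix d :: real and x :: "real^3" assume d: "0 < d" "d \<le> 1" "norm x \<le> 1"
    have "\<bar>f d x * g d x\<bar> \<le> (C * rp k d x) * (D * rp l d x)"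
      unfolding abs_mult using C D d rp_pos[OF d(1), of k x] by (intro mult_mono) auto
    also have "\<dots> = C * D * (rp k d x * rp l d x)" by simp
    finally show "\<bar>f d x * g d x\<bar> \<le> C * D * rp (k + l) d x" by (simp only: rp_mult[OF d(1)])
  qed (use C D in auto)
next
  case (add f k g)
  then obtain C D where C: "C \<ge> 0" "\<And>d x. 0 < d \<Longrightarrow> d \<le> 1 \<Longrightarrow> norm x \<le> 1 \<Longrightarrow> \<bar>f d x\<bar> \<le> C * rp k d x"
    and D: "D \<ge> 0" "\<And>d x. 0 < d \<Longrightarrow> d \<le> 1 \<Longrightarrow> norm x \<le> 1 \<Longrightarrow> \<bar>g d x\<bar> \<le> D * rp k d x"
    by metis
  show ?case
  proof (intro exI[of _ "C + D"] conjI allI impI)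
    fix d :: real and x :: "real^3" assume d: "0 < d" "d \<le> 1" "norm x \<le> 1"
    show "\<bar>f d x + g d x\<bar> \<le> (C + D) * rp k d x"
      using C(2)[OF d] D(2)[OF d] by (simp add: distrib_right)
  qed (use C D in auto)
next
  case (weaken f k l)
  then obtain C where C: "C \<ge> 0" "\<And>d x. 0 < d \<Longrightarrow> d \<le> 1 \<Longrightarrow> norm x \<le> 1 \<Longrightarrow> \<bar>f d x\<bar> \<le> C * rp k d x"
    by metis
  \<comment> \<open>On the unit ball with d \<le> 1 the base of \<open>rp\<close> is at most 2, so a
    surplus of order k - l costs only this constant.\<close>
  define B where "B = (2::real) powr ((k - l) / 2)"
  show ?case
  proof (intro exI[of _ "C * B"] conjI allI impI)
    fix d :: real and x :: "real^3" assume d: "0 < d" "d \<le> 1" "norm x \<le> 1"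
    have "(norm x)\<^sup>2 + d\<^sup>2 \<le> 1 + 1" using d by (intro add_mono power_le_one) auto
    then have "rp (k - l) d x \<le> B"
      unfolding rp_def B_def using weaken.hyps rp_base_pos[OF d(1), of x] by (intro powr_mono2) auto
    then have "rp (k - l) d x * rp l d x \<le> B * rp l d x"
      using rp_pos[OF d(1), of l x] by (intro mult_right_mono) auto
    then have "rp k d x \<le> B * rp l d x" by (simp add: rp_mult[OF d(1)])
    then have "C * rp k d x \<le> C * (B * rp l d x)" using C(1) by (rule mult_left_mono)
    with C(2)[OF d] show "\<bar>f d x\<bar> \<le> C * B * rp l d x" by (simp add: mult.assoc)
  qed (use C in \<open>auto simp: B_def\<close>)
next
  case (cong f k g)
  then show ?case by metis
qed

section \<open>The truncated biharmonic potential\<close>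

text \<open>Truncation to the unit ball makes the regularised biharmonic potential an admissible
  test function, at the price of a harmless bounded term in its bilaplacian.\<close>

definition pot :: "real \<Rightarrow> real^3 \<Rightarrow> real" where
  "pot d x = cutoff x * rp 1 d x"

lemma test_fun_pot: "d > 0 \<Longrightarrow> test_fun (pot d)"
  unfolding pot_def[abs_def] by (intro test_fun_mult_left test_fun_cutoff smooth3_rp)

lemma graded_pot: "graded pot 1"
  using graded.mult[OF graded.test[OF test_fun_cutoff] graded.rp[of 1]] by (simp add: pot_def[abs_def])

lemma pot_eq_0: "norm x > 1 \<Longrightarrow> pot d x = 0"
  by (simp add: pot_def cutoff_eq_0)

lemma rp_neg_2_le:
  assumes "d > 0" "x \<noteq> 0" shows "rp (-2) d x \<le> 1 / (norm x)\<^sup>2"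
proof -
  have "rp (-2) d x = 1 / ((norm x)\<^sup>2 + d\<^sup>2)"
    using rp_base_pos[OF assms(1), of x] by (simp add: rp_def powr_minus_divide)
  also have "\<dots> \<le> 1 / (norm x)\<^sup>2" using assms rp_base_pos[OF assms(1), of x] by (intro divide_left_mono mult_pos_pos) auto
  finally show ?thesis .
qed

text \<open>Three derivatives of a potential of order 1 have order -2. The bound is uniform in
  \<open>d\<close>, so the regularisation can be removed later, and the finitely many index triples
  share one constant.\<close>

lemma pot_partial3_bound:
  obtains C where "C > 0"
    "\<And>i j k d x. 0 < d \<Longrightarrow> d \<le> 1 \<Longrightarrow> x \<noteq> 0 \<Longrightarrow>
      \<bar>partial i (partial j (partial k (pot d))) x\<bar> \<le> C * (indicator (cball 0 1) x / (norm x)\<^sup>2)"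
proof -
  have g: "graded (\<lambda>d. partial i (partial j (partial k (pot d)))) (-2)" for i j k
    using graded_partial[OF graded_partial[OF graded_partial[OF graded_pot]]] by simp
  have "\<forall>i j k. \<exists>C\<ge>0. \<forall>d x. 0 < d \<longrightarrow> d \<le> 1 \<longrightarrow> norm x \<le> 1 \<longrightarrow>
      \<bar>partial i (partial j (partial k (pot d))) x\<bar> \<le> C * rp (-2) d x"
    using graded_bound[OF g] by blast
  then obtain C where C: "\<And>i j k. C i j k \<ge> 0" "\<And>i j k d x. 0 < d \<Longrightarrow> d \<le> 1 \<Longrightarrow> norm x \<le> 1 \<Longrightarrow>
      \<bar>partial i (partial j (partial k (pot d))) x\<bar> \<le> C i j k * rp (-2) d x"
    by metis
  define B where "B = 1 + (\<Sum>i\<in>UNIV. \<Sum>j\<in>UNIV. \<Sum>k\<in>UNIV. C i j k)"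
  have CB: "C i j k \<le> B" for i j k
  proof -
    have "C i j k \<le> (\<Sum>k\<in>UNIV. C i j k)" by (rule member_le_sum) (auto intro: C)
    also have "\<dots> \<le> (\<Sum>j\<in>UNIV. \<Sum>k\<in>UNIV. C i j k)" by (rule member_le_sum) (auto intro: sum_nonneg C)
    also have "\<dots> \<le> (\<Sum>i\<in>UNIV. \<Sum>j\<in>UNIV. \<Sum>k\<in>UNIV. C i j k)" by (rule member_le_sum) (auto intro: sum_nonneg C)
    finally show ?thesis by (simp add: B_def)
  qed
  have "\<bar>partial i (partial j (partial k (pot d))) x\<bar> \<le> B * (indicator (cball 0 1) x / (norm x)\<^sup>2)"
    if d: "0 < d" "d \<le> 1" "x \<noteq> 0" for i j k d and x :: "real^3"
  proof (cases "norm x \<le> 1")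
    case True
    have "\<bar>partial i (partial j (partial k (pot d))) x\<bar> \<le> C i j k * rp (-2) d x" using C d True by blast
    also have "\<dots> \<le> B * (1 / (norm x)\<^sup>2)"
      using C(1)[of i j k] CB[of i j k] rp_neg_2_le[of d x] rp_pos[of d "-2" x] d by (intro mult_mono) auto
    finally show ?thesis using True by simp
  next
    case False
    have z: "partial k (pot d) x = 0" if "norm x > 1" for k x
      using partial_eq_0_outside[OF test_fun_smooth[OF test_fun_pot[OF d(1)]] pot_eq_0 that] .
    have z2: "partial j (partial k (pot d)) x = 0" if "norm x > 1" for j k x
      using partial_eq_0_outside[OF smooth3_partial[OF test_fun_smooth[OF test_fun_pot[OF d(1)]]] z that] .
    have "partial i (partial j (partial k (pot d))) x = 0"
      using partial_eq_0_outside[OF smooth3_partial[OF smooth3_partial[OF test_fun_smooth[OF test_fun_pot[OF d(1)]]]] z2] False by simp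
    then show ?thesis by (simp add: False)
  qed
  moreover have "B > 0" unfolding B_def by (intro add_pos_nonneg sum_nonneg C) auto
  ultimately show ?thesis using that[of B] by simp
qed

lemma lap_cong_open:
  assumes S: "open S" "x \<in> S" "\<And>y. y \<in> S \<Longrightarrow> f y = g y" and f: "smooth3 f"
  shows "lap f x = lap g x"
proof -
  have "partial i f y = partial i g y" if "y \<in> S" for i y
    using partial_cong_open[OF S(1) that S(3) smooth3_differentiable[OF f]] .
  then have "partial i (partial i f) x = partial i (partial i g) x" for i
    using partial_cong_open[OF S(1,2) _ smooth3_differentiable[OF smooth3_partial[OF f]]] by blast
  then show ?thesis by (simp add: lap_def)
qed

lemma bilap_pot_inner:
  assumes d: "d > 0" and x: "norm x < 1/2"
  shows "lap (lap (pot d)) x = - 15 * d ^ 4 * rp (-7) d x"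
proof -
  have e: "pot d y = rp 1 d y" if "y \<in> ball 0 (1/2)" for y
    using that by (simp add: pot_def cutoff_eq_1)
  have s: "smooth3 (pot d)" using test_fun_smooth[OF test_fun_pot[OF d]] .
  have e2: "lap (pot d) y = lap (rp 1 d) y" if "y \<in> ball 0 (1/2)" for y
    using lap_cong_open[OF open_ball that e s] .
  have "lap (lap (pot d)) x = lap (lap (rp 1 d)) x"
    by (rule lap_cong_open[where S = "ball 0 (1/2)", OF open_ball _ e2 smooth3_lap[OF s]])
      (use x in auto)
  then show ?thesis by (simp add: bilap_rp[OF d])
qed

lemma graded_lap: "graded f k \<Longrightarrow> graded (\<lambda>d. lap (f d)) (k - 2)"
proof -
  assume f: "graded f k"
  have g: "graded (\<lambda>d. partial i (partial i (f d))) (k - 2)" for i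
    using graded_partial[OF graded_partial[OF f], of i i] by simp
  have "graded (\<lambda>d x. partial 1 (partial 1 (f d)) x + (partial 2 (partial 2 (f d)) x + partial 3 (partial 3 (f d)) x)) (k - 2)"
    by (intro graded.add g)
  then show ?thesis by (rule graded.cong) (auto simp: lap_def sum_3)
qed

text \<open>The bilaplacian has order 1 - 4 = -3, which is singular only at the origin: for |x|
  \<ge> 1/2 the weight \<open>rp (-3) d x\<close> is at most (1/4) powr (-3/2) = 8.\<close>

lemma bilap_pot_outer:
  obtains C where "C > 0"
    "\<And>d x. 0 < d \<Longrightarrow> d \<le> 1 \<Longrightarrow> norm x \<ge> 1/2 \<Longrightarrow> \<bar>lap (lap (pot d)) x\<bar> \<le> C * indicator (cball 0 1) x"
proof -
  have "graded (\<lambda>d. lap (lap (pot d))) (-3)"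
    using graded_lap[OF graded_lap[OF graded_pot]] by simp
  from graded_bound[OF this] obtain C where C: "C \<ge> 0" "\<And>d x. 0 < d \<Longrightarrow> d \<le> 1 \<Longrightarrow> norm x \<le> 1 \<Longrightarrow>
      \<bar>lap (lap (pot d)) x\<bar> \<le> C * rp (-3) d x" by blast
  have "\<bar>lap (lap (pot d)) x\<bar> \<le> (8 * C + 1) * indicator (cball 0 1) x"
    if d: "0 < d" "d \<le> 1" "norm x \<ge> 1/2" for d x
  proof (cases "norm x \<le> 1")
    case True
    have "(1/2)\<^sup>2 \<le> (norm x)\<^sup>2" using d(3) by (intro power_mono) auto
    then have b: "1/4 \<le> (norm x)\<^sup>2 + d\<^sup>2" by (simp add: power2_eq_square add_increasing2)
    have "rp (-3) d x \<le> (1/4) powr (-3/2)"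
      unfolding rp_def using b by (intro powr_mono2') auto
    also have "(1/4::real) powr (-3/2) = (1/2) powr (2 * (-3/2))"
      by (subst powr_powr[symmetric]) (simp add: power2_eq_square)
    also have "\<dots> = 8" by (simp add: powr_minus_divide power3_eq_cube)
    finally have "C * rp (-3) d x \<le> C * 8" using C(1) by (rule mult_left_mono)
    then show ?thesis using C(2)[of d x] d True by simp
  next
    case False
    have z: "lap (pot d) y = 0" if "norm y > 1" for y
    proof -
      have "lap (pot d) y = lap (\<lambda>x. 0) y"
        by (rule lap_cong_open[where S = "- cball 0 1"]) 
          (use that pot_eq_0 test_fun_smooth[OF test_fun_pot[OF d(1)]] in \<open>auto simp: open_Compl\<close>)
      then show ?thesis by (simp add: lap_0)
    qed
    have "lap (lap (pot d)) x = lap (\<lambda>x. 0) x"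
      by (rule lap_cong_open[where S = "- cball 0 1"])
        (use False z smooth3_lap test_fun_smooth[OF test_fun_pot[OF d(1)]] in \<open>auto simp: open_Compl\<close>)
    then show ?thesis using False by (simp add: lap_0)
  qed
  then show ?thesis using that[of "8 * C + 1"] C(1) by simp
qed

subsection \<open>Boundedness from a nonlinear potential inequality\<close>

lemma ball_measurable [measurable]: "ball (c :: 'a::euclidean_space) r \<in> sets borel"
  by simp

lemma emeasure_ball3:
  obtains v where "v > 0" "\<And>r. r \<ge> 0 \<Longrightarrow> emeasure lborel (ball (c::real^3) r) = ennreal (v * r ^ 3)"
    "\<And>r. r \<ge> 0 \<Longrightarrow> emeasure lborel (cball (c::real^3) r) = ennreal (v * r ^ 3)"
  using that[of "unit_ball_vol 3"] emeasure_ball[of _ c] emeasure_cball[of _ c] unit_ball_vol_pos[of 3]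
  by simp

text \<open>Dyadic decomposition: on the shell between radii 2^-(n+1) and 2^-n the integrand is at
  most 2^((n+1) a) and the volume is of order 2^(-3 n), so the sum is geometric with ratio 2^(a - 3)
  < 1.\<close>

lemma nn_integral_powr_ball_finite:
  assumes a: "a > 0" "a < 3"
  shows "(\<integral>\<^sup>+z. ennreal (norm (z::real^3) powr (-a)) * indicator (ball 0 1) z \<partial>lborel) < \<infinity>"
proof -
  obtain v where v: "v > 0" "\<And>r. r \<ge> 0 \<Longrightarrow> emeasure lborel (ball (0::real^3) r) = ennreal (v * r ^ 3)"
    using emeasure_ball3 by metis
  define h where "h n = (1/2::real) ^ n" for n :: nat
  have hpos: "h n > 0" for n by (simp add: h_def)
  have pw: "ennreal (norm z powr (-a)) * indicator (ball 0 1) z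
     \<le> (\<Sum>n. ennreal (h (Suc n) powr (-a)) * indicator (ball 0 (h n)) z)" for z :: "real^3"
  proof (cases "z = 0 \<or> norm z \<ge> 1")
    case False
    then have z: "norm z > 0" "norm z < 1" by auto
    define P where "P n \<longleftrightarrow> h (Suc n) \<le> norm z" for n
    have "\<exists>n. P n"
    proof -
      obtain n where "(1/2) ^ n < norm z" using real_arch_pow_inv[OF z(1), of "1/2"] by auto
      moreover have "h (Suc n) = (1/2) ^ n / 2" by (simp add: h_def)
      ultimately have "P n" using z(1) unfolding P_def by linarith
      then show ?thesis ..
    qed
    \<comment> \<open>The least such index selects the dyadic shell that contains
      \<open>z\<close>.\<close>
    define n where "n = (LEAST n. P n)"
    have Pn: "P n" unfolding n_def using \<open>\<exists>n. P n\<close> by (rule LeastI_ex)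
    have "norm z < h n"
    proof (cases n)
      case 0
      then show ?thesis using z by (simp add: h_def)
    next
      case (Suc m)
      then have "\<not> P m" unfolding n_def using not_less_Least by (metis lessI)
      then show ?thesis using Suc by (simp add: P_def)
    qed
    then have "ennreal (norm z powr (-a)) * indicator (ball 0 1) z
        \<le> ennreal (h (Suc n) powr (-a)) * indicator (ball 0 (h n)) z"
      using z Pn a hpos[of "Suc n"] unfolding P_def by (auto intro!: ennreal_leI powr_mono2')
    also have "\<dots> \<le> (\<Sum>n. ennreal (h (Suc n) powr (-a)) * indicator (ball 0 (h n)) z)"
    proof -
      let ?f = "\<lambda>n. ennreal (h (Suc n) powr (-a)) * indicator (ball 0 (h n)) z"
      have "?f n = sum ?f {n}"
        by (subst sum.insert, simp, simp, simp only: sum.empty add_0_right)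
      also have "\<dots> \<le> suminf ?f" by (rule sum_le_suminf) auto
      finally show ?thesis .
    qed
    finally show ?thesis .
  qed auto
  have "(\<integral>\<^sup>+z. ennreal (norm (z::real^3) powr (-a)) * indicator (ball 0 1) z \<partial>lborel)
     \<le> (\<integral>\<^sup>+z. (\<Sum>n. ennreal (h (Suc n) powr (-a)) * indicator (ball (0::real^3) (h n)) z) \<partial>lborel)"
    by (intro nn_integral_mono pw)
  also have "\<dots> = (\<Sum>n. \<integral>\<^sup>+z. ennreal (h (Suc n) powr (-a)) * indicator (ball (0::real^3) (h n)) z \<partial>lborel)"
    by (intro nn_integral_suminf) auto
  also have "\<dots> = (\<Sum>n. ennreal (2 powr a * v * (2 powr (a - 3)) ^ n))"
  proof (intro suminf_cong)
    fix n
    have "(\<integral>\<^sup>+z. ennreal (h (Suc n) powr (-a)) * indicator (ball (0::real^3) (h n)) z \<partial>lborel)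
        = ennreal (h (Suc n) powr (-a)) * ennreal (v * h n ^ 3)"
      using v(2)[of "h n"] hpos[of n] by (simp add: nn_integral_cmult_indicator)
    also have "\<dots> = ennreal (h (Suc n) powr (-a) * (v * h n ^ 3))"
      by (simp add: ennreal_mult')
    also have "h (Suc n) powr (-a) * (v * h n ^ 3) = 2 powr a * v * (2 powr (a - 3)) ^ n"
    proof -
      have e: "h n = 2 powr (- real n)" for n
        by (simp add: h_def powr_minus powr_realpow power_one_over inverse_eq_divide)
      have p1: "h (Suc n) powr (-a) = 2 powr (real (Suc n) * a)"
        unfolding e by (simp add: powr_powr algebra_simps)
      have p2: "h n ^ 3 = 2 powr (- 3 * real n)"
      proof -
        have "h n ^ 3 = (2 powr (- real n)) powr real 3"
          unfolding e by (subst powr_realpow) auto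
        also have "\<dots> = 2 powr (- real n * real 3)" by (rule powr_powr)
        also have "- real n * real 3 = - 3 * real n" by simp
        finally show ?thesis .
      qed
      have p3: "(2 powr (a - 3)) ^ n = 2 powr ((a - 3) * real n)"
        by (simp add: powr_realpow[symmetric] powr_powr)
      have p4: "2 powr (real (Suc n) * a) * 2 powr (- 3 * real n) = 2 powr a * 2 powr ((a - 3) * real n)"
        unfolding powr_add[symmetric] by (simp add: algebra_simps)
      have "h (Suc n) powr (-a) * (v * h n ^ 3) = v * (2 powr (real (Suc n) * a) * 2 powr (- 3 * real n))"
        unfolding p1 p2 by (rule mult.left_commute)
      also have "\<dots> = 2 powr a * v * (2 powr (a - 3)) ^ n"
        unfolding p3 p4 by (simp only: mult.left_commute mult.assoc)
      finally show ?thesis .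
    qed
    finally show "(\<integral>\<^sup>+z. ennreal (h (Suc n) powr (-a)) * indicator (ball (0::real^3) (h n)) z \<partial>lborel)
      = ennreal (2 powr a * v * (2 powr (a - 3)) ^ n)" .
  qed
  also have "\<dots> < \<infinity>"
  proof -
    have "2 powr (a - 3) < (2::real) powr 0" using a by (intro powr_less_mono) auto
    then have "summable (\<lambda>n. 2 powr a * v * (2 powr (a - 3)) ^ n)"
      by (intro summable_mult summable_geometric) auto
    then show ?thesis using v(1) by (subst suminf_ennreal2) auto
  qed
  finally show ?thesis .
qed

text \<open>Integrability has room to spare: for |z| < r one has |z|^-a \<le> r^s |z|^-(a+s), and a
  + s stays below 3 when \<open>s\<close> is half the gap 3 - a. The factor r^s supplies the
  smallness.\<close>

lemma nn_integral_powr_ball_small: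
  assumes a: "a > 0" "a < 3" and e: "e > 0"
  obtains r0 where "0 < r0" "r0 \<le> 1"
    "\<And>r. 0 < r \<Longrightarrow> r \<le> r0 \<Longrightarrow>
      (\<integral>\<^sup>+z. ennreal (norm (z::real^3) powr (-a)) * indicator (ball 0 r) z \<partial>lborel) \<le> ennreal e"
proof -
  define s where "s = (3 - a) / 2"
  have s: "s > 0" "a + s > 0" "a + s < 3" using a by (auto simp: s_def field_simps)
  define I where "I = (\<integral>\<^sup>+z. ennreal (norm (z::real^3) powr (-(a + s))) * indicator (ball 0 1) z \<partial>lborel)"
  have "I < \<infinity>" unfolding I_def by (rule nn_integral_powr_ball_finite[OF s(2,3)])
  then obtain J where J: "J \<ge> 0" "I = ennreal J" by (cases I) auto
  define r0 where "r0 = min 1 ((e / (J + 1)) powr (1 / s))"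
  have r0: "0 < r0" "r0 \<le> 1" using e J by (auto simp: r0_def)
  show ?thesis
  proof (rule that[OF r0])
    fix r :: real assume r: "0 < r" "r \<le> r0"
    have "r powr s \<le> ((e / (J + 1)) powr (1 / s)) powr s"
      using r s by (intro powr_mono2) (auto simp: r0_def)
    also have "\<dots> = e / (J + 1)" using s e J by (simp add: powr_powr)
    finally have rs: "r powr s * J \<le> e"
      using J e by (simp add: field_simps) (smt (verit) mult_nonneg_nonneg powr_ge_zero)
    have "(\<integral>\<^sup>+z. ennreal (norm (z::real^3) powr (-a)) * indicator (ball 0 r) z \<partial>lborel)
       \<le> (\<integral>\<^sup>+z. ennreal (r powr s) * (ennreal (norm (z::real^3) powr (-(a + s))) * indicator (ball 0 1) z) \<partial>lborel)"
    proof (intro nn_integral_mono)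
      fix z :: "real^3"
      show "ennreal (norm z powr (-a)) * indicator (ball 0 r) z
        \<le> ennreal (r powr s) * (ennreal (norm z powr (-(a + s))) * indicator (ball 0 1) z)"
      proof (cases "z \<noteq> 0 \<and> norm z < r")
        case True
        have "norm z powr (-a) = norm z powr s * norm z powr (-(a + s))"
          using True by (simp add: powr_add[symmetric])
        also have "\<dots> \<le> r powr s * norm z powr (-(a + s))"
          using True s by (intro mult_right_mono powr_mono2) auto
        finally have "ennreal (norm z powr (-a)) \<le> ennreal (r powr s * norm z powr (-(a + s)))"
          by (rule ennreal_leI)
        then show ?thesis using True r r0 by (simp add: ennreal_mult')
      qed auto
    qed
    also have "\<dots> = ennreal (r powr s) * I"
      unfolding I_def by (intro nn_integral_cmult) measurable
    also have "\<dots> \<le> ennreal e" using rs J by (simp add: ennreal_mult'[symmetric] ennreal_leI)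
    finally show "(\<integral>\<^sup>+z. ennreal (norm (z::real^3) powr (-a)) * indicator (ball 0 r) z \<partial>lborel) \<le> ennreal e" .
  qed
qed

text \<open>Compare \<open>v\<close> with t^-\<sigma>. If \<open>v\<close> is smaller, the product
  is at most t^-(2+\<sigma>). If it is larger, inserting the factor (v t^\<sigma>)^(q-1) \<ge> 1
  gives v^q t^\<tau> with a positive power of t. A choice with \<sigma> < 1 and \<tau> > 0, i.e.
  2/(q-1) < \<sigma> < 1, exists precisely because q > 3.\<close>

lemma singular_product_bound:
  fixes A q v t r \<sigma> \<tau> :: real
  assumes q: "q > 3" and \<sigma>: "0 < \<sigma>" "\<tau> = \<sigma> * (q - 1) - 2" "\<tau> > 0"
    and t: "0 < t" "t < r" "r \<le> 1" and A: "A \<ge> 1" and v: "v \<ge> 0"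
  shows "t powr (-2) * v \<le> (A + 1) * t powr (-(2 + \<sigma>)) + r powr \<tau> * (if v > A then v powr q else 0)"
proof -
  have t1: "t powr (-2) \<le> t powr (-(2 + \<sigma>))"
    using t \<sigma> by (intro powr_mono') auto
  consider "v \<le> A" | "v > A" "v \<le> t powr (-\<sigma>)" | "v > A" "v > t powr (-\<sigma>)" by linarith
  then show ?thesis
  proof cases
    case 1
    have "t powr (-2) * v \<le> t powr (-(2 + \<sigma>)) * (A + 1)"
      using 1 t1 v A by (intro mult_mono) auto
    then show ?thesis using 1 by (simp add: mult.commute)
  next
    case 2
    have "t powr (-2) * v \<le> t powr (-2) * t powr (-\<sigma>)" using 2 by (intro mult_left_mono) auto
    also have "\<dots> = t powr (-(2 + \<sigma>))" by (simp add: powr_add[symmetric])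
    also have "\<dots> \<le> (A + 1) * t powr (-(2 + \<sigma>))" using mult_right_mono[of 1 "A + 1" "t powr (-(2 + \<sigma>))"] A by simp
    finally show ?thesis using 2 by (simp add: add_increasing2)
  next
    case 3
    have v1: "v > 1" using 3 A by simp
    have "1 = (t powr (-\<sigma>) * t powr \<sigma>) powr (q - 1)" using t by (simp add: powr_add[symmetric])
    also have "\<dots> \<le> (v * t powr \<sigma>) powr (q - 1)"
      using 3 q by (intro powr_mono2 mult_right_mono) auto
    also have "\<dots> = v powr (q - 1) * t powr (\<sigma> * (q - 1))"
      using v1 by (simp add: powr_mult powr_powr)
    finally have "t powr (-2) * v * 1 \<le> t powr (-2) * v * (v powr (q - 1) * t powr (\<sigma> * (q - 1)))"
      using v by (intro mult_left_mono) auto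
    also have "\<dots> = (v powr 1 * v powr (q - 1)) * (t powr (-2) * t powr (\<sigma> * (q - 1)))" using v by simp
    also have "\<dots> = v powr q * t powr \<tau>" unfolding powr_add[symmetric] by (simp add: \<sigma>)
    also have "\<dots> \<le> v powr q * r powr \<tau>" using t \<sigma> by (intro mult_left_mono powr_mono2) auto
    finally have "t powr (-2) * v \<le> r powr \<tau> * v powr q" by (simp add: mult.commute)
    moreover have "0 \<le> (A + 1) * t powr (-(2 + \<sigma>))" using A by simp
    ultimately show ?thesis using 3 by (simp add: add_increasing)
  qed
qed

lemma square_le_of_gt:
  fixes A q v :: real
  assumes "A \<ge> 1" "q > 3" "v > A" shows "v\<^sup>2 \<le> v powr q" "v \<le> v powr q"
proof -
  show "v\<^sup>2 \<le> v powr q" "v \<le> v powr q"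
    using powr_mono[of 2 q v] powr_mono[of 1 q v] assms by auto
qed

text \<open>The singular integral operator with kernel \<open>|x - y|\<^sup>-\<^sup>2 v y\<close> on a small ball has norm less than
  one, both on \<open>L\<^sup>\<infinity>\<close> and, by symmetry of the kernel, on \<open>L\<^sup>1(v)\<close>. Hence the excess \<open>(v - M)\<^sup>+\<close>,
  which is a subsolution of the linearised inequality, vanishes.\<close>

lemma bounded_of_potential_inequality:
  fixes v :: "real^3 \<Rightarrow> real"
  assumes v [measurable]: "v \<in> borel_measurable borel" and v0: "\<And>x. 0 \<le> v x"
    and C: "C > 0"
    and ineq: "AE x in lborel. ennreal (v x) \<le> ennreal C * (\<integral>\<^sup>+y. indicator (cball 0 1) (x - y) *
        (ennreal (v y) + ennreal (norm (x - y) powr (-2) * (v y)\<^sup>2)) \<partial>lborel)"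
    and q: "q > 3" and A: "A \<ge> 1"
    and fin: "(\<integral>\<^sup>+x. ennreal (if v x > A then v x powr q else 0) \<partial>lborel) < \<infinity>"
  obtains M where "AE x in lborel. v x \<le> M"
proof -
  define N where "N = enn2real (\<integral>\<^sup>+x. ennreal (if v x > A then v x powr q else 0) \<partial>lborel)"
  have N: "N \<ge> 0" "(\<integral>\<^sup>+x. ennreal (if v x > A then v x powr q else 0) \<partial>lborel) = ennreal N"
    unfolding N_def using fin by (auto simp: ennreal_enn2real)
  obtain V where V: "V > 0" "\<And>x. emeasure lborel (cball (x::real^3) 1) = ennreal V"
  proof -
    have "emeasure lborel (cball (x::real^3) 1) = ennreal (unit_ball_vol 3)" for x
      using emeasure_cball[of 1 x] by simp
    with unit_ball_vol_pos[of 3] that[of "unit_ball_vol 3"] show ?thesis by simp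
  qed
  have ind: "indicator (cball 0 1) (x - y) = (indicator (cball x 1) y :: ennreal)" for x y :: "real^3"
    by (auto simp: indicator_def dist_norm norm_minus_commute)
  \<comment> \<open>Bounds the integral of \<open>v^2\<close> over any unit ball: values up to
    \<open>A\<close> contribute \<open>A^2 V\<close>, and larger values satisfy v^2 \<le> v^q
    because A \<ge> 1.\<close>
  define B1 where "B1 = A\<^sup>2 * V + N"
  have B1: "B1 \<ge> 0" using V N by (auto simp: B1_def)
  have sq: "(\<integral>\<^sup>+y. indicator (cball 0 1) (x - y) * ennreal ((v y)\<^sup>2) \<partial>lborel) \<le> ennreal B1" for x
  proof -
    have "(\<integral>\<^sup>+y. indicator (cball 0 1) (x - y) * ennreal ((v y)\<^sup>2) \<partial>lborel)
      \<le> (\<integral>\<^sup>+y. ennreal (A\<^sup>2) * indicator (cball x 1) y + ennreal (if v y > A then v y powr q else 0) \<partial>lborel)"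
    proof (intro nn_integral_mono)
      fix y
      show "indicator (cball 0 1) (x - y) * ennreal ((v y)\<^sup>2)
        \<le> ennreal (A\<^sup>2) * indicator (cball x 1) y + ennreal (if v y > A then v y powr q else 0)"
      proof (cases "v y > A")
        case True
        then have "ennreal ((v y)\<^sup>2) \<le> ennreal (v y powr q)"
          using square_le_of_gt[OF A q True] by (intro ennreal_leI)
        then show ?thesis using True by (auto simp: indicator_def add_increasing)
      next
        case False
        then have "ennreal ((v y)\<^sup>2) \<le> ennreal (A\<^sup>2)" using v0[of y] by (intro ennreal_leI power_mono) auto
        then show ?thesis unfolding ind by (auto simp: indicator_def False)
      qed
    qed
    also have "\<dots> = ennreal (A\<^sup>2) * ennreal V + ennreal N"
      using V N by (subst nn_integral_add) (auto simp: nn_integral_cmult_indicator)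
    also have "\<dots> = ennreal B1" using V N by (simp add: B1_def ennreal_mult' ennreal_plus)
    finally show ?thesis .
  qed
  have lin: "(\<integral>\<^sup>+y. indicator (cball 0 1) (x - y) * ennreal (v y) \<partial>lborel) \<le> ennreal (V + B1)" for x
  proof -
    have "(\<integral>\<^sup>+y. indicator (cball 0 1) (x - y) * ennreal (v y) \<partial>lborel)
      \<le> (\<integral>\<^sup>+y. indicator (cball x 1) y + indicator (cball 0 1) (x - y) * ennreal ((v y)\<^sup>2) \<partial>lborel)"
    proof (intro nn_integral_mono)
      fix y
      have "v y \<le> 1 + (v y)\<^sup>2" using zero_le_power2[of "v y - 1"] v0[of y] by (simp add: power2_diff)
      then have "ennreal (v y) \<le> 1 + ennreal ((v y)\<^sup>2)"
        by (metis ennreal_1 ennreal_leI ennreal_plus zero_le_one zero_le_power2)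
      then show "indicator (cball 0 1) (x - y) * ennreal (v y)
        \<le> indicator (cball x 1) y + indicator (cball 0 1) (x - y) * ennreal ((v y)\<^sup>2)"
        unfolding ind by (auto simp: indicator_def)
    qed
    also have "\<dots> = emeasure lborel (cball x 1) + (\<integral>\<^sup>+y. indicator (cball 0 1) (x - y) * ennreal ((v y)\<^sup>2) \<partial>lborel)"
      by (subst nn_integral_add) (auto simp: ind)
    also have "\<dots> \<le> ennreal V + ennreal B1" using V sq[of x] by (intro add_mono) auto
    finally show ?thesis using V B1 by (simp add: ennreal_plus)
  qed
  \<comment> \<open>The lower end of the admissible range for \<sigma>; q > 3 makes it less than 1,
    and \<sigma> is taken halfway between.\<close>
  define b where "b = 2 / (q - 1)"
  have b: "b < 1" "b > 0" using q by (auto simp: b_def)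
  define \<sigma> where "\<sigma> = (b + 1) / 2"
  have \<sigma>: "0 < \<sigma>" "\<sigma> < 1" "b < \<sigma>" using b by (auto simp: \<sigma>_def)
  define \<tau> where "\<tau> = \<sigma> * (q - 1) - 2"
  have \<tau>: "\<tau> > 0" using \<sigma>(3) q by (simp add: \<tau>_def b_def pos_divide_less_eq)
  \<comment> \<open>\<open>e\<close> and then \<open>r\<close> are chosen so that the singular part
    and the L^q part of the integral of \<open>k v\<close>, multiplied by \<open>C\<close>, are each
    at most 1/4. The operator norm is then at most 1/2.\<close>
  define e where "e = 1 / (4 * C * (A + 1))"
  have e: "e > 0" using C A by (simp add: e_def)
  obtain r0 where r0: "0 < r0" "r0 \<le> 1" "\<And>r. 0 < r \<Longrightarrow> r \<le> r0 \<Longrightarrow>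
      (\<integral>\<^sup>+z. ennreal (norm (z::real^3) powr (-(2 + \<sigma>))) * indicator (ball 0 r) z \<partial>lborel) \<le> ennreal e"
    using nn_integral_powr_ball_small[of "2 + \<sigma>" e] \<sigma> e by auto
  define r where "r = min r0 ((1 / (4 * C * (N + 1))) powr (1 / \<tau>))"
  have r: "0 < r" "r \<le> r0" "r \<le> 1" using r0 C N by (auto simp: r_def)
  have rN: "C * (r powr \<tau> * N) \<le> 1 / 4"
  proof -
    have "r powr \<tau> \<le> ((1 / (4 * C * (N + 1))) powr (1 / \<tau>)) powr \<tau>"
      using r \<tau> by (intro powr_mono2) (auto simp: r_def)
    also have "\<dots> = 1 / (4 * C * (N + 1))" using \<tau> C N by (simp add: powr_powr)
    finally have "C * (r powr \<tau> * N) \<le> C * (1 / (4 * C * (N + 1)) * (N + 1))"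
      using C N by (intro mult_left_mono mult_mono) auto
    also have "\<dots> = 1 / 4"
    proof -
      have *: "C * (1 / (4 * C * D) * D) = 1 / 4" if "D > 0" for D using that C by simp
      show ?thesis by (rule *) (use N in auto)
    qed
    finally show ?thesis .
  qed
  \<comment> \<open>Only the part of the kernel within distance \<open>r\<close> is kept; the rest
    is at most r^-2 and is absorbed into the constant \<open>B\<close> below.\<close>
  define k where "k z = norm z powr (-2) * indicator (ball 0 r) z" for z :: "real^3"
  have km [measurable]: "k \<in> borel_measurable borel" unfolding k_def by measurable
  have k0: "k z \<ge> 0" for z by (simp add: k_def)
  have ksym: "k (x - y) = k (y - x)" for x y by (simp add: k_def norm_minus_commute indicator_def)
  have kv: "ennreal C * (\<integral>\<^sup>+y. ennreal (k (x - y) * v y) \<partial>lborel) \<le> ennreal (1 / 2)" for x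
  proof -
    have "(\<integral>\<^sup>+y. ennreal (k (x - y) * v y) \<partial>lborel)
      \<le> (\<integral>\<^sup>+y. ennreal (A + 1) * (ennreal (norm (x - y) powr (-(2 + \<sigma>))) * indicator (ball 0 r) (x - y))
          + ennreal (r powr \<tau>) * ennreal (if v y > A then v y powr q else 0) \<partial>lborel)"
    proof (intro nn_integral_mono)
      fix y
      show "ennreal (k (x - y) * v y) \<le> ennreal (A + 1) * (ennreal (norm (x - y) powr (-(2 + \<sigma>))) * indicator (ball 0 r) (x - y))
          + ennreal (r powr \<tau>) * ennreal (if v y > A then v y powr q else 0)"
      proof (cases "x - y \<noteq> 0 \<and> norm (x - y) < r")
        case True
        then have "k (x - y) * v y = norm (x - y) powr (-2) * v y" by (simp add: k_def)
        also have "\<dots> \<le> (A + 1) * norm (x - y) powr (-(2 + \<sigma>)) + r powr \<tau> * (if v y > A then v y powr q else 0)"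
          using True by (intro singular_product_bound[OF q \<sigma>(1) \<tau>_def \<tau> _ _ r(3) A v0]) auto
        finally have "ennreal (k (x - y) * v y) \<le> ennreal ((A + 1) * norm (x - y) powr (-(2 + \<sigma>)) + r powr \<tau> * (if v y > A then v y powr q else 0))"
          by (rule ennreal_leI)
        also have "\<dots> = ennreal (A + 1) * ennreal (norm (x - y) powr (-(2 + \<sigma>))) + ennreal (r powr \<tau>) * ennreal (if v y > A then v y powr q else 0)"
          using A by (simp add: ennreal_plus ennreal_mult')
        finally show ?thesis using True by simp
      next
        case False
        then have "k (x - y) * v y = 0" by (auto simp: k_def)
        then show ?thesis by (simp only: ennreal_0 zero_le)
      qed
    qed
    also have "\<dots> = ennreal (A + 1) * (\<integral>\<^sup>+y. ennreal (norm (x - y) powr (-(2 + \<sigma>))) * indicator (ball 0 r) (x - y) \<partial>lborel)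
          + ennreal (r powr \<tau>) * ennreal N"
      by (subst nn_integral_add) (auto simp: nn_integral_cmult N(2))
    also have "(\<integral>\<^sup>+y. ennreal (norm (x - y) powr (-(2 + \<sigma>))) * indicator (ball 0 r) (x - y) \<partial>lborel)
       = (\<integral>\<^sup>+z. ennreal (norm (z::real^3) powr (-(2 + \<sigma>))) * indicator (ball 0 r) z \<partial>lborel)"
      by (rule nn_integral_reflect[of "\<lambda>z. ennreal (norm z powr (-(2 + \<sigma>))) * indicator (ball 0 r) z"]) measurable
    also have "ennreal (A + 1) * \<dots> + ennreal (r powr \<tau>) * ennreal N \<le> ennreal (A + 1) * ennreal e + ennreal (r powr \<tau>) * ennreal N"
      by (intro add_right_mono mult_left_mono r0(3) r) auto
    also have "\<dots> = ennreal ((A + 1) * e + r powr \<tau> * N)"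
      using A e N by (simp add: ennreal_plus ennreal_mult')
    finally have "ennreal C * (\<integral>\<^sup>+y. ennreal (k (x - y) * v y) \<partial>lborel) \<le> ennreal C * ennreal ((A + 1) * e + r powr \<tau> * N)"
      by (rule mult_left_mono) simp
    also have "\<dots> = ennreal (C * ((A + 1) * e) + C * (r powr \<tau> * N))"
      using C by (simp add: ennreal_mult'[symmetric] distrib_left)
    also have "\<dots> \<le> ennreal (1 / 2)"
    proof (rule ennreal_leI)
      have "C * ((A + 1) * e) = 1 / 4" using C A by (simp add: e_def)
      then show "C * ((A + 1) * e) + C * (r powr \<tau> * N) \<le> 1 / 2" using rN by simp
    qed
    finally show ?thesis .
  qed
  define B where "B = C * (V + B1 + r powr (-2) * B1)"
  have B: "B \<ge> 0" using C V B1 by (simp add: B_def)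
  have split: "AE x in lborel. ennreal (v x) \<le> ennreal B + ennreal C * (\<integral>\<^sup>+y. ennreal (k (x - y) * (v y)\<^sup>2) \<partial>lborel)"
    using ineq
  proof eventually_elim
    fix x
    assume i: "ennreal (v x) \<le> ennreal C * (\<integral>\<^sup>+y. indicator (cball 0 1) (x - y) *
        (ennreal (v y) + ennreal (norm (x - y) powr (-2) * (v y)\<^sup>2)) \<partial>lborel)"
    have "(\<integral>\<^sup>+y. indicator (cball 0 1) (x - y) * (ennreal (v y) + ennreal (norm (x - y) powr (-2) * (v y)\<^sup>2)) \<partial>lborel)
      \<le> (\<integral>\<^sup>+y. indicator (cball 0 1) (x - y) * ennreal (v y) + (ennreal (r powr (-2)) * (indicator (cball 0 1) (x - y) * ennreal ((v y)\<^sup>2))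
          + ennreal (k (x - y) * (v y)\<^sup>2)) \<partial>lborel)"
    proof (intro nn_integral_mono)
      fix y
      show "indicator (cball 0 1) (x - y) * (ennreal (v y) + ennreal (norm (x - y) powr (-2) * (v y)\<^sup>2))
        \<le> indicator (cball 0 1) (x - y) * ennreal (v y) + (ennreal (r powr (-2)) * (indicator (cball 0 1) (x - y) * ennreal ((v y)\<^sup>2))
          + ennreal (k (x - y) * (v y)\<^sup>2))"
      proof (cases "norm (x - y) \<le> 1")
        case True
        show ?thesis
        proof (cases "norm (x - y) < r")
          case True
          then show ?thesis using \<open>norm (x - y) \<le> 1\<close> by (simp add: k_def add_increasing)
        next
          case False
          then have "norm (x - y) powr (-2) * (v y)\<^sup>2 \<le> r powr (-2) * (v y)\<^sup>2"
            using r by (intro mult_right_mono powr_mono2') auto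
          then have "ennreal (norm (x - y) powr (-2) * (v y)\<^sup>2) \<le> ennreal (r powr (-2)) * ennreal ((v y)\<^sup>2)"
            by (simp add: ennreal_mult'[symmetric] ennreal_leI)
          then show ?thesis using True by (simp add: add_increasing2)
        qed
      qed simp
    qed
    also have "\<dots> = (\<integral>\<^sup>+y. indicator (cball 0 1) (x - y) * ennreal (v y) \<partial>lborel) + (ennreal (r powr (-2)) * (\<integral>\<^sup>+y. indicator (cball 0 1) (x - y) * ennreal ((v y)\<^sup>2) \<partial>lborel)
          + (\<integral>\<^sup>+y. ennreal (k (x - y) * (v y)\<^sup>2) \<partial>lborel))"
      by (subst nn_integral_add, measurable)+ (simp add: nn_integral_cmult)
    also have "\<dots> \<le> ennreal (V + B1) + (ennreal (r powr (-2)) * ennreal B1 + (\<integral>\<^sup>+y. ennreal (k (x - y) * (v y)\<^sup>2) \<partial>lborel))"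
      by (intro add_mono lin mult_left_mono sq) auto
    finally have "ennreal (v x) \<le> ennreal C * (ennreal (V + B1) + (ennreal (r powr (-2)) * ennreal B1 + (\<integral>\<^sup>+y. ennreal (k (x - y) * (v y)\<^sup>2) \<partial>lborel)))"
      using i by (meson mult_left_mono order_trans zero_le)
    also have "\<dots> = ennreal B + ennreal C * (\<integral>\<^sup>+y. ennreal (k (x - y) * (v y)\<^sup>2) \<partial>lborel)"
      using C V B1 by (simp add: B_def distrib_left ennreal_plus ennreal_mult' add.assoc)
    finally show "ennreal (v x) \<le> ennreal B + ennreal C * (\<integral>\<^sup>+y. ennreal (k (x - y) * (v y)\<^sup>2) \<partial>lborel)" .
  qed
  \<comment> \<open>\<open>M \<ge> 2 B\<close> gives B + M/2 \<le> M: replacing one factor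
    \<open>v\<close> by \<open>w + M\<close> costs at most M/2, so the constants are swallowed and a
    homogeneous inequality for \<open>w\<close> remains.\<close>
  define M where "M = max A (2 * B)"
  have M: "M \<ge> A" "M \<ge> 2 * B" "M \<ge> 1" using A by (auto simp: M_def)
  define w where "w x = max 0 (v x - M)" for x
  have w [measurable]: "w \<in> borel_measurable borel" unfolding w_def by measurable
  have w0: "w x \<ge> 0" for x by (simp add: w_def)
  define T where "T x = ennreal C * (\<integral>\<^sup>+y. ennreal (k (x - y) * (v y * w y)) \<partial>lborel)" for x
  have wT: "AE x in lborel. ennreal (w x) \<le> T x"
    using split
  proof eventually_elim
    fix x assume i: "ennreal (v x) \<le> ennreal B + ennreal C * (\<integral>\<^sup>+y. ennreal (k (x - y) * (v y)\<^sup>2) \<partial>lborel)"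
    have "(\<integral>\<^sup>+y. ennreal (k (x - y) * (v y)\<^sup>2) \<partial>lborel)
      \<le> (\<integral>\<^sup>+y. ennreal (k (x - y) * (v y * w y)) + ennreal M * ennreal (k (x - y) * v y) \<partial>lborel)"
    proof (intro nn_integral_mono)
      fix y
      have "k (x - y) * (v y)\<^sup>2 \<le> k (x - y) * (v y * (w y + M))"
        unfolding power2_eq_square using k0 v0 by (intro mult_left_mono) (auto simp: w_def)
      also have "\<dots> = k (x - y) * (v y * w y) + M * (k (x - y) * v y)" by (simp add: algebra_simps)
      finally have "ennreal (k (x - y) * (v y)\<^sup>2) \<le> ennreal (k (x - y) * (v y * w y) + M * (k (x - y) * v y))"
        by (rule ennreal_leI)
      then show "ennreal (k (x - y) * (v y)\<^sup>2) \<le> ennreal (k (x - y) * (v y * w y)) + ennreal M * ennreal (k (x - y) * v y)"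
        using k0 v0 w0 M by (simp add: ennreal_plus ennreal_mult')
    qed
    also have "\<dots> = (\<integral>\<^sup>+y. ennreal (k (x - y) * (v y * w y)) \<partial>lborel) + ennreal M * (\<integral>\<^sup>+y. ennreal (k (x - y) * v y) \<partial>lborel)"
      by (subst nn_integral_add, measurable) (simp add: nn_integral_cmult)
    finally have "ennreal C * (\<integral>\<^sup>+y. ennreal (k (x - y) * (v y)\<^sup>2) \<partial>lborel)
        \<le> ennreal C * ((\<integral>\<^sup>+y. ennreal (k (x - y) * (v y * w y)) \<partial>lborel) + ennreal M * (\<integral>\<^sup>+y. ennreal (k (x - y) * v y) \<partial>lborel))"
      by (rule mult_left_mono) simp
    also have "\<dots> = T x + ennreal M * (ennreal C * (\<integral>\<^sup>+y. ennreal (k (x - y) * v y) \<partial>lborel))"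
      unfolding T_def by (simp only: distrib_left mult.left_commute)
    also have "\<dots> \<le> T x + ennreal M * ennreal (1 / 2)"
      by (intro add_left_mono mult_left_mono kv) auto
    finally have "ennreal (v x) \<le> ennreal B + (T x + ennreal M * ennreal (1 / 2))"
      using i by (meson add_left_mono order_trans)
    also have "\<dots> = ennreal (B + M / 2) + T x"
    proof -
      have "ennreal M * ennreal (1 / 2) = ennreal (M / 2)"
        using M A by (subst ennreal_mult[symmetric]) auto
      then show ?thesis using B M A by (simp only:) (simp add: ennreal_plus ac_simps)
    qed
    also have "\<dots> \<le> ennreal M + T x" using M by (intro add_right_mono ennreal_leI) auto
    finally have "ennreal (v x) \<le> ennreal M + T x" .
    then have "ennreal (v x) - ennreal M \<le> T x"
      by (simp add: ennreal_minus_le_iff)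
    moreover have "ennreal (w x) = ennreal (v x) - ennreal M"
      using M by (auto simp: w_def max_def ennreal_minus ennreal_neg)
    ultimately show "ennreal (w x) \<le> T x" by simp
  qed
  \<comment> \<open>The norm of the excess \<open>w\<close> in L^1 with weight \<open>v\<close>, the
    space in which the contraction is applied.\<close>
  define J where "J = (\<integral>\<^sup>+x. ennreal (v x * w x) \<partial>lborel)"
  have "J \<le> (\<integral>\<^sup>+x. ennreal (v x) * T x \<partial>lborel)"
    unfolding J_def using wT
    by (intro nn_integral_mono_AE) (auto simp: ennreal_mult' v0 elim!: eventually_mono intro: mult_left_mono)
  also have "\<dots> = (\<integral>\<^sup>+x. \<integral>\<^sup>+y. ennreal C * (ennreal (v x) * (ennreal (k (x - y)) * ennreal (v y * w y))) \<partial>lborel \<partial>lborel)"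
  proof (intro nn_integral_cong)
    fix x
    have "ennreal (v x) * T x = ennreal C * (ennreal (v x) * (\<integral>\<^sup>+y. ennreal (k (x - y)) * ennreal (v y * w y) \<partial>lborel))"
      unfolding T_def by (simp add: ennreal_mult' k0 v0 w0 mult.left_commute)
    also have "\<dots> = (\<integral>\<^sup>+y. ennreal C * (ennreal (v x) * (ennreal (k (x - y)) * ennreal (v y * w y))) \<partial>lborel)"
      by (subst nn_integral_cmult[symmetric], measurable)+
    finally show "ennreal (v x) * T x = \<dots>" .
  qed
  \<comment> \<open>After exchanging the integrals, symmetry of \<open>k\<close> puts the kernel
    next to the weight \<open>v x\<close>, so the bound \<open>kv\<close> applies again.\<close>
  also have "\<dots> = (\<integral>\<^sup>+y. \<integral>\<^sup>+x. ennreal C * (ennreal (v x) * (ennreal (k (x - y)) * ennreal (v y * w y))) \<partial>lborel \<partial>lborel)"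
    by (rule lborel_pair.Fubini') measurable
  also have "\<dots> = (\<integral>\<^sup>+y. ennreal (v y * w y) * (ennreal C * (\<integral>\<^sup>+x. ennreal (k (y - x) * v x) \<partial>lborel)) \<partial>lborel)"
  proof (intro nn_integral_cong)
    fix y
    have "(\<integral>\<^sup>+x. ennreal C * (ennreal (v x) * (ennreal (k (x - y)) * ennreal (v y * w y))) \<partial>lborel)
       = (\<integral>\<^sup>+x. (ennreal (v y * w y) * ennreal C) * ennreal (k (y - x) * v x) \<partial>lborel)"
      by (intro nn_integral_cong) (simp add: ksym[of y] ennreal_mult' k0 v0 w0 ac_simps)
    also have "\<dots> = (ennreal (v y * w y) * ennreal C) * (\<integral>\<^sup>+x. ennreal (k (y - x) * v x) \<partial>lborel)"
      by (intro nn_integral_cmult) measurable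
    finally show "(\<integral>\<^sup>+x. ennreal C * (ennreal (v x) * (ennreal (k (x - y)) * ennreal (v y * w y))) \<partial>lborel)
      = ennreal (v y * w y) * (ennreal C * (\<integral>\<^sup>+x. ennreal (k (y - x) * v x) \<partial>lborel))"
      by (simp add: mult.assoc)
  qed
  also have "\<dots> \<le> (\<integral>\<^sup>+y. ennreal (v y * w y) * ennreal (1 / 2) \<partial>lborel)"
    by (intro nn_integral_mono mult_left_mono kv) auto
  also have "\<dots> = J * ennreal (1 / 2)"
    unfolding J_def by (intro nn_integral_multc) measurable
  finally have J2: "J \<le> J * ennreal (1 / 2)" .
  \<comment> \<open>Finiteness is essential: \<open>J \<le> J / 2\<close> gives J = 0 only when J is
    finite.\<close>
  have "J \<le> ennreal N"
    unfolding J_def N(2)[symmetric]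
  proof (intro nn_integral_mono ennreal_leI)
    fix x
    show "v x * w x \<le> (if v x > A then v x powr q else 0)"
    proof (cases "v x > M")
      case True
      then have "v x * w x \<le> (v x)\<^sup>2"
        unfolding power2_eq_square using v0[of x] M A by (intro mult_left_mono) (auto simp: w_def)
      also have "\<dots> \<le> v x powr q" using True M by (intro square_le_of_gt[OF A q]) auto
      finally show ?thesis using True M by simp
    qed (auto simp: w_def)
  qed
  then obtain j where j: "j \<ge> 0" "J = ennreal j" by (cases J) (auto simp: top_unique)
  have "ennreal j * ennreal (1 / 2) = ennreal (j / 2)"
    using j(1) by (subst ennreal_mult[symmetric]) auto
  then have "ennreal j \<le> ennreal (j / 2)" using J2 unfolding j(2) by (simp only:)
  then have "j \<le> j / 2" by (subst (asm) ennreal_le_iff) (use j(1) in auto)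
  then have "j = 0" using j(1) by simp
  then have "AE x in lborel. ennreal (v x * w x) = 0"
    using j(2) nn_integral_0_iff_AE[of "\<lambda>x. ennreal (v x * w x)" lborel] unfolding J_def by simp
  then have "AE x in lborel. v x \<le> M"
  proof eventually_elim
    fix x assume "ennreal (v x * w x) = 0"
    then have "v x * w x \<le> 0" by (simp add: ennreal_eq_0_iff)
    moreover have "v x * w x > 0" if "v x > M" using that M A by (auto simp: w_def intro!: mult_pos_pos)
    ultimately show "v x \<le> M" by force
  qed
  then show ?thesis by (rule that)
qed

subsection \<open>Weak solutions and the potential inequality\<close>

text \<open>The hypotheses in the form in which they are used: Borel fields, integrals over
  \<open>lborel\<close>, and vector test fields given by their components.\<close>

locale stationary_NS =
  fixes u :: "real^3 \<Rightarrow> real^3" and \<pi> :: "real^3 \<Rightarrow> real"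
  assumes u_locint: "\<And>i. locint (\<lambda>x. u x $ i)"
    and uu_locint: "\<And>i j. locint (\<lambda>x. u x $ i * u x $ j)"
    and pressure_locint: "locint \<pi>"
    and momentum: "\<And>\<phi>. (\<And>j. test_fun (\<phi> j)) \<Longrightarrow>
      (\<integral>x. (\<Sum>j\<in>UNIV. u x $ j * lap (\<phi> j) x)
         + (\<Sum>i\<in>UNIV. \<Sum>j\<in>UNIV. u x $ i * u x $ j * partial i (\<phi> j) x)
         + \<pi> x * (\<Sum>j\<in>UNIV. partial j (\<phi> j) x) \<partial>lborel) = 0"
    and divergence_free: "\<And>\<psi>. test_fun \<psi> \<Longrightarrow> (\<integral>x. (\<Sum>i\<in>UNIV. u x $ i * partial i \<psi> x) \<partial>lborel) = 0"
begin

lemma u_comp_borel [measurable]: "(\<lambda>x. u x $ i) \<in> borel_measurable borel"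
  using u_locint locint_borel by blast

lemma norm_u_borel [measurable]: "(\<lambda>x. norm (u x)) \<in> borel_measurable borel"
  unfolding norm_vec_def L2_set_def by measurable

lemma u_test_integrable: "test_fun k \<Longrightarrow> integrable lborel (\<lambda>x. u x $ i * k x)"
  using locint_test_integrable[OF u_locint, of k i] by (simp add: mult.commute)

lemma uu_test_integrable: "test_fun k \<Longrightarrow> integrable lborel (\<lambda>x. u x $ i * u x $ j * k x)"
  using locint_test_integrable[OF uu_locint, of k i j] by (simp add: mult.commute)

text \<open>Testing with the divergence-free field \<open>(\<delta>\<^bsub>kj\<^esub> \<Delta> - \<partial>\<^sub>k \<partial>\<^sub>j) G\<close> removes the pressure.\<close>

lemma stokes_test:
  assumes G: "test_fun G"
  shows "(\<integral>x. u x $ j * lap (lap G) x \<partial>lborel) = - (\<integral>x. (\<Sum>i\<in>UNIV. \<Sum>k\<in>UNIV. u x $ i * u x $ k *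
      partial i (\<lambda>y. (if k = j then 1 else 0) * lap G y - partial k (partial j G) y) x) \<partial>lborel)"
proof -
  have sG: "smooth3 G" using G by (rule test_fun_smooth)
  define c :: "3 \<Rightarrow> real" where "c k = (if k = j then 1 else 0)" for k
  define \<phi> where "\<phi> k = (\<lambda>y. c k * lap G y - partial k (partial j G) y)" for k
  have t: "test_fun (\<phi> k)" for k
    unfolding \<phi>_def by (intro test_fun_diff test_fun_cmult test_fun_lap test_fun_partial G)
  have "lap (partial k (partial j G)) = partial k (partial j (lap G))" for k
    by (simp add: lap_partial smooth3_partial sG)
  then have lap\<phi>: "lap (\<phi> k) = (\<lambda>y. c k * lap (lap G) y - partial k (partial j (lap G)) y)" for k
    unfolding \<phi>_def by (simp add: lap_diff lap_cmult smooth3_cmult smooth3_lap smooth3_partial sG)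
  have sc: "(\<Sum>k\<in>UNIV. a k * (c k * b)) = a j * b" for a :: "3 \<Rightarrow> real" and b
  proof -
    have "(\<Sum>k\<in>UNIV. a k * (c k * b)) = (\<Sum>k\<in>UNIV. if k = j then a k * b else 0)"
      by (rule sum.cong) (auto simp: c_def)
    then show ?thesis by simp
  qed
  \<comment> \<open>The column is divergence free because the Laplacian commutes with \<partial>_j:
    the two contributions are \<partial>_j of the Laplacian of \<open>G\<close> with opposite
    signs.\<close>
  have div\<phi>: "(\<Sum>k\<in>UNIV. partial k (\<phi> k) x) = 0" for x
  proof -
    have "partial k (\<phi> k) x = c k * partial k (lap G) x - partial k (partial k (partial j G)) x" for k
      unfolding \<phi>_def
      by (simp add: partial_smooth_diff partial_smooth_cmult smooth3_cmult smooth3_lap smooth3_partial sG)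
    then have "(\<Sum>k\<in>UNIV. partial k (\<phi> k) x) = (\<Sum>k\<in>UNIV. c k * partial k (lap G) x) - lap (partial j G) x"
      by (simp add: sum_subtractf lap_def)
    also have "(\<Sum>k\<in>UNIV. c k * partial k (lap G) x) = (\<Sum>k\<in>UNIV. if k = j then partial k (lap G) x else 0)"
      by (rule sum.cong) (auto simp: c_def)
    finally show ?thesis by (simp add: lap_partial sG)
  qed
  define S where "S x = (\<Sum>i\<in>UNIV. \<Sum>k\<in>UNIV. u x $ i * u x $ k * partial i (\<phi> k) x)" for x
  have iS: "integrable lborel S"
    unfolding S_def by (intro Bochner_Integration.integrable_sum uu_test_integrable test_fun_partial t)
  define P where "P x = (\<Sum>k\<in>UNIV. u x $ k * partial k (partial j (lap G)) x)" for x
  have iP: "integrable lborel P"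
    unfolding P_def by (intro Bochner_Integration.integrable_sum u_test_integrable test_fun_partial test_fun_lap G)
  have iL: "integrable lborel (\<lambda>x. u x $ j * lap (lap G) x)"
    by (intro u_test_integrable test_fun_lap G)
  have "0 = (\<integral>x. (\<Sum>k\<in>UNIV. u x $ k * lap (\<phi> k) x) + S x + \<pi> x * (\<Sum>k\<in>UNIV. partial k (\<phi> k) x) \<partial>lborel)"
    using momentum[of \<phi>] t unfolding S_def by simp
  also have "\<dots> = (\<integral>x. u x $ j * lap (lap G) x - P x + S x \<partial>lborel)"
    by (intro Bochner_Integration.integral_cong)
      (simp_all add: div\<phi> lap\<phi> right_diff_distrib sum_subtractf sc P_def)
  also have "\<dots> = (\<integral>x. u x $ j * lap (lap G) x \<partial>lborel) - (\<integral>x. P x \<partial>lborel) + (\<integral>x. S x \<partial>lborel)"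
    using iS iP iL by simp
  \<comment> \<open>The second half of \<open>lap (\<phi> k)\<close> is the gradient of the scalar
    test function \<open>partial j (lap G)\<close>, hence orthogonal to the divergence-free
    field.\<close>
  also have "(\<integral>x. P x \<partial>lborel) = 0"
    unfolding P_def by (intro divergence_free test_fun_partial test_fun_lap G)
  finally show ?thesis unfolding S_def \<phi>_def c_def by simp
qed

text \<open>The potential centred at \<open>x\<close> is put into the Stokes test. Only third
  derivatives of \<open>pot\<close> meet the quadratic term, which gives the kernel |x - y|^-2. Each
  derivative of a test component costs 4 such terms, three from the Laplacian and one from the mixed
  derivative, and nine index pairs give the factor 36.\<close>

lemma bilap_pot_bound:
  obtains C where "C > 0"
    "\<And>d x j. 0 < d \<Longrightarrow> d \<le> 1 \<Longrightarrow> ennreal \<bar>conv (lap (lap (pot d))) (\<lambda>y. u y $ j) x\<bar>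
      \<le> ennreal C * (\<integral>\<^sup>+y. indicator (cball 0 1) (x - y) * ennreal (norm (x - y) powr (-2) * (norm (u y))\<^sup>2) \<partial>lborel)"
proof -
  obtain C where C: "C > 0"
    "\<And>i j k d x. 0 < d \<Longrightarrow> d \<le> 1 \<Longrightarrow> x \<noteq> 0 \<Longrightarrow>
      \<bar>partial i (partial j (partial k (pot d))) x\<bar> \<le> C * (indicator (cball 0 1) x / (norm x)\<^sup>2)"
    using pot_partial3_bound by blast
  show ?thesis
  proof (rule that[of "36 * C"])
    fix d x j assume d: "0 < d" "d \<le> (1::real)"
    have tp: "test_fun (pot d)" and sp: "smooth3 (pot d)" using test_fun_pot[OF d(1)] test_fun_smooth by auto
    define G where "G y = pot d (x - y)" for y
    have G: "test_fun G" unfolding G_def by (rule test_fun_reflect[OF tp])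
    have sG: "smooth3 G" using G by (rule test_fun_smooth)
    define h where "h y = indicator (cball 0 1) (x - y) / (norm (x - y))\<^sup>2" for y
    have lapG: "lap G = (\<lambda>y. lap (pot d) (x - y))"
      unfolding G_def[abs_def] by (rule lap_reflect[OF sp])
    have bilapG: "lap (lap G) = (\<lambda>y. lap (lap (pot d)) (x - y))"
      unfolding lapG by (rule lap_reflect[OF smooth3_lap[OF sp]])
    define \<phi> where "\<phi> k = (\<lambda>y. (if k = j then 1 else 0) * lap G y - partial k (partial j G) y)" for k
    have t: "test_fun (\<phi> k)" for k
      unfolding \<phi>_def by (intro test_fun_diff test_fun_cmult test_fun_lap test_fun_partial G)
    have \<phi>b: "\<bar>partial i (\<phi> k) y\<bar> \<le> 4 * C * h y" if "y \<noteq> x" for i k y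
    proof -
      have ne: "x - y \<noteq> 0" using that by simp
      have p3: "partial i (partial k (partial j G)) y = - partial i (partial k (partial j (pot d))) (x - y)"
        unfolding G_def[abs_def]
        by (simp add: partial_reflect sp smooth3_partial partial_smooth_uminus smooth3_reflect smooth3_uminus)
      have pl: "partial i (lap G) y = - (\<Sum>l\<in>UNIV. partial i (partial l (partial l (pot d))) (x - y))"
      proof -
        have "partial i (lap G) y = - partial i (lap (pot d)) (x - y)"
          unfolding lapG by (simp add: partial_reflect smooth3_lap sp)
        also have "partial i (lap (pot d)) = (\<lambda>x. \<Sum>l\<in>UNIV. partial i (partial l (partial l (pot d))) x)"
          unfolding lap_def[abs_def] by (intro partial_smooth_sum smooth3_partial sp)
        finally show ?thesis .
      qed
      have "\<bar>partial i (lap G) y\<bar> \<le> (\<Sum>l\<in>UNIV. \<bar>partial i (partial l (partial l (pot d))) (x - y)\<bar>)"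
        unfolding pl by simp
      also have "\<dots> \<le> (\<Sum>l\<in>(UNIV::3 set). C * h y)"
        unfolding h_def by (intro sum_mono C(2)[OF d ne])
      finally have b1: "\<bar>partial i (lap G) y\<bar> \<le> 3 * (C * h y)" by simp
      have b2: "\<bar>partial i (partial k (partial j G)) y\<bar> \<le> C * h y"
        unfolding p3 h_def using C(2)[OF d ne] by simp
      have "partial i (\<phi> k) y = (if k = j then 1 else 0) * partial i (lap G) y - partial i (partial k (partial j G)) y"
        unfolding \<phi>_def
        by (simp add: partial_smooth_diff partial_smooth_cmult smooth3_cmult smooth3_lap smooth3_partial sG)
      then show ?thesis using b1 b2 by (auto split: if_splits)
    qed
    define S where "S y = (\<Sum>i\<in>UNIV. \<Sum>k\<in>UNIV. u y $ i * u y $ k * partial i (\<phi> k) y)" for y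
    have iS: "integrable lborel S"
      unfolding S_def by (intro Bochner_Integration.integrable_sum uu_test_integrable test_fun_partial t)
    have Sb: "\<bar>S y\<bar> \<le> 36 * C * (indicator (cball 0 1) (x - y) * (norm (x - y) powr (-2) * (norm (u y))\<^sup>2))" if "y \<noteq> x" for y
    proof -
      define K where "K = norm (u y) * norm (u y) * (4 * C * h y)"
      have "\<bar>S y\<bar> \<le> (\<Sum>i\<in>UNIV. \<Sum>k\<in>UNIV. \<bar>u y $ i * u y $ k * partial i (\<phi> k) y\<bar>)"
        unfolding S_def by (rule order_trans[OF sum_abs]) (intro sum_mono sum_abs)
      also have "\<dots> \<le> (\<Sum>i\<in>(UNIV::3 set). \<Sum>k\<in>(UNIV::3 set). K)"
      proof (intro sum_mono)
        fix i k
        show "\<bar>u y $ i * u y $ k * partial i (\<phi> k) y\<bar> \<le> K"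
          unfolding abs_mult K_def
          by (rule mult_mono[OF mult_mono[OF abs_component_le_norm abs_component_le_norm] \<phi>b[OF that]]) auto
      qed
      also have "\<dots> = 9 * K" by simp
      also have "\<dots> = 36 * C * (h y * (norm (u y))\<^sup>2)" unfolding K_def by (simp add: power2_eq_square)
      finally show ?thesis using that by (simp add: h_def powr_minus_divide)
    qed
    have "conv (lap (lap (pot d))) (\<lambda>y. u y $ j) x = (\<integral>y. u y $ j * lap (lap G) y \<partial>lborel)"
      unfolding conv_def bilapG by (simp add: mult.commute)
    also have "\<dots> = - (\<integral>y. S y \<partial>lborel)"
      unfolding S_def \<phi>_def by (rule stokes_test[OF G])
    finally have "ennreal \<bar>conv (lap (lap (pot d))) (\<lambda>y. u y $ j) x\<bar> \<le> (\<integral>\<^sup>+y. ennreal \<bar>S y\<bar> \<partial>lborel)"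
      using integral_norm_bound_ennreal[OF iS] by simp
    also have "\<dots> \<le> (\<integral>\<^sup>+y. ennreal (36 * C) * (indicator (cball 0 1) (x - y) * ennreal (norm (x - y) powr (-2) * (norm (u y))\<^sup>2)) \<partial>lborel)"
    proof (rule nn_integral_mono_AE)
      \<comment> \<open>The point y = x is excluded because \<open>0 powr (-2)\<close> is 0 and the
        right-hand side vanishes there; it is a null set.\<close>
      show "AE y in lborel. ennreal \<bar>S y\<bar> \<le> ennreal (36 * C) * (indicator (cball 0 1) (x - y) * ennreal (norm (x - y) powr (-2) * (norm (u y))\<^sup>2))"
        using AE_lborel_singleton[of x]
      proof eventually_elim
        fix y assume "y \<noteq> x"
        from ennreal_leI[OF Sb[OF this]] C(1)
        show "ennreal \<bar>S y\<bar> \<le> ennreal (36 * C) * (indicator (cball 0 1) (x - y) * ennreal (norm (x - y) powr (-2) * (norm (u y))\<^sup>2))"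
          by (cases "norm (x - y) \<le> 1") (auto simp: ennreal_mult'[symmetric])
      qed
    qed
    also have "\<dots> = ennreal (36 * C) * (\<integral>\<^sup>+y. indicator (cball 0 1) (x - y) * ennreal (norm (x - y) powr (-2) * (norm (u y))\<^sup>2) \<partial>lborel)"
      by (intro nn_integral_cmult) measurable
    finally show "ennreal \<bar>conv (lap (lap (pot d))) (\<lambda>y. u y $ j) x\<bar>
      \<le> ennreal (36 * C) * (\<integral>\<^sup>+y. indicator (cball 0 1) (x - y) * ennreal (norm (x - y) powr (-2) * (norm (u y))\<^sup>2) \<partial>lborel)" .
  qed (use C in simp)
qed

end

section \<open>The concentrating part of the bilaplacian\<close>

text \<open>Minus the bilaplacian of \<open>pot d\<close> near the origin. As \<open>d\<close> tends
  to 0 it behaves like a positive multiple of the Dirac measure; it is left unnormalised.\<close>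

definition delta_part :: "real \<Rightarrow> real^3 \<Rightarrow> real" where
  "delta_part d z = (if norm z < 1/2 then 15 * d ^ 4 * rp (-7) d z else 0)"

lemma rp_borel [measurable]: "rp k d \<in> borel_measurable borel"
  unfolding rp_def[abs_def] by measurable

lemma delta_part_borel [measurable]: "delta_part d \<in> borel_measurable borel"
  unfolding delta_part_def[abs_def] by measurable

lemma delta_part_nonneg: "d > 0 \<Longrightarrow> delta_part d z \<ge> 0"
  by (simp add: delta_part_def less_imp_le[OF rp_pos])

lemma rp_7_le:
  assumes "d > 0" "r > 0" "r\<^sup>2 \<le> (norm x)\<^sup>2 + d\<^sup>2" shows "rp (-7) d x \<le> 1 / r ^ 7"
proof -
  have "rp (-7) d x \<le> (r\<^sup>2) powr (-7/2)"
    unfolding rp_def using assms by (intro powr_mono2') auto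
  also have "r\<^sup>2 = r powr 2" using assms by simp
  also have "(r powr 2) powr (-7/2) = r powr (- real 7)" by (simp add: powr_powr)
  also have "\<dots> = 1 / r ^ 7" using assms by (simp only: powr_minus_divide powr_realpow)
  finally show ?thesis .
qed

lemma delta_part_le:
  assumes "d > 0" shows "delta_part d z \<le> 15 * d ^ 4 / d ^ 7"
proof -
  have "15 * d ^ 4 * rp (-7) d z \<le> 15 * d ^ 4 * (1 / d ^ 7)"
    using assms by (intro mult_left_mono rp_7_le) auto
  then show ?thesis using assms by (simp add: delta_part_def)
qed

text \<open>On the ball of radius \<open>d\<close> one has |z|^2 + d^2 \<le> 2 d^2, so the density
  is at least a constant times d^-3, which compensates the volume. A lower bound on the mass is
  enough to normalise the kernel with uniform constants.\<close>

lemma delta_part_mass: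
  obtains c where "c > 0" "\<And>d. 0 < d \<Longrightarrow> d \<le> 1/2 \<Longrightarrow> ennreal c \<le> (\<integral>\<^sup>+z. ennreal (delta_part d z) \<partial>lborel)"
proof -
  obtain v where v: "v > 0" "\<And>r. r \<ge> 0 \<Longrightarrow> emeasure lborel (ball (0::real^3) r) = ennreal (v * r ^ 3)"
    using emeasure_ball3 by metis
  define b where "b = (2::real) powr (-7/2)"
  have b: "b > 0" by (simp add: b_def)
  show ?thesis
  proof (rule that[of "15 * b * v"])
    fix d :: real assume d: "0 < d" "d \<le> 1/2"
    have low: "15 * b / d ^ 3 \<le> delta_part d z" if "norm z < d" for z
    proof -
      have "(norm z)\<^sup>2 \<le> d\<^sup>2" using that by (intro power_mono) auto
      then have "(2 * d powr 2) powr (-7/2) \<le> rp (-7) d z"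
        unfolding rp_def using d rp_base_pos[OF d(1), of z] by (intro powr_mono2') auto
      moreover have "(2 * d powr 2) powr (-7/2) = b / d ^ 7"
      proof -
        have "(2 * d powr 2) powr (-7/2) = b * d powr (- real 7)"
        proof -
          have "(2 * d powr 2) powr (-7/2) = b * (d powr 2) powr (-7/2)"
            unfolding b_def by (rule powr_mult)
          also have "(d powr 2) powr (-7/2) = d powr (2 * (-7/2))" by (rule powr_powr)
          also have "2 * (-7/2) = - real 7" by simp
          finally show ?thesis .
        qed
        then show ?thesis using d by (simp only: powr_minus_divide powr_realpow) simp
      qed
      ultimately have "15 * d ^ 4 * (b / d ^ 7) \<le> 15 * d ^ 4 * rp (-7) d z"
        using d by (intro mult_left_mono) auto
      moreover have "15 * d ^ 4 * (b / d ^ 7) = 15 * b / d ^ 3"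
        using d by (simp add: divide_simps power_add[symmetric])
      ultimately show ?thesis using that d by (simp add: delta_part_def)
    qed
    have "ennreal (15 * b * v) = ennreal (15 * b / d ^ 3) * ennreal (v * d ^ 3)"
      using d b v by (simp add: ennreal_mult'[symmetric])
    also have "\<dots> = (\<integral>\<^sup>+z. ennreal (15 * b / d ^ 3) * indicator (ball (0::real^3) d) z \<partial>lborel)"
      using v(2)[of d] d by (simp add: nn_integral_cmult_indicator)
    also have "\<dots> \<le> (\<integral>\<^sup>+z. ennreal (delta_part d z) \<partial>lborel)"
    proof (intro nn_integral_mono)
      fix z :: "real^3"
      show "ennreal (15 * b / d ^ 3) * indicator (ball 0 d) z \<le> ennreal (delta_part d z)"
        using ennreal_leI[OF low[of z]] by (cases "norm z < d") auto
    qed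
    finally show "ennreal (15 * b * v) \<le> (\<integral>\<^sup>+z. ennreal (delta_part d z) \<partial>lborel)" .
  qed (use b v in simp)
qed

lemma conv_bounded_integrable:
  assumes "locint f" "k \<in> borel_measurable borel" "\<And>z. \<bar>k z\<bar> \<le> C" "\<And>z. norm z > 1 \<Longrightarrow> k z = 0"
  shows "integrable lborel (\<lambda>y. k (x - y) * f y)"
proof (rule locint_mult_integrable[where C = C and R = "norm x + 1"])
  show "(\<lambda>y. k (x - y)) \<in> borel_measurable borel" using assms(2) by measurable
  fix y :: "real^3" assume "norm y > norm x + 1"
  then have "norm (x - y) > 1" using norm_triangle_ineq2[of y x] by (simp add: norm_minus_commute)
  then show "k (x - y) = 0" by (rule assms(4))
qed (use assms in auto)

context stationary_NS
begin

text \<open>The bilaplacian of \<open>pot d\<close> splits as \<open>S - delta_part d\<close> with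
  \<open>S\<close> bounded and supported in the unit ball. The bilaplacian contributes the quadratic
  term and \<open>S\<close> the linear one, so the convolution of \<open>u\<close> with
  \<open>delta_part d\<close> is controlled uniformly in \<open>d\<close>. After normalisation this
  convolution tends to \<open>u\<close> in L^1 on balls, and the excess of |u_j| over the bound has
  zero integral.\<close>

lemma potential_inequality_component:
  obtains C where "C > 0"
    "\<And>j. AE x in lborel. ennreal \<bar>u x $ j\<bar> \<le> ennreal C * (\<integral>\<^sup>+y. indicator (cball 0 1) (x - y) *
        (ennreal (norm (u y)) + ennreal (norm (x - y) powr (-2) * (norm (u y))\<^sup>2)) \<partial>lborel)"
proof -
  obtain C1 where C1: "C1 > 0"
    "\<And>d x j. 0 < d \<Longrightarrow> d \<le> 1 \<Longrightarrow> ennreal \<bar>conv (lap (lap (pot d))) (\<lambda>y. u y $ j) x\<bar>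
      \<le> ennreal C1 * (\<integral>\<^sup>+y. indicator (cball 0 1) (x - y) * ennreal (norm (x - y) powr (-2) * (norm (u y))\<^sup>2) \<partial>lborel)"
    using bilap_pot_bound by blast
  obtain C2 where C2: "C2 > 0"
    "\<And>d x. 0 < d \<Longrightarrow> d \<le> 1 \<Longrightarrow> norm x \<ge> 1/2 \<Longrightarrow> \<bar>lap (lap (pot d)) x\<bar> \<le> C2 * indicator (cball 0 1) x"
    using bilap_pot_outer by blast
  obtain c0 where c0: "c0 > 0" "\<And>d. 0 < d \<Longrightarrow> d \<le> 1/2 \<Longrightarrow> ennreal c0 \<le> (\<integral>\<^sup>+z. ennreal (delta_part d z) \<partial>lborel)"
    using delta_part_mass by blast
  obtain V where V: "V > 0" "\<And>r. r \<ge> 0 \<Longrightarrow> emeasure lborel (ball (0::real^3) r) = ennreal (V * r ^ 3)"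
    using emeasure_ball3 by metis
  define W where "W x = (\<integral>\<^sup>+y. indicator (cball 0 1) (x - y) *
        (ennreal (norm (u y)) + ennreal (norm (x - y) powr (-2) * (norm (u y))\<^sup>2)) \<partial>lborel)" for x
  have Wm [measurable]: "W \<in> borel_measurable borel" unfolding W_def by measurable
  define C where "C = (C1 + C2) / c0"
  have C: "C > 0" using C1 C2 c0 by (simp add: C_def)
  have W2: "(\<integral>\<^sup>+y. indicator (cball 0 1) (x - y) * ennreal (norm (x - y) powr (-2) * (norm (u y))\<^sup>2) \<partial>lborel) \<le> W x" for x
    unfolding W_def by (intro nn_integral_mono mult_left_mono) (auto simp: add_increasing)
  have W1: "(\<integral>\<^sup>+y. indicator (cball 0 1) (x - y) * ennreal (norm (u y)) \<partial>lborel) \<le> W x" for x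
    unfolding W_def by (intro nn_integral_mono mult_left_mono) (auto simp: add_increasing2)
  have convZ: "ennreal \<bar>conv (delta_part d) (\<lambda>y. u y $ j) x\<bar> \<le> ennreal (C1 + C2) * W x"
    if d: "0 < d" "d \<le> 1/2" for d x j
  proof -
    define S where "S z = (if norm z < 1/2 then 0 else lap (lap (pot d)) z)" for z
    have sp: "smooth3 (lap (lap (pot d)))" by (intro smooth3_lap test_fun_smooth test_fun_pot d)
    have [measurable]: "lap (lap (pot d)) \<in> borel_measurable borel" using sp by (rule smooth3_borel)
    have Sm [measurable]: "S \<in> borel_measurable borel" unfolding S_def[abs_def] by measurable
    have Sb: "\<bar>S z\<bar> \<le> C2 * indicator (cball 0 1) z" for z
      using C2 d by (auto simp: S_def)
    have S0: "S z = 0" if "norm z > 1" for z using Sb[of z] that by simp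
    have Sb': "\<bar>S z\<bar> \<le> C2" for z using Sb[of z] C2(1) by (cases "norm z \<le> 1") auto
    have dec: "lap (lap (pot d)) z = S z - delta_part d z" for z
      using bilap_pot_inner[OF d(1), of z] by (simp add: S_def delta_part_def)
    have iS: "integrable lborel (\<lambda>y. S (x - y) * u y $ j)"
      by (rule conv_bounded_integrable[OF u_locint Sm Sb' S0])
    have Z0: "delta_part d z = 0" if "norm z > 1" for z using that by (simp add: delta_part_def)
    have Zb: "\<bar>delta_part d z\<bar> \<le> 15 * d ^ 4 / d ^ 7" for z
      using delta_part_nonneg[OF d(1), of z] delta_part_le[OF d(1), of z] by simp
    have iZ: "integrable lborel (\<lambda>y. delta_part d (x - y) * u y $ j)"
      by (rule conv_bounded_integrable[OF u_locint delta_part_borel Zb Z0])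
    have "conv (lap (lap (pot d))) (\<lambda>y. u y $ j) x = conv S (\<lambda>y. u y $ j) x - conv (delta_part d) (\<lambda>y. u y $ j) x"
      unfolding conv_def dec using iS iZ by (simp add: left_diff_distrib)
    then have "\<bar>conv (delta_part d) (\<lambda>y. u y $ j) x\<bar> \<le> \<bar>conv (lap (lap (pot d))) (\<lambda>y. u y $ j) x\<bar> + \<bar>conv S (\<lambda>y. u y $ j) x\<bar>"
      by linarith
    then have "ennreal \<bar>conv (delta_part d) (\<lambda>y. u y $ j) x\<bar>
       \<le> ennreal \<bar>conv (lap (lap (pot d))) (\<lambda>y. u y $ j) x\<bar> + ennreal \<bar>conv S (\<lambda>y. u y $ j) x\<bar>"
      by (simp add: ennreal_plus[symmetric] ennreal_leI del: ennreal_plus)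
    moreover have "ennreal \<bar>conv S (\<lambda>y. u y $ j) x\<bar> \<le> ennreal C2 * W x"
    proof -
      have "ennreal \<bar>conv S (\<lambda>y. u y $ j) x\<bar> \<le> (\<integral>\<^sup>+y. ennreal \<bar>S (x - y) * u y $ j\<bar> \<partial>lborel)"
      unfolding conv_def using integral_norm_bound_ennreal[OF iS] by simp
    also have "\<dots> \<le> (\<integral>\<^sup>+y. ennreal C2 * (indicator (cball 0 1) (x - y) * ennreal (norm (u y))) \<partial>lborel)"
    proof (intro nn_integral_mono)
      fix y
      have "\<bar>S (x - y) * u y $ j\<bar> \<le> C2 * indicator (cball 0 1) (x - y) * norm (u y)"
        unfolding abs_mult using C2(1) by (intro mult_mono Sb abs_component_le_norm) auto
      then have "ennreal \<bar>S (x - y) * u y $ j\<bar> \<le> ennreal (C2 * indicator (cball 0 1) (x - y) * norm (u y))"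
        by (rule ennreal_leI)
      also have "\<dots> = ennreal C2 * (indicator (cball 0 1) (x - y) * ennreal (norm (u y)))"
        using C2(1) by (cases "norm (x - y) \<le> 1") (auto simp: ennreal_mult')
      finally show "ennreal \<bar>S (x - y) * u y $ j\<bar> \<le> \<dots>" .
    qed
    also have "\<dots> = ennreal C2 * (\<integral>\<^sup>+y. indicator (cball 0 1) (x - y) * ennreal (norm (u y)) \<partial>lborel)"
      by (intro nn_integral_cmult) measurable
    also have "\<dots> \<le> ennreal C2 * W x" by (intro mult_left_mono W1) simp
      finally show ?thesis .
    qed
    moreover have "ennreal \<bar>conv (lap (lap (pot d))) (\<lambda>y. u y $ j) x\<bar> \<le> ennreal C1 * W x"
      by (rule order_trans[OF C1(2) mult_left_mono[OF W2]]) (use d in auto)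
    ultimately have "ennreal \<bar>conv (delta_part d) (\<lambda>y. u y $ j) x\<bar> \<le> ennreal C1 * W x + ennreal C2 * W x"
      by (meson add_mono order_trans)
    also have "\<dots> = ennreal (C1 + C2) * W x"
      using C1 C2 by (simp add: ennreal_plus distrib_right)
    finally show ?thesis .
  qed
  have approx: "(\<integral>\<^sup>+x. (ennreal \<bar>u x $ j\<bar> - ennreal C * W x) * indicator (cball 0 R) x \<partial>lborel) \<le> ennreal e"
    if e: "e > 0" for R e j
  proof -
    obtain r where r: "r > 0"
     "\<And>k C. k \<in> borel_measurable borel \<Longrightarrow> (\<And>x. 0 \<le> k x) \<Longrightarrow> (\<And>x. k x \<le> C) \<Longrightarrow>
      (\<And>x. norm x > 1 \<Longrightarrow> k x = 0) \<Longrightarrow>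
      (\<integral>\<^sup>+x. ennreal (k x) \<partial>lborel) = 1 \<Longrightarrow>
      (\<integral>\<^sup>+x. ennreal (k x) * indicator {x. r \<le> norm x} x \<partial>lborel) \<le> ennreal r \<Longrightarrow>
      (\<integral>\<^sup>+x. ennreal \<bar>conv k (\<lambda>y. u y $ j) x - u x $ j\<bar> * indicator (cball 0 R) x \<partial>lborel) \<le> ennreal e"
      using approximate_identity_local[OF u_locint[of j] e, of R] by blast
    \<comment> \<open>Outside radius \<open>r\<close> the normalised kernel is at most 15 d / (r^7
      c0), using d^4 \<le> d, and it is supported in the unit ball of volume \<open>V\<close>. This
      choice makes that mass at most \<open>r\<close>.\<close>
    define d where "d = min (1/2) (r ^ 8 * c0 / (15 * V))"
    have d: "0 < d" "d \<le> 1/2" "d \<le> r ^ 8 * c0 / (15 * V)" using r c0 V by (auto simp: d_def)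
    have Zm: "(\<integral>\<^sup>+z. ennreal (delta_part d z) \<partial>lborel) \<le> ennreal (15 * d ^ 4 / d ^ 7 * V)"
    proof -
      have "(\<integral>\<^sup>+z. ennreal (delta_part d z) \<partial>lborel) \<le> (\<integral>\<^sup>+z. ennreal (15 * d ^ 4 / d ^ 7) * indicator (ball (0::real^3) 1) z \<partial>lborel)"
      proof (intro nn_integral_mono)
        fix z
        show "ennreal (delta_part d z) \<le> ennreal (15 * d ^ 4 / d ^ 7) * indicator (ball 0 1) z"
          using delta_part_le[OF d(1), of z] by (cases "norm z < 1") (auto simp: delta_part_def intro: ennreal_leI)
      qed
      also have "\<dots> = ennreal (15 * d ^ 4 / d ^ 7) * ennreal V"
        using V(2)[of 1] by (simp add: nn_integral_cmult_indicator)
      also have "\<dots> = ennreal (15 * d ^ 4 / d ^ 7 * V)"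
        using V(1) d by (intro ennreal_mult[symmetric]) auto
      finally show ?thesis .
    qed
    obtain m where m: "(\<integral>\<^sup>+z. ennreal (delta_part d z) \<partial>lborel) = ennreal m" "m \<ge> 0"
      using Zm by (cases "\<integral>\<^sup>+z. ennreal (delta_part d z) \<partial>lborel") (auto simp: top_unique)
    have mc: "c0 \<le> m" using c0(2)[OF d(1,2)] m by simp
    then have m0: "m > 0" using c0 by simp
    define k where "k z = delta_part d z / m" for z
    have "(\<integral>\<^sup>+x. ennreal \<bar>conv k (\<lambda>y. u y $ j) x - u x $ j\<bar> * indicator (cball 0 R) x \<partial>lborel) \<le> ennreal e"
    proof (rule r(2))
      show "k \<in> borel_measurable borel" unfolding k_def[abs_def] by measurable
      show "k z \<ge> 0" for z unfolding k_def using m0 delta_part_nonneg[OF d(1), of z] by simp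
      show "k z \<le> 15 * d ^ 4 / d ^ 7 / m" for z
        unfolding k_def using m0 delta_part_le[OF d(1), of z] by (intro divide_right_mono) auto
      show "k z = 0" if "norm z > 1" for z using that by (simp add: k_def delta_part_def)
      have km: "ennreal (k z) = ennreal (1 / m) * ennreal (delta_part d z)" for z
        unfolding k_def using m0 by (simp add: ennreal_mult'[symmetric])
      have "(\<integral>\<^sup>+z. ennreal (k z) \<partial>lborel) = ennreal (1 / m) * ennreal m"
        unfolding km by (subst nn_integral_cmult) (auto simp: m)
      also have "\<dots> = ennreal (1 / m * m)" using m0 by (subst ennreal_mult) auto
      also have "1 / m * m = 1" using m0 by simp
      finally show "(\<integral>\<^sup>+z. ennreal (k z) \<partial>lborel) = 1" by simp
      have "(\<integral>\<^sup>+z. ennreal (k z) * indicator {x. r \<le> norm x} z \<partial>lborel)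
         \<le> (\<integral>\<^sup>+z. ennreal (15 * d / r ^ 7 / c0) * indicator (ball (0::real^3) 1) z \<partial>lborel)"
      proof (intro nn_integral_mono)
        fix z :: "real^3"
        show "ennreal (k z) * indicator {x. r \<le> norm x} z \<le> ennreal (15 * d / r ^ 7 / c0) * indicator (ball 0 1) z"
        proof (cases "r \<le> norm z \<and> norm z < 1/2")
          case True
          have "r\<^sup>2 \<le> (norm z)\<^sup>2" using True r(1) by (intro power_mono) auto
          then have "r\<^sup>2 \<le> (norm z)\<^sup>2 + d\<^sup>2" by (simp add: add_increasing2)
          then have "rp (-7) d z \<le> 1 / r ^ 7" by (intro rp_7_le d r)
          moreover have "d ^ 4 \<le> d ^ 1" using d by (intro power_decreasing) auto
          ultimately have "15 * d ^ 4 * rp (-7) d z \<le> 15 * d * (1 / r ^ 7)"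
            using d r rp_pos[OF d(1), of "-7" z] by (intro mult_mono) auto
          then have "15 * d ^ 4 * rp (-7) d z / m \<le> 15 * d * (1 / r ^ 7) / c0"
            by (intro frac_le) (use mc c0(1) d(1) r(1) in simp_all)
          then have "k z \<le> 15 * d * (1 / r ^ 7) / c0"
            using True by (simp add: k_def delta_part_def)
          then show ?thesis using True by (auto intro!: ennreal_leI)
        next
          case False
          then show ?thesis by (auto simp: k_def delta_part_def indicator_def)
        qed
      qed
      also have "\<dots> = ennreal (15 * d / r ^ 7 / c0) * ennreal V"
        using V(2)[of 1] by (simp add: nn_integral_cmult_indicator)
      also have "\<dots> = ennreal (15 * d / r ^ 7 / c0 * V)"
        using V(1) d(1) r(1) c0(1) by (intro ennreal_mult[symmetric]) auto
      also have "\<dots> \<le> ennreal r"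
      proof (rule ennreal_leI)
        have "d * (15 * V) \<le> r ^ 8 * c0" using d(3) V by (simp add: pos_le_divide_eq)
        then have "d * (15 * V) / (r ^ 7 * c0) \<le> r ^ 8 * c0 / (r ^ 7 * c0)"
          using r(1) c0(1) by (intro divide_right_mono) auto
        moreover have "r ^ 8 * c0 / (r ^ 7 * c0) = r"
          using r(1) c0(1) power_Suc[of r 7] by simp
        ultimately show "15 * d / r ^ 7 / c0 * V \<le> r" by (simp add: mult_ac)
      qed
      finally show "(\<integral>\<^sup>+z. ennreal (k z) * indicator {x. r \<le> norm x} z \<partial>lborel) \<le> ennreal r" .
    qed
    \<comment> \<open>The subtraction is truncated at 0 in \<open>ennreal\<close>, so it measures
      exactly the excess over the bound, and points with infinite \<open>W x\<close> contribute
      nothing.\<close>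
    moreover have "ennreal \<bar>u x $ j\<bar> - ennreal C * W x \<le> ennreal \<bar>conv k (\<lambda>y. u y $ j) x - u x $ j\<bar>" for x
    proof -
      have "conv k (\<lambda>y. u y $ j) x = conv (delta_part d) (\<lambda>y. u y $ j) x / m"
        unfolding conv_def k_def by simp
      then have "\<bar>conv k (\<lambda>y. u y $ j) x\<bar> \<le> \<bar>conv (delta_part d) (\<lambda>y. u y $ j) x\<bar> / c0"
        using mc c0(1) m0 by (auto intro!: divide_left_mono)
      then have "ennreal \<bar>conv k (\<lambda>y. u y $ j) x\<bar> \<le> ennreal (1 / c0) * ennreal \<bar>conv (delta_part d) (\<lambda>y. u y $ j) x\<bar>"
        using c0(1) by (simp add: ennreal_mult'[symmetric] ennreal_leI)
      also have "\<dots> \<le> ennreal (1 / c0) * (ennreal (C1 + C2) * W x)"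
        by (intro mult_left_mono convZ d) auto
      also have "\<dots> = ennreal (1 / c0) * ennreal (C1 + C2) * W x" by (simp only: mult.assoc)
      also have "ennreal (1 / c0) * ennreal (C1 + C2) = ennreal C"
        unfolding C_def using c0(1) C1 C2 by (subst ennreal_mult[symmetric]) auto
      finally have a: "ennreal \<bar>conv k (\<lambda>y. u y $ j) x\<bar> \<le> ennreal C * W x" .
      have "ennreal \<bar>u x $ j\<bar> \<le> ennreal (\<bar>conv k (\<lambda>y. u y $ j) x\<bar> + \<bar>conv k (\<lambda>y. u y $ j) x - u x $ j\<bar>)"
        by (intro ennreal_leI) linarith
      also have "\<dots> = ennreal \<bar>conv k (\<lambda>y. u y $ j) x\<bar> + ennreal \<bar>conv k (\<lambda>y. u y $ j) x - u x $ j\<bar>"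
        by (simp add: ennreal_plus)
      also have "\<dots> \<le> ennreal C * W x + ennreal \<bar>conv k (\<lambda>y. u y $ j) x - u x $ j\<bar>"
        by (intro add_right_mono a)
      finally show ?thesis by (subst ennreal_minus_le_iff) auto
    qed
    then have "(\<integral>\<^sup>+x. (ennreal \<bar>u x $ j\<bar> - ennreal C * W x) * indicator (cball 0 R) x \<partial>lborel)
      \<le> (\<integral>\<^sup>+x. ennreal \<bar>conv k (\<lambda>y. u y $ j) x - u x $ j\<bar> * indicator (cball 0 R) x \<partial>lborel)"
      by (intro nn_integral_mono mult_right_mono) auto
    ultimately show ?thesis by (rule order_trans[rotated])
  qed
  have "AE x in lborel. ennreal \<bar>u x $ j\<bar> \<le> ennreal C * W x" for j
  proof -
    have "AE x in lborel. x \<in> cball 0 (real n) \<longrightarrow> ennreal \<bar>u x $ j\<bar> \<le> ennreal C * W x" for n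
    proof -
      have "(\<integral>\<^sup>+x. (ennreal \<bar>u x $ j\<bar> - ennreal C * W x) * indicator (cball 0 (real n)) x \<partial>lborel) \<le> 0"
        by (rule ennreal_le_epsilon) (use approx in auto)
      then have "(\<integral>\<^sup>+x. (ennreal \<bar>u x $ j\<bar> - ennreal C * W x) * indicator (cball 0 (real n)) x \<partial>lborel) = 0"
        by simp
      then have "AE x in lborel. (ennreal \<bar>u x $ j\<bar> - ennreal C * W x) * indicator (cball 0 (real n)) x = 0"
        by (subst (asm) nn_integral_0_iff_AE) measurable
      then show ?thesis
      proof eventually_elim
        fix x assume a: "(ennreal \<bar>u x $ j\<bar> - ennreal C * W x) * indicator (cball 0 (real n)) x = 0"
        show "x \<in> cball 0 (real n) \<longrightarrow> ennreal \<bar>u x $ j\<bar> \<le> ennreal C * W x"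
        proof
          assume "x \<in> cball 0 (real n)"
          with a have "ennreal \<bar>u x $ j\<bar> - ennreal C * W x = 0" by simp
          then have "ennreal \<bar>u x $ j\<bar> - ennreal C * W x \<le> 0" by simp
          then show "ennreal \<bar>u x $ j\<bar> \<le> ennreal C * W x" by (subst (asm) ennreal_minus_le_iff) auto
        qed
      qed
    qed
    then have "AE x in lborel. \<forall>n. x \<in> cball 0 (real n) \<longrightarrow> ennreal \<bar>u x $ j\<bar> \<le> ennreal C * W x"
      unfolding AE_all_countable by blast
    then show ?thesis
    proof eventually_elim
      fix x assume a: "\<forall>n. x \<in> cball 0 (real n) \<longrightarrow> ennreal \<bar>u x $ j\<bar> \<le> ennreal C * W x"
      obtain n where "norm x \<le> real n" using real_arch_simple by blast
      then show "ennreal \<bar>u x $ j\<bar> \<le> ennreal C * W x" using a by auto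
    qed
  qed
  then show ?thesis using that[of C] C by (simp add: W_def)
qed

theorem essentially_bounded:
  assumes q: "q > 3" and A: "A \<ge> 1"
    and fin: "(\<integral>\<^sup>+x. ennreal (if norm (u x) > A then norm (u x) powr q else 0) \<partial>lborel) < \<infinity>"
  obtains M where "AE x in lborel. norm (u x) \<le> M"
proof -
  obtain C where C: "C > 0"
    "\<And>j. AE x in lborel. ennreal \<bar>u x $ j\<bar> \<le> ennreal C * (\<integral>\<^sup>+y. indicator (cball 0 1) (x - y) *
        (ennreal (norm (u y)) + ennreal (norm (x - y) powr (-2) * (norm (u y))\<^sup>2)) \<partial>lborel)"
    using potential_inequality_component by blast
  define W where "W x = (\<integral>\<^sup>+y. indicator (cball 0 1) (x - y) *
        (ennreal (norm (u y)) + ennreal (norm (x - y) powr (-2) * (norm (u y))\<^sup>2)) \<partial>lborel)" for x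
  have "AE x in lborel. \<forall>j\<in>UNIV. ennreal \<bar>u x $ j\<bar> \<le> ennreal C * W x"
    by (rule AE_finite_allI) (use C(2) in \<open>auto simp: W_def\<close>)
  then have "AE x in lborel. ennreal (norm (u x)) \<le> ennreal (3 * C) * W x"
  proof eventually_elim
    fix x assume a: "\<forall>j\<in>UNIV. ennreal \<bar>u x $ j\<bar> \<le> ennreal C * W x"
    have "ennreal (norm (u x)) \<le> ennreal (\<Sum>j\<in>UNIV. \<bar>u x $ j\<bar>)"
      by (intro ennreal_leI norm_le_l1_cart)
    also have "\<dots> = (\<Sum>j\<in>UNIV. ennreal \<bar>u x $ j\<bar>)" by (simp add: sum_ennreal)
    also have "\<dots> \<le> (\<Sum>j\<in>(UNIV::3 set). ennreal C * W x)" using a by (intro sum_mono) auto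
    also have "\<dots> = ennreal (3 * C) * W x"
      using C(1) by (simp add: ennreal_mult' mult.assoc)
    finally show "ennreal (norm (u x)) \<le> ennreal (3 * C) * W x" .
  qed
  then show ?thesis
    using bounded_of_potential_inequality[of "\<lambda>x. norm (u x)" "3 * C" q A] C(1) q A fin that
    unfolding W_def by auto
qed

end

subsection \<open>Mollifiers\<close>

text \<open>Here \<open>d\<close> only bounds the support and is not a scaling parameter, so the
  property is monotone in \<open>d\<close> and a single mollifier can meet finitely many smallness
  requirements.\<close>

definition mollifier :: "real \<Rightarrow> (real^3 \<Rightarrow> real) \<Rightarrow> bool" where
  "mollifier d \<eta> \<longleftrightarrow> test_fun \<eta> \<and> (\<forall>x. 0 \<le> \<eta> x) \<and> (\<forall>x. norm x \<ge> d \<longrightarrow> \<eta> x = 0) \<and> (\<integral>x. \<eta> x \<partial>lborel) = 1"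

lemma mollifierD:
  assumes "mollifier d \<eta>"
  shows "test_fun \<eta>" "\<And>x. 0 \<le> \<eta> x" "\<And>x. norm x \<ge> d \<Longrightarrow> \<eta> x = 0" "(\<integral>x. \<eta> x \<partial>lborel) = 1"
  using assms by (auto simp: mollifier_def)

lemma mollifier_mono: "mollifier d \<eta> \<Longrightarrow> d \<le> d' \<Longrightarrow> mollifier d' \<eta>"
  by (auto simp: mollifier_def)

lemma mollifier_exists:
  assumes d: "d > 0" obtains \<eta> where "mollifier d \<eta>"
proof -
  define f where "f x = cutoff ((1 / d) *\<^sub>R x)" for x
  have f: "test_fun f"
    unfolding f_def using test_fun_affine[OF test_fun_cutoff, of "1 / d" 0] d by simp
  define N where "N = (\<integral>x. f x \<partial>lborel)"
  have "(\<integral>x. indicator (cball (0::real^3) (d / 2)) x \<partial>lborel :: real) \<le> N"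
    unfolding N_def
  proof (intro integral_mono integrable_indicator_cball test_fun_integrable f)
    fix x :: "real^3"
    show "indicator (cball 0 (d / 2)) x \<le> f x"
      using d cutoff_nonneg[of "(1 / d) *\<^sub>R x"] cutoff_eq_1[of "(1 / d) *\<^sub>R x"]
      by (auto simp: f_def indicator_def field_simps)
  qed
  moreover obtain v where v: "v > 0" "\<And>r. r \<ge> 0 \<Longrightarrow> emeasure lborel (cball (0::real^3) r) = ennreal (v * r ^ 3)"
    using emeasure_ball3 by metis
  have "measure lborel (cball (0::real^3) (d / 2)) = v * (d / 2) ^ 3"
    using v(2)[of "d / 2"] v(1) d by (simp add: measure_def)
  moreover have "v * (d / 2) ^ 3 > 0" using v d by simp
  ultimately have N: "N > 0" by simp
  have "mollifier d (\<lambda>x. (1 / N) * f x)"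
    unfolding mollifier_def
  proof (intro conjI allI impI)
    show "test_fun (\<lambda>x. (1 / N) * f x)" by (intro test_fun_cmult f)
    show "0 \<le> (1 / N) * f x" for x using N cutoff_nonneg by (simp add: f_def)
    show "(1 / N) * f x = 0" if "norm x \<ge> d" for x
      using that d cutoff_eq_0[of "(1 / d) *\<^sub>R x"] by (simp add: f_def)
    show "(\<integral>x. (1 / N) * f x \<partial>lborel) = 1" using N by (simp add: N_def[symmetric])
  qed
  then show ?thesis by (rule that)
qed

lemma mollifier_integral_reflect:
  assumes "mollifier d \<eta>" shows "(\<integral>y. \<eta> (x - y) \<partial>lborel) = 1"
  using integral_reflect[of \<eta> x] mollifierD[OF assms] smooth3_borel test_fun_smooth by simp

lemma mollifier_nn_integral:
  assumes "mollifier d \<eta>" shows "(\<integral>\<^sup>+x. ennreal (\<eta> x) \<partial>lborel) = 1"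
  using mollifierD[OF assms] by (subst nn_integral_eq_integral) (auto intro: test_fun_integrable)

lemma mollifier_approximates:
  assumes f: "locint f" and e: "e > 0"
  obtains d where "d > 0"
    "\<And>\<eta>. mollifier d \<eta> \<Longrightarrow> (\<integral>\<^sup>+x. ennreal \<bar>conv \<eta> f x - f x\<bar> * indicator (cball 0 R) x \<partial>lborel) \<le> ennreal e"
proof -
  obtain d where d: "d > 0"
    "\<And>k C. k \<in> borel_measurable borel \<Longrightarrow> (\<And>x. 0 \<le> k x) \<Longrightarrow> (\<And>x. k x \<le> C) \<Longrightarrow>
      (\<And>x. norm x > 1 \<Longrightarrow> k x = 0) \<Longrightarrow>
      (\<integral>\<^sup>+x. ennreal (k x) \<partial>lborel) = 1 \<Longrightarrow>
      (\<integral>\<^sup>+x. ennreal (k x) * indicator {x. d \<le> norm x} x \<partial>lborel) \<le> ennreal d \<Longrightarrow>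
      (\<integral>\<^sup>+x. ennreal \<bar>conv k f x - f x\<bar> * indicator (cball 0 R) x \<partial>lborel) \<le> ennreal e"
    using approximate_identity_local[OF f e, of R] by blast
  show ?thesis
  proof (rule that[of "min d 1"])
    fix \<eta> assume m: "mollifier (min d 1) \<eta>"
    note \<eta> = mollifierD[OF m]
    obtain C where C: "C > 0" "\<And>x. \<bar>\<eta> x\<bar> \<le> C" using test_fun_bounded[OF \<eta>(1)] by metis
    show "(\<integral>\<^sup>+x. ennreal \<bar>conv \<eta> f x - f x\<bar> * indicator (cball 0 R) x \<partial>lborel) \<le> ennreal e"
    proof (rule d(2))
      show "\<eta> \<in> borel_measurable borel" using \<eta>(1) smooth3_borel test_fun_smooth by auto
      show "\<eta> x \<le> C" for x using C(2)[of x] by simp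
      have "(\<integral>\<^sup>+x. ennreal (\<eta> x) * indicator {x. d \<le> norm x} x \<partial>lborel) = nn_integral lborel (\<lambda>x::real^3. 0)"
        by (intro nn_integral_cong) (auto simp: indicator_def \<eta>(3))
      then show "(\<integral>\<^sup>+x. ennreal (\<eta> x) * indicator {x. d \<le> norm x} x \<partial>lborel) \<le> ennreal d" by simp
    qed (use \<eta> mollifier_nn_integral[OF m] in auto)
  qed (use d in auto)
qed

lemma conv_add:
  assumes "test_fun k" "locint f" "locint g"
  shows "conv k (\<lambda>y. f y + g y) x = conv k f x + conv k g x"
  unfolding conv_def using conv_integrable[OF assms(1,2)] conv_integrable[OF assms(1,3)]
  by (simp add: distrib_left)

lemma conv_cmult: "conv k (\<lambda>y. c * f y) x = c * conv k f x"
  unfolding conv_def by (simp add: mult.left_commute)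

lemma locint_const: "locint (\<lambda>x. c)"
  by (rule locint_bounded[of _ "\<bar>c\<bar>"]) auto

lemma locint_add: "locint f \<Longrightarrow> locint g \<Longrightarrow> locint (\<lambda>x. f x + g x)"
  by (auto simp: locint_def distrib_left)

lemma locint_cmult: "locint f \<Longrightarrow> locint (\<lambda>x. c * f x)"
  by (auto simp: locint_def mult.left_commute)

lemma locint_dominated:
  assumes "locint g" "f \<in> borel_measurable borel" "\<And>x. \<bar>f x\<bar> \<le> g x"
  shows "locint f"
  unfolding locint_def
proof (intro conjI allI assms)
  fix R
  have "integrable lborel (\<lambda>x. indicator (cball 0 R) x * g x)" using assms(1) by (simp add: locint_def)
  then show "integrable lborel (\<lambda>x. indicator (cball 0 R) x * f x)"
  proof (rule Bochner_Integration.integrable_bound)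
    show "AE x in lborel. norm (indicator (cball 0 R) x * f x) \<le> norm (indicator (cball 0 R) x * g x)"
      using assms(3) by (auto simp: indicator_def intro: order_trans[OF _ abs_ge_self])
    show "(\<lambda>x. indicator (cball 0 R) x * f x) \<in> borel_measurable lborel"
      using assms(2) by (intro borel_measurable_times borel_measurable_indicator) auto
  qed
qed

lemma conv_const:
  assumes "mollifier d \<eta>" shows "conv \<eta> (\<lambda>y. c) x = c"
  using mollifier_integral_reflect[OF assms, of x] by (simp add: conv_def)

lemma conv_mono_AE:
  assumes "mollifier d \<eta>" "locint f" "locint g" "AE x in lborel. f x \<le> g x"
  shows "conv \<eta> f x \<le> conv \<eta> g x"
  unfolding conv_def
proof (rule integral_mono_AE)
  show "AE y in lborel. \<eta> (x - y) * f y \<le> \<eta> (x - y) * g y"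
    using assms(4) by eventually_elim (intro mult_left_mono mollifierD[OF assms(1)])
qed (intro conv_integrable mollifierD[OF assms(1)] assms)+

lemma conv_abs_le:
  assumes "mollifier d \<eta>" "locint f" "locint g" "AE x in lborel. \<bar>f x\<bar> \<le> g x"
  shows "\<bar>conv \<eta> f x\<bar> \<le> conv \<eta> g x"
proof -
  have "conv \<eta> f x \<le> conv \<eta> g x" using assms(4) by (intro conv_mono_AE[OF assms(1-3)]) auto
  moreover have "conv \<eta> (\<lambda>y. (-1) * f y) x \<le> conv \<eta> g x"
    using assms(4) by (intro conv_mono_AE[OF assms(1) locint_cmult[OF assms(2)] assms(3)]) auto
  ultimately show ?thesis unfolding conv_cmult by simp
qed

lemma lap_conv:
  assumes "test_fun k" "locint f" shows "lap (conv k f) = conv (lap k) f"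
proof
  fix x
  have "lap (conv k f) x = (\<Sum>i\<in>UNIV. conv (partial i (partial i k)) f x)"
    by (simp add: lap_def partial_conv test_fun_partial assms)
  also have "\<dots> = conv (lap k) f x"
    unfolding conv_def lap_def
    by (subst Bochner_Integration.integral_sum[symmetric])
      (auto intro!: conv_integrable test_fun_partial assms simp: sum_distrib_right)
  finally show "lap (conv k f) x = conv (lap k) f x" .
qed

subsection \<open>The local energy inequality\<close>

context stationary_NS
begin

definition umol :: "(real^3 \<Rightarrow> real) \<Rightarrow> 3 \<Rightarrow> real^3 \<Rightarrow> real" where
  "umol \<eta> j = conv \<eta> (\<lambda>x. u x $ j)"

definition tmol :: "(real^3 \<Rightarrow> real) \<Rightarrow> 3 \<Rightarrow> 3 \<Rightarrow> real^3 \<Rightarrow> real" where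
  "tmol \<eta> i j = conv \<eta> (\<lambda>x. u x $ i * u x $ j)"

lemma smooth3_umol: "test_fun \<eta> \<Longrightarrow> smooth3 (umol \<eta> j)"
  unfolding umol_def by (intro smooth3_conv u_locint)

lemma smooth3_tmol: "test_fun \<eta> \<Longrightarrow> smooth3 (tmol \<eta> i j)"
  unfolding tmol_def by (intro smooth3_conv uu_locint)

text \<open>The equation is tested with \<open>y \<mapsto> \<eta> (x - y)\<close> placed in
  component \<open>j\<close>. Reflection changes the sign of first derivatives and preserves the
  Laplacian, which explains the signs.\<close>

lemma mollified_momentum:
  assumes \<eta>: "test_fun \<eta>"
  shows "lap (umol \<eta> j) x = (\<Sum>i\<in>UNIV. partial i (tmol \<eta> i j) x) + partial j (conv \<eta> \<pi>) x"
proof -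
  have s: "smooth3 \<eta>" using \<eta> by (rule test_fun_smooth)
  define \<phi> where "\<phi> k = (if k = j then (\<lambda>y. \<eta> (x - y)) else (\<lambda>y. 0))" for k
  have t: "test_fun (\<phi> k)" for k unfolding \<phi>_def using test_fun_reflect[OF \<eta>] test_fun_0 by simp
  have l: "lap (\<phi> k) y = (if k = j then lap \<eta> (x - y) else 0)" for k y
    by (simp add: \<phi>_def lap_reflect s lap_0)
  have p: "partial i (\<phi> k) y = (if k = j then - partial i \<eta> (x - y) else 0)" for i k y
    by (simp add: \<phi>_def partial_reflect s)
  have i1: "integrable lborel (\<lambda>y. lap \<eta> (x - y) * u y $ j)"
    by (intro conv_integrable test_fun_lap \<eta> u_locint)
  have i2: "integrable lborel (\<lambda>y. partial i \<eta> (x - y) * (u y $ i * u y $ j))" for i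
    by (intro conv_integrable test_fun_partial \<eta> uu_locint)
  have i3: "integrable lborel (\<lambda>y. partial j \<eta> (x - y) * \<pi> y)"
    by (intro conv_integrable test_fun_partial \<eta> pressure_locint)
  have sum1: "(\<Sum>k\<in>UNIV. a k * (if k = j then b else 0)) = a j * b" for a :: "3 \<Rightarrow> real" and b
    by (simp add: if_distrib[of "\<lambda>z. _ * z"] cong: if_cong)
  have sum2: "(\<Sum>k\<in>UNIV. if k = j then b k else 0) = b j" for b :: "3 \<Rightarrow> real" by simp
  have "0 = (\<integral>y. (\<Sum>k\<in>UNIV. u y $ k * lap (\<phi> k) y)
         + (\<Sum>i\<in>UNIV. \<Sum>k\<in>UNIV. u y $ i * u y $ k * partial i (\<phi> k) y)
         + \<pi> y * (\<Sum>k\<in>UNIV. partial k (\<phi> k) y) \<partial>lborel)"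
    using momentum[of \<phi>] t by simp
  also have "\<dots> = (\<integral>y. lap \<eta> (x - y) * u y $ j - (\<Sum>i\<in>UNIV. partial i \<eta> (x - y) * (u y $ i * u y $ j))
         - partial j \<eta> (x - y) * \<pi> y \<partial>lborel)"
    unfolding l p sum1 sum2 by (intro Bochner_Integration.integral_cong) (simp_all add: sum_negf mult_ac)
  also have "\<dots> = conv (lap \<eta>) (\<lambda>y. u y $ j) x - (\<Sum>i\<in>UNIV. conv (partial i \<eta>) (\<lambda>y. u y $ i * u y $ j) x)
       - conv (partial j \<eta>) \<pi> x"
    unfolding conv_def using i1 i2 i3 by simp
  finally show ?thesis
    by (simp add: umol_def tmol_def lap_conv partial_conv \<eta> u_locint uu_locint pressure_locint)
qed

lemma mollified_divergence:
  assumes \<eta>: "test_fun \<eta>"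
  shows "(\<Sum>i\<in>UNIV. partial i (umol \<eta> i) x) = 0"
proof -
  have "(\<Sum>i\<in>UNIV. partial i (umol \<eta> i) x) = (\<Sum>i\<in>UNIV. \<integral>y. partial i \<eta> (x - y) * u y $ i \<partial>lborel)"
    by (simp add: umol_def partial_conv \<eta> u_locint conv_def)
  also have "\<dots> = (\<integral>y. (\<Sum>i\<in>UNIV. partial i \<eta> (x - y) * u y $ i) \<partial>lborel)"
    by (intro Bochner_Integration.integral_sum[symmetric] conv_integrable test_fun_partial \<eta> u_locint)
  also have "\<dots> = (\<integral>y. - (\<Sum>i\<in>UNIV. u y $ i * partial i (\<lambda>y. \<eta> (x - y)) y) \<partial>lborel)"
    by (simp add: partial_reflect test_fun_smooth[OF \<eta>] sum_negf mult.commute)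
  also have "\<dots> = 0"
    using divergence_free[OF test_fun_reflect[OF \<eta>, of x]] by simp
  finally show ?thesis .
qed

text \<open>The integrand is a total divergence once the mollified equation and incompressibility
  are inserted. The convective term is split into the commutator \<open>T - U U\<close>, which keeps
  a gradient factor, and the exact product, which reduces to |U|^2 U times the gradient of \<phi>.
  All other terms except the dissipation carry derivatives of \<phi>.\<close>

lemma energy_identity:
  assumes \<eta>: "test_fun \<eta>" and \<phi>: "test_fun \<phi>"
  defines "U \<equiv> umol \<eta>" and "T \<equiv> tmol \<eta>" and "P \<equiv> conv \<eta> \<pi>"
  shows "(\<integral>x. (\<Sum>i\<in>UNIV. \<Sum>j\<in>UNIV. \<phi> x * (partial i (U j) x)\<^sup>2 - (U j x)\<^sup>2 * partial i (partial i \<phi>) x / 2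
      - partial i \<phi> x * T i j x * U j x + (U j x)\<^sup>2 * U i x * partial i \<phi> x / 2
      - \<phi> x * (T i j x - U i x * U j x) * partial i (U j) x)
      - P x * (\<Sum>i\<in>UNIV. partial i \<phi> x * U i x) \<partial>lborel) = 0"
proof -
  have sU: "smooth3 (U j)" and sT: "smooth3 (T i j)" and sP: "smooth3 P" for i j
    unfolding U_def T_def P_def by (intro smooth3_umol smooth3_tmol smooth3_conv \<eta> pressure_locint)+
  have sphi: "smooth3 \<phi>" using \<phi> by (rule test_fun_smooth)
  \<comment> \<open>The energy fluxes: diffusion, its correction by \<nabla>\<phi>, which cancels
    the cross term, the mollified stress, and the transport of kinetic energy. \<open>Q\<close> is
    the pressure flux.\<close>
  define W where "W i j = (\<lambda>x. \<phi> x * (U j x * partial i (U j) x) - partial i \<phi> x * ((1/2) * (U j x * U j x))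
      - \<phi> x * (T i j x * U j x) + \<phi> x * ((1/2) * ((U j x * U j x) * U i x)))" for i j
  define Q where "Q i = (\<lambda>x. \<phi> x * (P x * U i x))" for i
  have tW: "test_fun (W i j)" for i j
    unfolding W_def
    by (intro test_fun_add test_fun_diff test_fun_mult_left test_fun_partial \<phi> smooth3_intros sU sT)
  have tQ: "test_fun (Q i)" for i
    unfolding Q_def by (intro test_fun_mult_left \<phi> smooth3_intros sU sP)
  have pW: "partial i (W i j) x = (\<phi> x * (partial i (U j) x)\<^sup>2 - (U j x)\<^sup>2 * partial i (partial i \<phi>) x / 2
      - partial i \<phi> x * T i j x * U j x + (U j x)\<^sup>2 * U i x * partial i \<phi> x / 2
      - \<phi> x * (T i j x - U i x * U j x) * partial i (U j) x)
      + \<phi> x * U j x * (partial i (partial i (U j)) x - partial i (T i j) x)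
      + \<phi> x * (U j x)\<^sup>2 / 2 * partial i (U i) x" for i j x
    unfolding W_def
    by (simp only: partial_smooth_add partial_smooth_diff partial_smooth_mult smooth3_add smooth3_diff smooth3_mult
        partial_const smooth3_const smooth3_partial sU sT sphi)
      (simp add: power2_eq_square field_simps)
  have pQ: "partial i (Q i) x = P x * (partial i \<phi> x * U i x) + \<phi> x * U i x * partial i P x + \<phi> x * P x * partial i (U i) x" for i x
    unfolding Q_def
    by (simp only: partial_smooth_mult smooth3_mult sU sP sphi) (simp add: algebra_simps)
  define E where "E i j x = \<phi> x * (partial i (U j) x)\<^sup>2 - (U j x)\<^sup>2 * partial i (partial i \<phi>) x / 2
      - partial i \<phi> x * T i j x * U j x + (U j x)\<^sup>2 * U i x * partial i \<phi> x / 2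
      - \<phi> x * (T i j x - U i x * U j x) * partial i (U j) x" for i j x
  have mom: "(\<Sum>i\<in>UNIV. partial i (partial i (U j)) x - partial i (T i j) x) = partial j P x" for j x
    using mollified_momentum[OF \<eta>, of j x] by (simp add: U_def T_def P_def lap_def sum_subtractf)
  have dv: "(\<Sum>i\<in>UNIV. partial i (U i) x) = 0" for x
    unfolding U_def by (rule mollified_divergence[OF \<eta>])
  have tot: "(\<Sum>i\<in>UNIV. (\<Sum>j\<in>UNIV. partial i (W i j) x)) - (\<Sum>i\<in>UNIV. partial i (Q i) x)
     = (\<Sum>i\<in>UNIV. \<Sum>j\<in>UNIV. E i j x) - P x * (\<Sum>i\<in>UNIV. partial i \<phi> x * U i x)" for x
  proof -
    have "(\<Sum>i\<in>UNIV. (\<Sum>j\<in>UNIV. partial i (W i j) x))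
       = (\<Sum>i\<in>UNIV. \<Sum>j\<in>UNIV. E i j x)
        + (\<Sum>j\<in>UNIV. \<Sum>i\<in>UNIV. \<phi> x * U j x * (partial i (partial i (U j)) x - partial i (T i j) x))
        + (\<Sum>j\<in>UNIV. \<Sum>i\<in>UNIV. \<phi> x * (U j x)\<^sup>2 / 2 * partial i (U i) x)"
      unfolding pW E_def[symmetric] sum.distrib
      by (subst (2 3) sum.swap) simp
    also have "\<dots> = (\<Sum>i\<in>UNIV. \<Sum>j\<in>UNIV. E i j x) + (\<Sum>j\<in>UNIV. \<phi> x * U j x * partial j P x)"
      unfolding sum_distrib_left[symmetric] mom dv by simp
    finally have a: "(\<Sum>i\<in>UNIV. (\<Sum>j\<in>UNIV. partial i (W i j) x))
       = (\<Sum>i\<in>UNIV. \<Sum>j\<in>UNIV. E i j x) + (\<Sum>j\<in>UNIV. \<phi> x * U j x * partial j P x)" .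
    have "(\<Sum>i\<in>UNIV. partial i (Q i) x) = P x * (\<Sum>i\<in>UNIV. partial i \<phi> x * U i x) + (\<Sum>j\<in>UNIV. \<phi> x * U j x * partial j P x)"
      unfolding pQ sum.distrib sum_distrib_left[symmetric] dv by simp
    with a show ?thesis by simp
  qed
  have iW: "integrable lborel (partial i (W i j))" and iQ: "integrable lborel (partial i (Q i))" for i j
    by (intro test_fun_integrable test_fun_partial tW tQ)+
  have "(\<integral>x. (\<Sum>i\<in>UNIV. (\<Sum>j\<in>UNIV. partial i (W i j) x)) - (\<Sum>i\<in>UNIV. partial i (Q i) x) \<partial>lborel) = 0"
    using iW iQ by (simp add: integral_partial_eq_0 tW tQ)
  then show ?thesis unfolding tot E_def .
qed

end

abbreviation annulus :: "real \<Rightarrow> real \<Rightarrow> (real^3) set" where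
  "annulus a b \<equiv> {x. a \<le> norm x \<and> norm x \<le> b}"

text \<open>The fixed cutoff is dilated by 1/(2R), since it equals 1 up to radius 1/2 and 0 from
  radius 1. Each derivative gains a factor 1/R and lives where \<phi> is not locally constant;
  \<open>K\<close> does not depend on \<open>R\<close>.\<close>

lemma scaled_cutoff:
  obtains K where "K > 0"
    "\<And>R. R > 0 \<Longrightarrow> \<exists>\<phi>. test_fun \<phi> \<and> (\<forall>x. 0 \<le> \<phi> x \<and> \<phi> x \<le> 1) \<and> (\<forall>x. norm x \<le> R \<longrightarrow> \<phi> x = 1)
      \<and> (\<forall>x. norm x \<ge> 2 * R \<longrightarrow> \<phi> x = 0)
      \<and> (\<forall>i x. \<bar>partial i \<phi> x\<bar> \<le> K / R * indicator (annulus R (2 * R)) x)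
      \<and> (\<forall>i x. \<bar>partial i (partial i \<phi>) x\<bar> \<le> K / R\<^sup>2 * indicator (annulus R (2 * R)) x)"
proof -
  have "\<forall>i. \<exists>C>0. \<forall>x. \<bar>partial i cutoff x\<bar> \<le> C"
    using test_fun_bounded[OF test_fun_partial[OF test_fun_cutoff]] by metis
  then obtain C1 where C1: "\<And>i. C1 i > 0" "\<And>i x. \<bar>partial i cutoff x\<bar> \<le> C1 i" by metis
  have "\<forall>i. \<exists>C>0. \<forall>x. \<bar>partial i (partial i cutoff) x\<bar> \<le> C"
    using test_fun_bounded[OF test_fun_partial[OF test_fun_partial[OF test_fun_cutoff]]] by metis
  then obtain C2 where C2: "\<And>i. C2 i > 0" "\<And>i x. \<bar>partial i (partial i cutoff) x\<bar> \<le> C2 i" by metis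
  define K where "K = (\<Sum>i\<in>UNIV. C1 i + C2 i)"
  have K1: "C1 i \<le> K" and K2: "C2 i \<le> K" for i
  proof -
    have "C1 i + C2 i \<le> K" unfolding K_def
      by (rule member_le_sum) (auto intro: add_nonneg_nonneg less_imp_le[OF C1(1)] less_imp_le[OF C2(1)])
    then show "C1 i \<le> K" "C2 i \<le> K" using C1(1)[of i] C2(1)[of i] by linarith+
  qed
  have K: "K > 0" using K1[of 1] C1(1)[of 1] by linarith
  show ?thesis
  proof (rule that[OF K])
    fix R :: real assume R: "R > 0"
    define t where "t = 1 / (2 * R)"
    have t: "t > 0" using R by (simp add: t_def)
    define \<phi> where "\<phi> x = cutoff (t *\<^sub>R x + 0)" for x
    have s: "smooth3 cutoff" by (rule smooth3_cutoff)
    have tf: "test_fun \<phi>" unfolding \<phi>_def using test_fun_affine[OF test_fun_cutoff, of t 0] t by simp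
    have one: "\<phi> x = 1" if "norm x \<le> R" for x
      unfolding \<phi>_def using that R by (intro cutoff_eq_1) (simp add: t_def divide_simps)
    have zero: "\<phi> x = 0" if "norm x \<ge> 2 * R" for x
      unfolding \<phi>_def using that R by (intro cutoff_eq_0) (simp add: t_def divide_simps)
    have p1: "partial i \<phi> = (\<lambda>x. t * partial i cutoff (t *\<^sub>R x + 0))" for i
      unfolding \<phi>_def[abs_def] by (rule ext, rule partial_affine[OF smooth3_differentiable[OF s]])
    have p2: "partial i (partial i \<phi>) = (\<lambda>x. t * (t * partial i (partial i cutoff) (t *\<^sub>R x + 0)))" for i
      unfolding p1 partial_smooth_cmult[OF smooth3_affine[OF smooth3_partial[OF s]]]
      by (rule ext) (simp only: partial_affine[OF smooth3_differentiable[OF smooth3_partial[OF s]]])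
    have in1: "partial i \<phi> x = 0" if "norm x < R" for i x
    proof -
      have "partial i \<phi> x = partial i (\<lambda>x. 1) x"
        by (rule partial_cong_open[of "ball 0 R"])
          (use that one smooth3_differentiable[OF test_fun_smooth[OF tf]] in auto)
      then show ?thesis by simp
    qed
    have in2: "partial i (partial i \<phi>) x = 0" if "norm x < R" for i x
    proof -
      have "partial i (partial i \<phi>) x = partial i (\<lambda>x. 0) x"
        by (rule partial_cong_open[of "ball 0 R"])
          (use that in1 smooth3_differentiable[OF smooth3_partial[OF test_fun_smooth[OF tf]]] in auto)
      then show ?thesis by simp
    qed
    have out1: "partial i \<phi> x = 0" if "norm x > 2 * R" for i x
      by (rule partial_eq_0_outside[OF test_fun_smooth[OF tf] zero that]) simp
    have out2: "partial i (partial i \<phi>) x = 0" if "norm x > 2 * R" for i x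
      by (rule partial_eq_0_outside[OF smooth3_partial[OF test_fun_smooth[OF tf]] out1 that])
    have b1: "\<bar>partial i \<phi> x\<bar> \<le> K / R" for i x
    proof -
      have "\<bar>partial i \<phi> x\<bar> \<le> t * K"
        unfolding p1 abs_mult using t C1(2) K1 by (intro mult_mono) (auto intro: order_trans)
      also have "\<dots> \<le> K / R" using R K by (simp add: t_def divide_simps)
      finally show ?thesis .
    qed
    have b2: "\<bar>partial i (partial i \<phi>) x\<bar> \<le> K / R\<^sup>2" for i x
    proof -
      have "\<bar>partial i (partial i \<phi>) x\<bar> \<le> t * (t * K)"
        unfolding p2 abs_mult using t C2(2) K2 by (intro mult_mono) (auto intro: order_trans)
      also have "\<dots> \<le> K / R\<^sup>2" using R K by (simp add: t_def divide_simps power2_eq_square)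
      finally show ?thesis .
    qed
    have b1': "\<bar>partial i \<phi> x\<bar> \<le> K / R * indicator (annulus R (2 * R)) x" for i x
      using b1[of i x] in1[of x i] out1[of x i] by (auto simp: indicator_def not_le)
    have b2': "\<bar>partial i (partial i \<phi>) x\<bar> \<le> K / R\<^sup>2 * indicator (annulus R (2 * R)) x" for i x
      using b2[of i x] in2[of x i] out2[of x i] by (auto simp: indicator_def not_le)
    show "\<exists>\<phi>. test_fun \<phi> \<and> (\<forall>x. 0 \<le> \<phi> x \<and> \<phi> x \<le> 1) \<and> (\<forall>x. norm x \<le> R \<longrightarrow> \<phi> x = 1)
      \<and> (\<forall>x. norm x \<ge> 2 * R \<longrightarrow> \<phi> x = 0)
      \<and> (\<forall>i x. \<bar>partial i \<phi> x\<bar> \<le> K / R * indicator (annulus R (2 * R)) x)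
      \<and> (\<forall>i x. \<bar>partial i (partial i \<phi>) x\<bar> \<le> K / R\<^sup>2 * indicator (annulus R (2 * R)) x)"
      using tf one zero b1' b2' cutoff_nonneg cutoff_le_1 by (intro exI[of _ \<phi>]) (auto simp: \<phi>_def)
  qed
qed

section \<open>Elementary inequalities of Young type\<close>

text \<open>The cube lies above its tangent line at \<open>a\<close>. Kept with a free parameter
  \<open>a\<close>, this linear bound passes through averages and yields Jensen's inequality for
  mollification.\<close>

lemma young_cubic:
  fixes x a :: real
  assumes "x \<ge> 0" "a \<ge> 0" shows "3 * a\<^sup>2 * x \<le> x ^ 3 + 2 * a ^ 3"
proof -
  have "0 \<le> (x - a)\<^sup>2 * (x + 2 * a)" using assms by simp
  also have "\<dots> = x ^ 3 + 2 * a ^ 3 - 3 * a\<^sup>2 * x" by (simp add: power2_eq_square power3_eq_cube algebra_simps)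
  finally show ?thesis by simp
qed

lemma square_mult_le_cubes:
  fixes x a :: real
  assumes "x \<ge> 0" "a \<ge> 0" shows "x\<^sup>2 * a \<le> x ^ 3 + a ^ 3"
proof (cases "a \<le> x")
  case True
  then have "x\<^sup>2 * a \<le> x\<^sup>2 * x" using assms by (intro mult_left_mono) auto
  then show ?thesis using assms by (simp add: power2_eq_square power3_eq_cube add_increasing2)
next
  case False
  then have "x\<^sup>2 * a \<le> a\<^sup>2 * a" using assms by (intro mult_right_mono power_mono) auto
  then show ?thesis using assms by (simp add: power2_eq_square power3_eq_cube add_increasing)
qed

lemma mult_le_powr_cube:
  fixes x a :: real
  assumes "x \<ge> 0" "a \<ge> 0" shows "x * a \<le> x powr (3/2) + a ^ 3"
proof (cases "a \<le> x powr (1/2)")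
  case True
  then have "x * a \<le> x powr 1 * x powr (1/2)" using assms by (intro mult_mono) auto
  also have "\<dots> = x powr (3/2)" unfolding powr_add[symmetric] by simp
  finally show ?thesis using assms by (simp add: add_increasing2)
next
  case False
  then have "(x powr (1/2))\<^sup>2 \<le> a\<^sup>2" by (intro power_mono) auto
  then have "x \<le> a\<^sup>2" using assms by (simp add: powr_half_sqrt)
  then have "x * a \<le> a\<^sup>2 * a" using assms by (intro mult_right_mono)
  then show ?thesis by (simp add: power2_eq_square power3_eq_cube add_increasing)
qed

text \<open>Used for the diffusion term with \<open>a\<close> the mollified speed: the remainder
  R^-4, integrated over a ball of radius of order \<open>R\<close>, contributes only O(1/R).\<close>

lemma square_le_cube_add:
  fixes a R :: real
  assumes "a \<ge> 0" "R > 0" shows "a\<^sup>2 / R\<^sup>2 \<le> a ^ 3 / R + 1 / R ^ 4"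
proof (cases "a \<le> 1 / R")
  case True
  then have "a\<^sup>2 / R\<^sup>2 \<le> (1 / R)\<^sup>2 / R\<^sup>2" using assms by (intro divide_right_mono power_mono) auto
  also have "\<dots> = 1 / R ^ 4" by (simp add: power_divide power_add[symmetric])
  finally show ?thesis using assms by (simp add: add_increasing)
next
  case False
  then have "a\<^sup>2 * (1 / R) \<le> a\<^sup>2 * a" using assms by (intro mult_left_mono) auto
  then have "a\<^sup>2 * (1 / R) / R \<le> a\<^sup>2 * a / R" using assms by (intro divide_right_mono) auto
  then show ?thesis using assms by (simp add: power2_eq_square power3_eq_cube add_increasing2)
qed

context stationary_NS
begin

text \<open>The density controlling every term of the energy flux. By Young with exponents 3/2 and 3
  it also dominates the product of pressure and velocity.\<close>

definition cubic :: "real^3 \<Rightarrow> real" where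
  "cubic x = norm (u x) ^ 3 + \<bar>\<pi> x\<bar> powr (3/2)"

lemma pressure_borel [measurable]: "\<pi> \<in> borel_measurable borel"
  using pressure_locint by (rule locint_borel)

lemma cubic_borel [measurable]: "cubic \<in> borel_measurable borel"
  unfolding cubic_def[abs_def] by measurable

lemma cubic_nonneg: "cubic x \<ge> 0"
  by (simp add: cubic_def)

context
  assumes cubic_locint: "locint cubic"
begin

lemma norm_u_locint: "locint (\<lambda>x. norm (u x))"
proof (rule locint_dominated[OF locint_add[OF locint_const[of 1] cubic_locint]])
  fix x
  have "3 * norm (u x) \<le> norm (u x) ^ 3 + 2" using young_cubic[of "norm (u x)" 1] by simp
  then have "norm (u x) \<le> norm (u x) ^ 3 + 1"
    using zero_le_power[OF norm_ge_zero[of "u x"], of 3] by linarith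
  also have "\<dots> \<le> 1 + cubic x" by (simp add: cubic_def)
  finally show "\<bar>norm (u x)\<bar> \<le> 1 + cubic x" by simp
qed measurable

lemma norm_u_sq_locint: "locint (\<lambda>x. (norm (u x))\<^sup>2)"
proof (rule locint_dominated[OF locint_add[OF locint_const[of 1] cubic_locint]])
  fix x
  have "(norm (u x))\<^sup>2 \<le> norm (u x) ^ 3 + 1" using square_mult_le_cubes[of "norm (u x)" 1] by simp
  also have "\<dots> \<le> 1 + cubic x" by (simp add: cubic_def)
  finally show "\<bar>(norm (u x))\<^sup>2\<bar> \<le> 1 + cubic x" by simp
qed measurable

lemma abs_pressure_locint: "locint (\<lambda>x. \<bar>\<pi> x\<bar>)"
proof (rule locint_dominated[OF locint_add[OF locint_const[of 1] cubic_locint]])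
  fix x
  have "\<bar>\<pi> x\<bar> \<le> \<bar>\<pi> x\<bar> powr (3/2) + 1" using mult_le_powr_cube[of "\<bar>\<pi> x\<bar>" 1] by simp
  also have "\<dots> \<le> 1 + cubic x" by (simp add: cubic_def)
  finally show "\<bar>\<bar>\<pi> x\<bar>\<bar> \<le> 1 + cubic x" by simp
qed measurable

context
  fixes \<eta> assumes \<eta>: "mollifier 1 \<eta>"
begin

abbreviation (input) "amol \<equiv> conv \<eta> (\<lambda>x. norm (u x))"

lemmas \<eta>_test = mollifierD(1)[OF \<eta>]

lemma amol_nonneg: "amol x \<ge> 0"
  using conv_mono_AE[OF \<eta> locint_const[of 0] norm_u_locint, of x] by (simp add: conv_const[OF \<eta>])

lemma umol_le: "\<bar>umol \<eta> j x\<bar> \<le> amol x"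
  unfolding umol_def by (intro conv_abs_le[OF \<eta> u_locint norm_u_locint] AE_I2 abs_component_le_norm)

text \<open>Jensen's inequality through the tangent line of the cube: the average \<open>a\<close>
  at the point \<open>x\<close> is frozen, the linear bound is mollified, and its value at the
  average is \<open>a^3\<close>.\<close>

lemma amol_cube: "amol x ^ 3 \<le> conv \<eta> cubic x"
proof -
  define a where "a = amol x"
  have a: "a \<ge> 0" unfolding a_def by (rule amol_nonneg)
  have "conv \<eta> (\<lambda>y. 3 * a\<^sup>2 * norm (u y)) x \<le> conv \<eta> (\<lambda>y. cubic y + 2 * a ^ 3) x"
  proof (intro conv_mono_AE[OF \<eta>] locint_cmult norm_u_locint locint_add cubic_locint locint_const AE_I2)
    fix y
    show "3 * a\<^sup>2 * norm (u y) \<le> cubic y + 2 * a ^ 3"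
      using young_cubic[of "norm (u y)" a] a powr_ge_zero[of "\<bar>\<pi> y\<bar>" "3/2"] norm_ge_zero[of "u y"]
      unfolding cubic_def by linarith
  qed
  then have "3 * a\<^sup>2 * a \<le> conv \<eta> cubic x + 2 * a ^ 3"
    by (simp add: conv_cmult conv_add[OF \<eta>_test cubic_locint locint_const] conv_const[OF \<eta>] a_def)
  then show ?thesis by (simp add: a_def power2_eq_square power3_eq_cube)
qed

text \<open>The factor \<open>a\<close>, constant once \<open>x\<close> is fixed, is moved inside
  the mollification, where the pointwise Young inequality applies; the leftover \<open>a^3\<close>
  is returned to \<open>cubic\<close> by Jensen.\<close>

lemma tmol_mult_le: "\<bar>tmol \<eta> i j x\<bar> * amol x \<le> 2 * conv \<eta> cubic x"
proof -
  define a where "a = amol x"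
  have a: "a \<ge> 0" unfolding a_def by (rule amol_nonneg)
  have "\<bar>tmol \<eta> i j x\<bar> \<le> conv \<eta> (\<lambda>x. (norm (u x))\<^sup>2) x"
    unfolding tmol_def power2_eq_square
    by (intro conv_abs_le[OF \<eta> uu_locint norm_u_sq_locint[unfolded power2_eq_square]] AE_I2)
      (simp add: abs_mult mult_mono abs_component_le_norm)
  then have "\<bar>tmol \<eta> i j x\<bar> * a \<le> a * conv \<eta> (\<lambda>x. (norm (u x))\<^sup>2) x"
    using a by (simp add: mult.commute mult_left_mono)
  also have "\<dots> = conv \<eta> (\<lambda>y. a * (norm (u y))\<^sup>2) x" by (simp add: conv_cmult)
  also have "\<dots> \<le> conv \<eta> (\<lambda>y. cubic y + a ^ 3) x"
  proof (intro conv_mono_AE[OF \<eta>] locint_cmult norm_u_sq_locint locint_add cubic_locint locint_const AE_I2)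
    fix y
    show "a * (norm (u y))\<^sup>2 \<le> cubic y + a ^ 3"
      using square_mult_le_cubes[of "norm (u y)" a] a powr_ge_zero[of "\<bar>\<pi> y\<bar>" "3/2"] norm_ge_zero[of "u y"]
      unfolding cubic_def mult.commute[of a] by linarith
  qed
  also have "\<dots> = conv \<eta> cubic x + a ^ 3"
    by (simp add: conv_add[OF \<eta>_test cubic_locint locint_const] conv_const[OF \<eta>])
  also have "\<dots> \<le> 2 * conv \<eta> cubic x" using amol_cube[of x] by (simp add: a_def)
  finally show ?thesis by (simp add: a_def)
qed

lemma pmol_mult_le: "\<bar>conv \<eta> \<pi> x\<bar> * amol x \<le> 2 * conv \<eta> cubic x"
proof -
  define a where "a = amol x"
  have a: "a \<ge> 0" unfolding a_def by (rule amol_nonneg)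
  have "\<bar>conv \<eta> \<pi> x\<bar> \<le> conv \<eta> (\<lambda>x. \<bar>\<pi> x\<bar>) x"
    by (intro conv_abs_le[OF \<eta> pressure_locint abs_pressure_locint] AE_I2) simp
  then have "\<bar>conv \<eta> \<pi> x\<bar> * a \<le> a * conv \<eta> (\<lambda>x. \<bar>\<pi> x\<bar>) x"
    using a by (simp add: mult.commute mult_left_mono)
  also have "\<dots> = conv \<eta> (\<lambda>y. a * \<bar>\<pi> y\<bar>) x" by (simp add: conv_cmult)
  also have "\<dots> \<le> conv \<eta> (\<lambda>y. cubic y + a ^ 3) x"
  proof (intro conv_mono_AE[OF \<eta>] locint_cmult abs_pressure_locint locint_add cubic_locint locint_const AE_I2)
    fix y
    show "a * \<bar>\<pi> y\<bar> \<le> cubic y + a ^ 3"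
      using mult_le_powr_cube[of "\<bar>\<pi> y\<bar>" a] a zero_le_power[of "norm (u y)" 3] abs_ge_zero[of "\<pi> y"] norm_ge_zero[of "u y"]
      unfolding cubic_def mult.commute[of a] by linarith
  qed
  also have "\<dots> = conv \<eta> cubic x + a ^ 3"
    by (simp add: conv_add[OF \<eta>_test cubic_locint locint_const] conv_const[OF \<eta>])
  also have "\<dots> \<le> 2 * conv \<eta> cubic x" using amol_cube[of x] by (simp add: a_def)
  finally show ?thesis by (simp add: a_def)
qed

lemma cmol_nonneg: "conv \<eta> cubic x \<ge> 0"
  using amol_cube[of x] amol_nonneg[of x] by (meson order_trans zero_le_power)

text \<open>The mollifier has mass one and reaches at most distance 1, and for R \<ge> 2 the unit
  neighbourhood of the annulus from R to 2R stays between R/2 and 3R. Fubini then removes the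
  mollifier.\<close>

lemma cmol_annulus:
  assumes R: "R \<ge> 2"
  shows "(\<integral>\<^sup>+x. ennreal (conv \<eta> cubic x) * indicator (annulus R (2 * R)) x \<partial>lborel)
    \<le> (\<integral>\<^sup>+x. ennreal (cubic x) * indicator (annulus (R / 2) (3 * R)) x \<partial>lborel)"
proof -
  have [measurable]: "\<eta> \<in> borel_measurable borel" using \<eta>_test smooth3_borel test_fun_smooth by auto
  have n0: "\<eta> x \<ge> 0" for x using mollifierD(2)[OF \<eta>] .
  have e: "ennreal (conv \<eta> cubic x) = (\<integral>\<^sup>+y. ennreal (\<eta> (x - y)) * ennreal (cubic y) \<partial>lborel)" for x
    unfolding conv_def using n0 cubic_nonneg
    by (subst nn_integral_eq_integral[symmetric]) (auto intro!: conv_integrable \<eta>_test cubic_locint simp: ennreal_mult')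
  have "(\<integral>\<^sup>+x. ennreal (conv \<eta> cubic x) * indicator (annulus R (2 * R)) x \<partial>lborel)
    = (\<integral>\<^sup>+x. \<integral>\<^sup>+y. ennreal (\<eta> (x - y)) * ennreal (cubic y) * indicator (annulus R (2 * R)) x \<partial>lborel \<partial>lborel)"
    unfolding e by (intro nn_integral_cong nn_integral_multc[symmetric]) measurable
  also have "\<dots> \<le> (\<integral>\<^sup>+x. \<integral>\<^sup>+y. ennreal (\<eta> (x - y)) * (ennreal (cubic y) * indicator (annulus (R / 2) (3 * R)) y) \<partial>lborel \<partial>lborel)"
  proof (intro nn_integral_mono)
    fix x y :: "real^3"
    show "ennreal (\<eta> (x - y)) * ennreal (cubic y) * indicator (annulus R (2 * R)) x
      \<le> ennreal (\<eta> (x - y)) * (ennreal (cubic y) * indicator (annulus (R / 2) (3 * R)) y)"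
    proof (cases "norm (x - y) < 1 \<and> R \<le> norm x \<and> norm x \<le> 2 * R")
      case True
      then have "R / 2 \<le> norm y \<and> norm y \<le> 3 * R"
        using R norm_triangle_ineq2[of x y] norm_triangle_ineq2[of y x] by (auto simp: norm_minus_commute)
      then show ?thesis using True by (simp add: mult.assoc)
    next
      case False
      then show ?thesis using mollifierD(3)[OF \<eta>, of "x - y"] by (auto simp: indicator_def not_less)
    qed
  qed
  also have "\<dots> = (\<integral>\<^sup>+y. \<integral>\<^sup>+x. ennreal (\<eta> (x - y)) * (ennreal (cubic y) * indicator (annulus (R / 2) (3 * R)) y) \<partial>lborel \<partial>lborel)"
    by (rule lborel_pair.Fubini') measurable
  also have "\<dots> = (\<integral>\<^sup>+y. ennreal (cubic y) * indicator (annulus (R / 2) (3 * R)) y \<partial>lborel)"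
  proof (intro nn_integral_cong)
    fix y :: "real^3"
    have "(\<integral>\<^sup>+x. ennreal (\<eta> (x - y)) \<partial>lborel) = 1"
      using nn_integral_translate[of "\<lambda>x. ennreal (\<eta> x)" "- y"] mollifier_nn_integral[OF \<eta>] by simp
    then show "(\<integral>\<^sup>+x. ennreal (\<eta> (x - y)) * (ennreal (cubic y) * indicator (annulus (R / 2) (3 * R)) y) \<partial>lborel)
       = ennreal (cubic y) * indicator (annulus (R / 2) (3 * R)) y"
      by (subst nn_integral_multc) auto
  qed
  finally show ?thesis .
qed

lemma smooth3_cmol: "smooth3 (conv \<eta> cubic)"
  by (intro smooth3_conv \<eta>_test cubic_locint)

lemma cmol_annulus_real:
  assumes R: "R \<ge> 2" and b: "b \<ge> 0"
    and tail: "(\<integral>\<^sup>+x. ennreal (cubic x) * indicator (annulus (R / 2) (3 * R)) x \<partial>lborel) \<le> ennreal b"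
  shows "integrable lborel (\<lambda>x. conv \<eta> cubic x * indicator (annulus R (2 * R)) x)"
    and "(\<integral>x. conv \<eta> cubic x * indicator (annulus R (2 * R)) x \<partial>lborel) \<le> b"
proof -
  have [measurable]: "conv \<eta> cubic \<in> borel_measurable borel" using smooth3_cmol by (rule smooth3_borel)
  have nn: "(\<integral>\<^sup>+x. ennreal (conv \<eta> cubic x * indicator (annulus R (2 * R)) x) \<partial>lborel) \<le> ennreal b"
    using order_trans[OF cmol_annulus[OF R] tail] cmol_nonneg by (simp add: ennreal_mult' ennreal_indicator)
  show i: "integrable lborel (\<lambda>x. conv \<eta> cubic x * indicator (annulus R (2 * R)) x)"
  proof (rule integrableI_nonneg)
    show "(\<lambda>x. conv \<eta> cubic x * indicator (annulus R (2 * R)) x) \<in> borel_measurable lborel"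
      by measurable
    show "(\<integral>\<^sup>+x. ennreal (conv \<eta> cubic x * indicator (annulus R (2 * R)) x) \<partial>lborel) < \<infinity>"
      using nn by (rule le_less_trans) simp
  qed (use cmol_nonneg in auto)
  show "(\<integral>x. conv \<eta> cubic x * indicator (annulus R (2 * R)) x \<partial>lborel) \<le> b"
    using nn b cmol_nonneg by (subst (asm) nn_integral_eq_integral[OF i]) auto
qed

end

end

end

lemma smooth3_divide: "smooth3 f \<Longrightarrow> smooth3 (\<lambda>x. f x / c)"
  using smooth3_cmult[of f "1 / c"] by simp

lemma conv_L1_error:
  assumes "locint f" "test_fun \<eta>" "\<tau> \<ge> 0"
    "(\<integral>\<^sup>+x. ennreal \<bar>conv \<eta> f x - f x\<bar> * indicator (cball 0 R) x \<partial>lborel) \<le> ennreal \<tau>"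
  shows "integrable lborel (\<lambda>x. indicator (cball 0 R) x * \<bar>conv \<eta> f x - f x\<bar>)"
    and "(\<integral>x. indicator (cball 0 R) x * \<bar>conv \<eta> f x - f x\<bar> \<partial>lborel) \<le> \<tau>"
proof -
  have "locint (\<lambda>x. conv \<eta> f x + (-1) * f x)"
    by (intro locint_add locint_cmult assms smooth3_locint smooth3_conv)
  then have "integrable lborel (\<lambda>x. indicator (cball 0 R) x * (conv \<eta> f x + (-1) * f x))"
    by (simp add: locint_def)
  from integrable_abs[OF this]
  show i: "integrable lborel (\<lambda>x. indicator (cball 0 R) x * \<bar>conv \<eta> f x - f x\<bar>)"
    by (simp add: abs_mult)
  have "(\<integral>\<^sup>+x. ennreal (indicator (cball 0 R) x * \<bar>conv \<eta> f x - f x\<bar>) \<partial>lborel) \<le> ennreal \<tau>"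
    using assms(4) by (simp add: ennreal_mult' ennreal_indicator mult.commute)
  then show "(\<integral>x. indicator (cball 0 R) x * \<bar>conv \<eta> f x - f x\<bar> \<partial>lborel) \<le> \<tau>"
    using assms(3) by (subst (asm) nn_integral_eq_integral[OF i]) auto
qed

context stationary_NS
begin

text \<open>Half of the dissipation absorbs the commutator; every other term lives on the annulus
  and is bounded by \<open>cubic\<close>. Per index pair the flux costs 3g/R + 1/(2R^4), nine pairs
  and the pressure term 6g/R give 33g/R + 9/(2R^4), and undoing the half gives 66 and (rounding 9
  up) 10.\<close>

lemma energy_bound:
  assumes L: "locint cubic" and \<eta>: "mollifier 1 \<eta>"
    and \<phi>: "test_fun \<phi>" "\<And>x. 0 \<le> \<phi> x" and K: "K > 0" and R: "R \<ge> 2"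
    and b1: "\<And>i x. \<bar>partial i \<phi> x\<bar> \<le> K / R * indicator (annulus R (2 * R)) x"
    and b2: "\<And>i x. \<bar>partial i (partial i \<phi>) x\<bar> \<le> K / R\<^sup>2 * indicator (annulus R (2 * R)) x"
    and b: "b \<ge> 0"
    and tail: "(\<integral>\<^sup>+x. ennreal (cubic x) * indicator (annulus (R / 2) (3 * R)) x \<partial>lborel) \<le> ennreal b"
  shows "(\<integral>x. \<phi> x * (\<Sum>i\<in>UNIV. \<Sum>j\<in>UNIV. (partial i (umol \<eta> j) x)\<^sup>2) \<partial>lborel)
    \<le> K * (66 * b / R + 10 / R ^ 4 * measure lborel (cball (0::real^3) (2 * R)))
      + (\<integral>x. \<phi> x * (\<Sum>i\<in>UNIV. \<Sum>j\<in>UNIV. (tmol \<eta> i j x - umol \<eta> i x * umol \<eta> j x)\<^sup>2) \<partial>lborel)"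
proof -
  have R0: "R > 0" using R by simp
  have \<eta>t: "test_fun \<eta>" using mollifierD(1)[OF \<eta>] .
  define U where "U = umol \<eta>"
  define T where "T = tmol \<eta>"
  define P where "P = conv \<eta> \<pi>"
  define g where "g = conv \<eta> cubic"
  define a where "a = conv \<eta> (\<lambda>x. norm (u x))"
  define A where "A = annulus R (2 * R)"
  have Am [measurable]: "A \<in> sets borel" unfolding A_def by measurable
  have sU: "smooth3 (U j)" and sT: "smooth3 (T i j)" and sP: "smooth3 P" for i j
    unfolding U_def T_def P_def by (intro smooth3_umol smooth3_tmol smooth3_conv \<eta>t pressure_locint)+
  have sphi: "smooth3 \<phi>" using \<phi>(1) by (rule test_fun_smooth)
  have a0: "a x \<ge> 0" and Ua: "\<bar>U j x\<bar> \<le> a x" and a3: "a x ^ 3 \<le> g x" and Ta: "\<bar>T i j x\<bar> * a x \<le> 2 * g x"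
    and Pa: "\<bar>P x\<bar> * a x \<le> 2 * g x" and g0: "g x \<ge> 0" for i j x
    unfolding a_def U_def g_def T_def P_def
    using amol_nonneg[OF L \<eta>] umol_le[OF L \<eta>] amol_cube[OF L \<eta>] tmol_mult_le[OF L \<eta>] pmol_mult_le[OF L \<eta>]
      cmol_nonneg[OF L \<eta>] by auto
  define t where "t i j x = \<phi> x * (partial i (U j) x)\<^sup>2 - (U j x)\<^sup>2 * partial i (partial i \<phi>) x / 2
      - partial i \<phi> x * T i j x * U j x + (U j x)\<^sup>2 * U i x * partial i \<phi> x / 2
      - \<phi> x * (T i j x - U i x * U j x) * partial i (U j) x" for i j x
  define E where "E x = (\<Sum>i\<in>UNIV. \<Sum>j\<in>UNIV. t i j x) - P x * (\<Sum>i\<in>UNIV. partial i \<phi> x * U i x)" for x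
  have E0: "(\<integral>x. E x \<partial>lborel) = 0"
    using energy_identity[OF \<eta>t \<phi>(1)] unfolding E_def t_def U_def T_def P_def .
  obtain S where S: "S > 0" "\<And>x. norm x > S \<Longrightarrow> \<phi> x = 0" using test_fun_support[OF \<phi>(1)] by metis
  have S1: "partial i \<phi> x = 0" if "norm x > S" for i x
    using partial_eq_0_outside[OF sphi S(2) that] .
  have S2: "partial i (partial i \<phi>) x = 0" if "norm x > S" for i x
    using partial_eq_0_outside[OF smooth3_partial[OF sphi] S1 that] .
  have tE: "test_fun E"
  proof (rule test_funI[of _ S])
    show "smooth3 E"
      unfolding E_def[abs_def] t_def by (intro smooth3_intros smooth3_divide sU sT sP sphi)
    show "E x = 0" if "norm x > S" for x
      unfolding E_def t_def using S(2)[OF that] S1[OF that] S2[OF that] by simp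
  qed
  define X where "X x = \<phi> x * (\<Sum>i\<in>UNIV. \<Sum>j\<in>UNIV. (partial i (U j) x)\<^sup>2)" for x
  define Y where "Y x = \<phi> x * (\<Sum>i\<in>UNIV. \<Sum>j\<in>UNIV. (T i j x - U i x * U j x)\<^sup>2)" for x
  have tX: "test_fun X" and tY: "test_fun Y"
    unfolding X_def[abs_def] Y_def[abs_def] by (intro test_fun_mult_left \<phi> smooth3_intros sU sT)+
  \<comment> \<open>The sum of the three flux bounds \<open>c2\<close>, \<open>c3\<close> and
    \<open>c4\<close> below: diffusion contributes 1/2 of g/R + 1/R^4, the stress 2g/R and the
    transport term g/(2R).\<close>
  define c where "c x = K * (3 * g x / R + 1 / (2 * R ^ 4)) * indicator A x" for x
  have pt: "\<phi> x * (partial i (U j) x)\<^sup>2 / 2 \<le> t i j x + c x + \<phi> x * (T i j x - U i x * U j x)\<^sup>2 / 2" for i j x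
  proof -
    define I :: real where "I = indicator A x"
    have I: "I \<ge> 0" by (simp add: I_def)
    define w where "w = partial i (U j) x"
    define r where "r = T i j x - U i x * U j x"
    have Uj2: "(U j x)\<^sup>2 \<le> (a x)\<^sup>2" using power_mono[OF Ua[of j x] abs_ge_zero, of 2] by simp
    \<comment> \<open>The one term without a derivative of \<phi>: it is paid for by half of the
      dissipation and the square of the commutator.\<close>
    have c1: "\<phi> x * r * w \<le> \<phi> x * w\<^sup>2 / 2 + \<phi> x * r\<^sup>2 / 2"
    proof -
      have "0 \<le> \<phi> x * (w - r)\<^sup>2" using \<phi>(2)[of x] by simp
      then show ?thesis by (simp add: power2_eq_square algebra_simps)
    qed
    have c2: "(U j x)\<^sup>2 * partial i (partial i \<phi>) x / 2 \<le> K * (g x / R + 1 / R ^ 4) * I / 2"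
    proof -
      have "(U j x)\<^sup>2 * partial i (partial i \<phi>) x \<le> (U j x)\<^sup>2 * (K / R\<^sup>2 * I)"
        using b2[of i x] unfolding I_def A_def by (intro mult_left_mono) auto
      also have "\<dots> \<le> (a x)\<^sup>2 * (K / R\<^sup>2 * I)" using K I by (intro mult_right_mono Uj2) auto
      also have "\<dots> = K * ((a x)\<^sup>2 / R\<^sup>2) * I" by simp
      also have "\<dots> \<le> K * (g x / R + 1 / R ^ 4) * I"
      proof (intro mult_right_mono mult_left_mono)
        show "(a x)\<^sup>2 / R\<^sup>2 \<le> g x / R + 1 / R ^ 4"
          using square_le_cube_add[OF a0[of x] R0] divide_right_mono[OF a3[of x], of R] R0 by linarith
      qed (use K I in auto)
      finally show ?thesis by simp
    qed
    have c3: "partial i \<phi> x * T i j x * U j x \<le> K * (2 * g x / R) * I"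
    proof -
      have "partial i \<phi> x * T i j x * U j x \<le> \<bar>partial i \<phi> x\<bar> * (\<bar>T i j x\<bar> * \<bar>U j x\<bar>)"
        by (metis abs_ge_self abs_mult mult.assoc)
      also have "\<dots> \<le> (K / R * I) * (\<bar>T i j x\<bar> * a x)"
        using b1[of i x] Ua[of j x] K R0 I unfolding I_def A_def by (intro mult_mono) auto
      also have "\<dots> \<le> (K / R * I) * (2 * g x)" using K R0 I by (intro mult_left_mono Ta) auto
      finally show ?thesis by (simp add: mult_ac)
    qed
    have c4: "- ((U j x)\<^sup>2 * U i x * partial i \<phi> x / 2) \<le> K * (g x / R) * I / 2"
    proof -
      have "- ((U j x)\<^sup>2 * U i x * partial i \<phi> x) \<le> (U j x)\<^sup>2 * \<bar>U i x\<bar> * \<bar>partial i \<phi> x\<bar>"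
        by (metis abs_ge_minus_self abs_mult abs_power2)
      also have "\<dots> \<le> ((a x)\<^sup>2 * a x) * (K / R * I)"
        using b1[of i x] Ua[of i x] Uj2 a0[of x] unfolding I_def A_def by (intro mult_mono) auto
      also have "\<dots> \<le> g x * (K / R * I)"
        using a3[of x] K R0 I by (intro mult_right_mono) (auto simp: power2_eq_square power3_eq_cube)
      finally show ?thesis by (simp add: mult_ac)
    qed
    have cx: "c x = K * (g x / R + 1 / R ^ 4) * I / 2 + K * (2 * g x / R) * I + K * (g x / R) * I / 2"
      unfolding c_def I_def by (simp add: algebra_simps add_divide_distrib)
    show ?thesis
      unfolding cx t_def using c1 c2 c3 c4 unfolding w_def r_def by linarith
  qed
  have Pt: "P x * (\<Sum>i\<in>UNIV. partial i \<phi> x * U i x) \<le> 6 * K * g x / R * indicator A x" for x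
  proof -
    define I :: real where "I = indicator A x"
    have I: "I \<ge> 0" by (simp add: I_def)
    have "\<bar>\<Sum>i\<in>UNIV. partial i \<phi> x * U i x\<bar> \<le> (\<Sum>i\<in>UNIV. \<bar>partial i \<phi> x\<bar> * \<bar>U i x\<bar>)"
      unfolding abs_mult[symmetric] by (rule sum_abs)
    also have "\<dots> \<le> (\<Sum>i\<in>(UNIV::3 set). (K / R * I) * a x)"
      using b1[of _ x] Ua[of _ x] K R0 I unfolding I_def A_def by (intro sum_mono mult_mono) auto
    also have "\<dots> = 3 * (K / R * I) * a x" by simp
    finally have s: "\<bar>\<Sum>i\<in>UNIV. partial i \<phi> x * U i x\<bar> \<le> 3 * (K / R * I) * a x" .
    have "P x * (\<Sum>i\<in>UNIV. partial i \<phi> x * U i x) \<le> \<bar>P x\<bar> * \<bar>\<Sum>i\<in>UNIV. partial i \<phi> x * U i x\<bar>"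
      unfolding abs_mult[symmetric] by (rule abs_ge_self)
    also have "\<dots> \<le> \<bar>P x\<bar> * (3 * (K / R * I) * a x)" by (intro mult_left_mono s) auto
    also have "\<dots> = 3 * (K / R * I) * (\<bar>P x\<bar> * a x)" by simp
    also have "\<dots> \<le> 3 * (K / R * I) * (2 * g x)" using K R0 I by (intro mult_left_mono Pa) auto
    finally show ?thesis by (simp add: I_def mult_ac)
  qed
  have main: "X x / 2 \<le> E x + (K * (33 / R) * (g x * indicator A x) + K * (5 / R ^ 4) * indicator A x) + Y x / 2" for x
  proof -
    have "X x / 2 = (\<Sum>i\<in>UNIV. \<Sum>j\<in>UNIV. \<phi> x * (partial i (U j) x)\<^sup>2 / 2)"
      by (simp add: X_def sum_distrib_left sum_divide_distrib)
    also have "\<dots> \<le> (\<Sum>i\<in>UNIV. \<Sum>j\<in>UNIV. t i j x + c x + \<phi> x * (T i j x - U i x * U j x)\<^sup>2 / 2)"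
      by (intro sum_mono pt)
    also have "\<dots> = (\<Sum>i\<in>UNIV. \<Sum>j\<in>UNIV. t i j x) + 9 * c x + Y x / 2"
      by (simp add: sum.distrib Y_def sum_distrib_left sum_divide_distrib)
    also have "\<dots> \<le> E x + 6 * K * g x / R * indicator A x + 9 * c x + Y x / 2"
      using Pt[of x] by (simp add: E_def)
    also have "\<dots> \<le> E x + (K * (33 / R) * (g x * indicator A x) + K * (5 / R ^ 4) * indicator A x) + Y x / 2"
      unfolding c_def using K R0 by (cases "x \<in> A") (auto simp: field_simps)
    finally show ?thesis .
  qed
  have ig: "integrable lborel (\<lambda>x. g x * indicator A x)" and Ig: "(\<integral>x. g x * indicator A x \<partial>lborel) \<le> b"
    using cmol_annulus_real[OF L \<eta> R b tail] unfolding g_def A_def by auto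
  have Asub: "A \<subseteq> cball 0 (2 * R)" by (auto simp: A_def)
  have fin: "emeasure lborel (cball (0::real^3) (2 * R)) < \<infinity>" by (rule emeasure_lborel_cball_finite)
  have iA: "integrable lborel (indicator A :: real^3 \<Rightarrow> real)"
  proof (rule integrable_real_indicator)
    show "emeasure lborel A < \<infinity>" using emeasure_mono[OF Asub, of lborel] fin by (auto intro: le_less_trans)
  qed simp
  have mA: "measure lborel A \<le> measure lborel (cball (0::real^3) (2 * R))"
    by (rule measure_mono_fmeasurable[OF Asub]) (use fin in \<open>auto intro: fmeasurableI\<close>)
  have "(\<integral>x. X x / 2 \<partial>lborel) \<le> (\<integral>x. E x + (K * (33 / R) * (g x * indicator A x) + K * (5 / R ^ 4) * indicator A x) + Y x / 2 \<partial>lborel)"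
    using test_fun_integrable[OF tX] test_fun_integrable[OF tY] test_fun_integrable[OF tE] ig iA
    by (intro integral_mono main) auto
  also have "\<dots> = (\<integral>x. E x \<partial>lborel) + (K * (33 / R) * (\<integral>x. g x * indicator A x \<partial>lborel) + K * (5 / R ^ 4) * measure lborel A) + (\<integral>x. Y x \<partial>lborel) / 2"
    using test_fun_integrable[OF tY] test_fun_integrable[OF tE] ig iA by simp
  also have "\<dots> \<le> (K * (33 / R) * b + K * (5 / R ^ 4) * measure lborel (cball (0::real^3) (2 * R))) + (\<integral>x. Y x \<partial>lborel) / 2"
    using K R0 by (simp add: E0) (intro add_mono mult_left_mono divide_right_mono Ig mA; simp)
  finally have "(\<integral>x. X x \<partial>lborel) \<le> 2 * (K * (33 / R) * b + K * (5 / R ^ 4) * measure lborel (cball (0::real^3) (2 * R))) + (\<integral>x. Y x \<partial>lborel)"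
    by simp
  then show ?thesis unfolding X_def Y_def U_def T_def by (simp add: algebra_simps)
qed

end

lemma abs_mult_le_weighted:
  fixes a b s :: real
  assumes "s > 0" shows "\<bar>a * b\<bar> \<le> s * a\<^sup>2 + b\<^sup>2 / s"
proof -
  have "0 \<le> (s * \<bar>a\<bar> - \<bar>b\<bar>)\<^sup>2" by simp
  then have "2 * s * (\<bar>a\<bar> * \<bar>b\<bar>) \<le> s\<^sup>2 * a\<^sup>2 + b\<^sup>2"
    by (simp add: power2_diff power_mult_distrib mult_ac)
  moreover have "s * (\<bar>a\<bar> * \<bar>b\<bar>) \<ge> 0" using assms by simp
  ultimately have "s * (\<bar>a\<bar> * \<bar>b\<bar>) \<le> s\<^sup>2 * a\<^sup>2 + b\<^sup>2" by linarith
  also have "\<dots> = s * (s * a\<^sup>2 + b\<^sup>2 / s)" using assms by (simp add: power2_eq_square distrib_left)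
  finally show ?thesis using assms by (simp add: abs_mult)
qed

context stationary_NS
begin

context
  fixes M :: real
  assumes bounded: "AE x in lborel. norm (u x) \<le> M"
    and cubic_loc: "locint cubic"
    and tail: "\<And>e. e > 0 \<Longrightarrow> \<exists>R0. \<forall>R\<ge>R0.
      (\<integral>\<^sup>+x. ennreal (cubic x) * indicator (annulus (R / 2) (3 * R)) x \<partial>lborel) \<le> ennreal (e * R)"
begin

lemma bound_nonneg: "M \<ge> 0"
proof (rule ccontr)
  assume "\<not> M \<ge> 0"
  then have "\<not> norm (u x) \<le> M" for x using norm_ge_zero[of "u x"] by linarith
  with bounded have "AE x in (lborel :: (real^3) measure). False" by simp
  then show False by (simp add: eventually_False ae_filter_eq_bot_iff)
qed

lemma umol_bound:
  assumes "mollifier d \<eta>" shows "\<bar>umol \<eta> j x\<bar> \<le> M"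
proof -
  have "\<bar>umol \<eta> j x\<bar> \<le> conv \<eta> (\<lambda>y. M) x"
    unfolding umol_def
  proof (rule conv_abs_le[OF assms u_locint locint_const])
    show "AE x in lborel. \<bar>u x $ j\<bar> \<le> M"
      using bounded by eventually_elim (use abs_component_le_norm order_trans in blast)
  qed
  then show ?thesis by (simp add: conv_const[OF assms])
qed

lemma tmol_bound:
  assumes "mollifier d \<eta>" shows "\<bar>tmol \<eta> i j x\<bar> \<le> M * M"
proof -
  have "\<bar>tmol \<eta> i j x\<bar> \<le> conv \<eta> (\<lambda>y. M * M) x"
    unfolding tmol_def
  proof (rule conv_abs_le[OF assms uu_locint locint_const])
    show "AE x in lborel. \<bar>u x $ i * u x $ j\<bar> \<le> M * M"
      using bounded
    proof eventually_elim
      fix x assume "norm (u x) \<le> M"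
      then show "\<bar>u x $ i * u x $ j\<bar> \<le> M * M"
        unfolding abs_mult using abs_component_le_norm[of "u x"] bound_nonneg
        by (intro mult_mono) (auto intro: order_trans)
    qed
  qed
  then show ?thesis by (simp add: conv_const[OF assms])
qed

text \<open>Boundedness enters here: the commutator is at most 2M^2 pointwise, and by telescoping
  the product it is bounded by mollification errors with bounded factors. Its square is therefore at
  most 2M^2 times quantities that are small in L^1. Nine index pairs give 18.\<close>

lemma commutator_bound:
  assumes \<eta>: "mollifier d \<eta>" and \<phi>: "test_fun \<phi>" "\<And>x. 0 \<le> \<phi> x" "\<And>x. \<phi> x \<le> 1" "\<And>x. norm x \<ge> S \<Longrightarrow> \<phi> x = 0"
    and \<tau>: "\<tau> \<ge> 0"
    and U: "\<And>i. (\<integral>\<^sup>+x. ennreal \<bar>umol \<eta> i x - u x $ i\<bar> * indicator (cball 0 S) x \<partial>lborel) \<le> ennreal \<tau>"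
    and T: "\<And>i j. (\<integral>\<^sup>+x. ennreal \<bar>tmol \<eta> i j x - u x $ i * u x $ j\<bar> * indicator (cball 0 S) x \<partial>lborel) \<le> ennreal \<tau>"
  shows "(\<integral>x. \<phi> x * (\<Sum>i\<in>UNIV. \<Sum>j\<in>UNIV. (tmol \<eta> i j x - umol \<eta> i x * umol \<eta> j x)\<^sup>2) \<partial>lborel)
    \<le> 18 * (M * M) * (1 + 2 * M) * \<tau>"
proof -
  have \<eta>t: "test_fun \<eta>" using mollifierD(1)[OF \<eta>] .
  define eU where "eU i x = indicator (cball 0 S) x * \<bar>umol \<eta> i x - u x $ i\<bar>" for i x
  define eT where "eT i j x = indicator (cball 0 S) x * \<bar>tmol \<eta> i j x - u x $ i * u x $ j\<bar>" for i j x
  have iU: "integrable lborel (eU i)" "(\<integral>x. eU i x \<partial>lborel) \<le> \<tau>" for i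
    using conv_L1_error[OF u_locint \<eta>t \<tau> U[unfolded umol_def]] unfolding eU_def[abs_def] umol_def by auto
  have iT: "integrable lborel (eT i j)" "(\<integral>x. eT i j x \<partial>lborel) \<le> \<tau>" for i j
    using conv_L1_error[OF uu_locint \<eta>t \<tau> T[unfolded tmol_def]] unfolding eT_def[abs_def] tmol_def by auto
  define r where "r i j x = tmol \<eta> i j x - umol \<eta> i x * umol \<eta> j x" for i j x
  have ir: "test_fun (\<lambda>x. \<phi> x * (r i j x)\<^sup>2)" for i j
    unfolding r_def by (intro test_fun_mult_left \<phi> smooth3_intros smooth3_umol smooth3_tmol \<eta>t)
  have pt: "AE x in lborel. \<phi> x * (r i j x)\<^sup>2 \<le> 2 * (M * M) * (eT i j x + M * eU j x + M * eU i x)" for i j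
    using bounded
  proof eventually_elim
    fix x assume ux: "norm (u x) \<le> M"
    show "\<phi> x * (r i j x)\<^sup>2 \<le> 2 * (M * M) * (eT i j x + M * eU j x + M * eU i x)"
    proof (cases "norm x \<le> S")
      case True
      have UU: "\<bar>umol \<eta> i x * umol \<eta> j x\<bar> \<le> M * M"
        unfolding abs_mult using umol_bound[OF \<eta>] bound_nonneg by (intro mult_mono) auto
      have r1: "\<bar>r i j x\<bar> \<le> 2 * (M * M)"
        using UU tmol_bound[OF \<eta>, of i j x] unfolding r_def by linarith
      have "r i j x = (tmol \<eta> i j x - u x $ i * u x $ j) - u x $ i * (umol \<eta> j x - u x $ j) - umol \<eta> j x * (umol \<eta> i x - u x $ i)"
        unfolding r_def by (simp add: algebra_simps)
      then have "\<bar>r i j x\<bar> \<le> \<bar>tmol \<eta> i j x - u x $ i * u x $ j\<bar> + \<bar>u x $ i * (umol \<eta> j x - u x $ j)\<bar> + \<bar>umol \<eta> j x * (umol \<eta> i x - u x $ i)\<bar>"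
        by linarith
      also have "\<dots> \<le> eT i j x + M * eU j x + M * eU i x"
        unfolding abs_mult eT_def eU_def using True ux umol_bound[OF \<eta>, of j x] abs_component_le_norm[of "u x" i]
        by (auto intro!: add_mono mult_right_mono)
      finally have r2: "\<bar>r i j x\<bar> \<le> eT i j x + M * eU j x + M * eU i x" .
      have "\<phi> x * (r i j x)\<^sup>2 \<le> 1 * (r i j x)\<^sup>2" using \<phi>(3)[of x] by (intro mult_right_mono) auto
      also have "\<dots> = \<bar>r i j x\<bar> * \<bar>r i j x\<bar>" by (simp add: power2_eq_square)
      also have "\<dots> \<le> 2 * (M * M) * (eT i j x + M * eU j x + M * eU i x)"
        using bound_nonneg by (intro mult_mono r1 r2) auto
      finally show ?thesis .
    next
      case False
      then show ?thesis using \<phi>(4)[of x] by (simp add: eT_def eU_def)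
    qed
  qed
  have "(\<integral>x. \<phi> x * (r i j x)\<^sup>2 \<partial>lborel) \<le> 2 * (M * M) * (1 + 2 * M) * \<tau>" for i j
  proof -
    have "(\<integral>x. \<phi> x * (r i j x)\<^sup>2 \<partial>lborel) \<le> (\<integral>x. 2 * (M * M) * (eT i j x + M * eU j x + M * eU i x) \<partial>lborel)"
      by (rule integral_mono_AE[OF test_fun_integrable[OF ir] _ pt]) (use iU(1) iT(1) in auto)
    also have "\<dots> = 2 * (M * M) * ((\<integral>x. eT i j x \<partial>lborel) + M * (\<integral>x. eU j x \<partial>lborel) + M * (\<integral>x. eU i x \<partial>lborel))"
      using iU(1) iT(1) by simp
    also have "\<dots> \<le> 2 * (M * M) * (\<tau> + M * \<tau> + M * \<tau>)"
      using bound_nonneg iU(2) iT(2) by (intro mult_left_mono add_mono) auto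
    finally show ?thesis by (simp add: algebra_simps)
  qed
  then have "(\<Sum>i\<in>(UNIV::3 set). \<Sum>j\<in>(UNIV::3 set). \<integral>x. \<phi> x * (r i j x)\<^sup>2 \<partial>lborel)
     \<le> (\<Sum>i\<in>(UNIV::3 set). \<Sum>j\<in>(UNIV::3 set). 2 * (M * M) * (1 + 2 * M) * \<tau>)"
    by (intro sum_mono) auto
  moreover have "(\<integral>x. \<phi> x * (\<Sum>i\<in>UNIV. \<Sum>j\<in>UNIV. (r i j x)\<^sup>2) \<partial>lborel)
     = (\<Sum>i\<in>(UNIV::3 set). \<Sum>j\<in>(UNIV::3 set). \<integral>x. \<phi> x * (r i j x)\<^sup>2 \<partial>lborel)"
    unfolding sum_distrib_left
    by (simp add: Bochner_Integration.integral_sum test_fun_integrable ir)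
  ultimately show ?thesis unfolding r_def by simp
qed

text \<open>Finitely many functions have to be approximated at once; the smallest of their radii
  works for all, and including 1 gives the support condition of the energy estimate.\<close>

lemma common_mollifier:
  assumes "\<tau> > 0"
  obtains \<eta> where "mollifier 1 \<eta>"
    "\<And>i. (\<integral>\<^sup>+x. ennreal \<bar>umol \<eta> i x - u x $ i\<bar> * indicator (cball 0 S) x \<partial>lborel) \<le> ennreal \<tau>"
    "\<And>i j. (\<integral>\<^sup>+x. ennreal \<bar>tmol \<eta> i j x - u x $ i * u x $ j\<bar> * indicator (cball 0 S) x \<partial>lborel) \<le> ennreal \<tau>"
proof -
  define PU where "PU i d \<longleftrightarrow> (\<forall>\<eta>. mollifier d \<eta> \<longrightarrow>
     (\<integral>\<^sup>+x. ennreal \<bar>umol \<eta> i x - u x $ i\<bar> * indicator (cball 0 S) x \<partial>lborel) \<le> ennreal \<tau>)" for i d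
  define PT where "PT i j d \<longleftrightarrow> (\<forall>\<eta>. mollifier d \<eta> \<longrightarrow>
     (\<integral>\<^sup>+x. ennreal \<bar>tmol \<eta> i j x - u x $ i * u x $ j\<bar> * indicator (cball 0 S) x \<partial>lborel) \<le> ennreal \<tau>)" for i j d
  have "\<exists>d>0. PU i d" for i
    unfolding PU_def umol_def using mollifier_approximates[OF u_locint[of i] assms, of S] by blast
  then obtain d1 where d1: "\<And>i. d1 i > 0" "\<And>i. PU i (d1 i)" by metis
  have "\<exists>d>0. PT i j d" for i j
    unfolding PT_def tmol_def using mollifier_approximates[OF uu_locint[of i j] assms, of S] by blast
  then obtain d2 where d2: "\<And>i j. d2 i j > 0" "\<And>i j. PT i j (d2 i j)" by metis
  define D where "D = insert 1 (range d1 \<union> range (\<lambda>(i, j). d2 i j))"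
  have D: "finite D" "D \<noteq> {}" "\<And>d. d \<in> D \<Longrightarrow> d > 0"
    using d1(1) d2(1) by (auto simp: D_def)
  have "Min D > 0" using D by (simp add: Min_gr_iff)
  then obtain \<eta> where \<eta>: "mollifier (Min D) \<eta>" using mollifier_exists by metis
  have "mollifier d \<eta>" if "d \<in> D" for d
    using mollifier_mono[OF \<eta>] Min_le[OF D(1) that] by blast
  then have m: "mollifier 1 \<eta>" "mollifier (d1 i) \<eta>" "mollifier (d2 i j) \<eta>" for i j
    unfolding D_def by auto
  show ?thesis
    by (rule that[OF m(1)]) (use d1(2) d2(2) m(2,3) in \<open>auto simp: PU_def PT_def\<close>)
qed

text \<open>Parameters are chosen in the order \<open>s\<close>, e = s^2, the radius
  \<open>R\<close> from the tail condition, and last the mollifier, whose errors may depend on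
  \<open>R\<close>. The energy estimate gives a mollified dissipation of at most C e, and
  Cauchy-Schwarz with weight \<open>s\<close> bounds the pairing with \<psi> by s Q + C e /
  s.\<close>

lemma weak_gradient_eq_0:
  assumes \<psi>: "test_fun \<psi>"
  shows "(\<integral>x. u x $ j * partial i \<psi> x \<partial>lborel) = 0"
proof -
  define I where "I = (\<integral>x. u x $ j * partial i \<psi> x \<partial>lborel)"
  obtain R1 where R1: "R1 > 0" "\<And>x. norm x > R1 \<Longrightarrow> \<psi> x = 0" using test_fun_support[OF \<psi>] by metis
  obtain D where D: "D > 0" "\<And>x. \<bar>partial i \<psi> x\<bar> \<le> D" using test_fun_bounded[OF test_fun_partial[OF \<psi>]] by metis
  obtain K where K: "K > 0"
    "\<And>R. R > 0 \<Longrightarrow> \<exists>\<phi>. test_fun \<phi> \<and> (\<forall>x. 0 \<le> \<phi> x \<and> \<phi> x \<le> 1) \<and> (\<forall>x. norm x \<le> R \<longrightarrow> \<phi> x = 1)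
      \<and> (\<forall>x. norm x \<ge> 2 * R \<longrightarrow> \<phi> x = 0)
      \<and> (\<forall>i x. \<bar>partial i \<phi> x\<bar> \<le> K / R * indicator (annulus R (2 * R)) x)
      \<and> (\<forall>i x. \<bar>partial i (partial i \<phi>) x\<bar> \<le> K / R\<^sup>2 * indicator (annulus R (2 * R)) x)"
    using scaled_cutoff by blast
  obtain v where v: "v > 0" "\<And>r. r \<ge> 0 \<Longrightarrow> emeasure lborel (cball (0::real^3) r) = ennreal (v * r ^ 3)"
    using emeasure_ball3 by metis
  define Q where "Q = (\<integral>x. (\<psi> x)\<^sup>2 \<partial>lborel)"
  have iQ: "integrable lborel (\<lambda>x. (\<psi> x)\<^sup>2)"
    using test_fun_integrable[OF test_fun_mult_left[OF \<psi> test_fun_smooth[OF \<psi>]]] by (simp add: power2_eq_square)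
  have Q: "Q \<ge> 0" unfolding Q_def by simp
  \<comment> \<open>The three contributions in units of \<open>e\<close>: the tail of
    \<open>cubic\<close>, the diffusion remainder 10 R^-4 v (2R)^3 = 80 v / R with 1/R \<le> e, and
    the commutator.\<close>
  define C where "C = 66 * K + 80 * K * v + 1"
  have C: "C > 0" using K v by (simp add: C_def add_pos_pos)
  have key: "\<bar>I\<bar> \<le> s * (Q + C + 1)" if s: "0 < s" "s \<le> 1" for s
  proof -
    \<comment> \<open>Quadratic in \<open>s\<close>, so that \<open>C * e / s\<close> is still of
      order \<open>s\<close>.\<close>
    define e where "e = s\<^sup>2"
    have e: "e > 0" "e \<le> s" using s by (auto simp: e_def power2_eq_square mult_left_le_one_le)
    obtain R0 where R0: "\<And>R. R \<ge> R0 \<Longrightarrow>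
      (\<integral>\<^sup>+x. ennreal (cubic x) * indicator (annulus (R / 2) (3 * R)) x \<partial>lborel) \<le> ennreal (e * R)"
      using tail[OF e(1)] by blast
    define R where "R = max (max R0 R1) (max 2 (1 / e))"
    have R: "R \<ge> R0" "R \<ge> R1" "R \<ge> 2" "R \<ge> 1 / e" by (auto simp: R_def)
    have Rpos: "R > 0" using R by simp
    have Re: "1 / R \<le> e" using R(4) Rpos e by (simp add: field_simps)
    obtain \<phi> where \<phi>: "test_fun \<phi>" "\<And>x. 0 \<le> \<phi> x" "\<And>x. \<phi> x \<le> 1" "\<And>x. norm x \<le> R \<Longrightarrow> \<phi> x = 1"
      "\<And>x. norm x \<ge> 2 * R \<Longrightarrow> \<phi> x = 0"
      "\<And>i x. \<bar>partial i \<phi> x\<bar> \<le> K / R * indicator (annulus R (2 * R)) x"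
      "\<And>i x. \<bar>partial i (partial i \<phi>) x\<bar> \<le> K / R\<^sup>2 * indicator (annulus R (2 * R)) x"
      using K(2)[OF Rpos] by blast
    \<comment> \<open>The constant of \<open>commutator_bound\<close>; \<tau> is then small enough
      both for the commutator and for replacing the mollified field by \<open>u\<close> against the
      bounded derivative of \<psi>.\<close>
    define m where "m = 18 * (M * M) * (1 + 2 * M)"
    have m: "m \<ge> 0" using bound_nonneg by (simp add: m_def)
    define \<tau> where "\<tau> = e / (m + D + 1)"
    have mD: "m + D + 1 > 0" using m D by simp
    have \<tau>: "\<tau> > 0" "m * \<tau> \<le> e" "D * \<tau> \<le> e"
    proof -
      show "\<tau> > 0" using e mD by (simp add: \<tau>_def)
      have "(m + D + 1) * \<tau> = e" using mD by (simp add: \<tau>_def)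
      then show "m * \<tau> \<le> e" "D * \<tau> \<le> e"
        using mult_right_mono[of m "m + D + 1" \<tau>] mult_right_mono[of D "m + D + 1" \<tau>] \<open>\<tau> > 0\<close> m D by auto
    qed
    obtain \<eta> where \<eta>: "mollifier 1 \<eta>"
      "\<And>i. (\<integral>\<^sup>+x. ennreal \<bar>umol \<eta> i x - u x $ i\<bar> * indicator (cball 0 (2 * R)) x \<partial>lborel) \<le> ennreal \<tau>"
      "\<And>i j. (\<integral>\<^sup>+x. ennreal \<bar>tmol \<eta> i j x - u x $ i * u x $ j\<bar> * indicator (cball 0 (2 * R)) x \<partial>lborel) \<le> ennreal \<tau>"
      using common_mollifier[OF \<tau>(1), of "2 * R"] by blast
    have \<eta>t: "test_fun \<eta>" using mollifierD(1)[OF \<eta>(1)] .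
    define X where "X x = \<phi> x * (\<Sum>i\<in>UNIV. \<Sum>j\<in>UNIV. (partial i (umol \<eta> j) x)\<^sup>2)" for x
    have tX: "test_fun X"
      unfolding X_def[abs_def] by (intro test_fun_mult_left \<phi> smooth3_intros smooth3_umol \<eta>t)
    have "(\<integral>x. X x \<partial>lborel) \<le> K * (66 * (e * R) / R + 10 / R ^ 4 * measure lborel (cball (0::real^3) (2 * R)))
      + (\<integral>x. \<phi> x * (\<Sum>i\<in>UNIV. \<Sum>j\<in>UNIV. (tmol \<eta> i j x - umol \<eta> i x * umol \<eta> j x)\<^sup>2) \<partial>lborel)"
      unfolding X_def
      by (rule energy_bound[OF cubic_loc \<eta>(1) \<phi>(1,2) K(1) R(3) \<phi>(6,7) _ R0[OF R(1)]]) (use e Rpos in auto)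
    also have "\<dots> \<le> K * (66 * (e * R) / R + 10 / R ^ 4 * measure lborel (cball (0::real^3) (2 * R))) + e"
      using commutator_bound[OF \<eta>(1) \<phi>(1,2,3,5) less_imp_le[OF \<tau>(1)] \<eta>(2,3)] \<tau>(2) by (simp add: m_def)
    also have "measure lborel (cball (0::real^3) (2 * R)) = v * (2 * R) ^ 3"
      using v(1) v(2)[of "2 * R"] Rpos by (simp add: measure_def)
    also have "K * (66 * (e * R) / R + 10 / R ^ 4 * (v * (2 * R) ^ 3)) = 66 * K * e + 80 * K * v * (1 / R)"
      using Rpos by (simp add: field_simps power_mult_distrib eval_nat_numeral)
    also have "66 * K * e + 80 * K * v * (1 / R) + e \<le> 66 * K * e + 80 * K * v * e + e"
      using K v by (intro add_mono mult_left_mono Re) auto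
    also have "\<dots> = C * e" by (simp add: C_def algebra_simps)
    finally have X: "(\<integral>x. X x \<partial>lborel) \<le> C * e" .
    have "\<bar>\<integral>x. \<psi> x * partial i (umol \<eta> j) x \<partial>lborel\<bar> \<le> (\<integral>x. s * (\<psi> x)\<^sup>2 + X x / s \<partial>lborel)"
    proof (rule integral_abs_bound_integral)
      show "integrable lborel (\<lambda>x. \<psi> x * partial i (umol \<eta> j) x)"
        by (intro test_fun_integrable test_fun_mult_left \<psi> smooth3_partial smooth3_umol \<eta>t)
      show "integrable lborel (\<lambda>x. s * (\<psi> x)\<^sup>2 + X x / s)"
        using iQ test_fun_integrable[OF tX] by simp
      fix x
      show "\<bar>\<psi> x * partial i (umol \<eta> j) x\<bar> \<le> s * (\<psi> x)\<^sup>2 + X x / s"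
      proof (cases "norm x \<le> R")
        case True
        have "(partial i (umol \<eta> j) x)\<^sup>2 \<le> (\<Sum>j\<in>UNIV. (partial i (umol \<eta> j) x)\<^sup>2)"
          by (rule member_le_sum) auto
        also have "\<dots> \<le> (\<Sum>i\<in>UNIV. \<Sum>j\<in>UNIV. (partial i (umol \<eta> j) x)\<^sup>2)"
          by (rule member_le_sum) (auto intro: sum_nonneg)
        also have "\<dots> = X x" using True by (simp add: X_def \<phi>(4))
        finally have "(partial i (umol \<eta> j) x)\<^sup>2 / s \<le> X x / s" using s by (intro divide_right_mono) auto
        then show ?thesis using abs_mult_le_weighted[OF s(1), of "\<psi> x" "partial i (umol \<eta> j) x"] by linarith
      next
        case False
        have "X x \<ge> 0" unfolding X_def using \<phi>(2)[of x] by (intro mult_nonneg_nonneg sum_nonneg) auto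
        then show ?thesis using False R R1(2)[of x] s by simp
      qed
    qed
    also have "\<dots> = s * Q + (\<integral>x. X x \<partial>lborel) / s"
      unfolding Q_def using iQ test_fun_integrable[OF tX] by simp
    also have "\<dots> \<le> s * Q + C * e / s" using X s by (intro add_left_mono divide_right_mono) auto
    also have "C * e / s = s * C" using s by (simp add: e_def power2_eq_square)
    finally have b1: "\<bar>\<integral>x. partial i \<psi> x * umol \<eta> j x \<partial>lborel\<bar> \<le> s * Q + s * C"
      using integral_by_parts[OF \<psi> smooth3_umol[OF \<eta>t], of i j] by simp
    define E where "E x = indicator (cball 0 (2 * R)) x * \<bar>umol \<eta> j x - u x $ j\<bar>" for x
    have iE: "integrable lborel E" "(\<integral>x. E x \<partial>lborel) \<le> \<tau>"
      using conv_L1_error[OF u_locint \<eta>t less_imp_le[OF \<tau>(1)] \<eta>(2)[unfolded umol_def, of j]]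
      unfolding E_def[abs_def] umol_def by auto
    have i1: "integrable lborel (\<lambda>x. partial i \<psi> x * umol \<eta> j x)"
      by (intro test_fun_integrable test_fun_mult_left test_fun_partial \<psi> smooth3_umol \<eta>t)
    have i2: "integrable lborel (\<lambda>x. u x $ j * partial i \<psi> x)"
      by (intro u_test_integrable test_fun_partial \<psi>)
    have "\<bar>\<integral>x. u x $ j * partial i \<psi> x - partial i \<psi> x * umol \<eta> j x \<partial>lborel\<bar> \<le> (\<integral>x. D * E x \<partial>lborel)"
    proof (rule integral_abs_bound_integral)
      show "integrable lborel (\<lambda>x. u x $ j * partial i \<psi> x - partial i \<psi> x * umol \<eta> j x)" using i1 i2 by simp
      show "integrable lborel (\<lambda>x. D * E x)" using iE by simp
      fix x
      show "\<bar>u x $ j * partial i \<psi> x - partial i \<psi> x * umol \<eta> j x\<bar> \<le> D * E x"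
      proof (cases "norm x \<le> 2 * R")
        case True
        have "\<bar>u x $ j * partial i \<psi> x - partial i \<psi> x * umol \<eta> j x\<bar> = \<bar>partial i \<psi> x\<bar> * \<bar>umol \<eta> j x - u x $ j\<bar>"
          by (simp add: abs_mult[symmetric] right_diff_distrib abs_minus_commute mult.commute)
        also have "\<dots> \<le> D * \<bar>umol \<eta> j x - u x $ j\<bar>" by (intro mult_right_mono D) auto
        finally show ?thesis using True by (simp add: E_def)
      next
        case False
        then have "norm x > R1" using R Rpos by linarith
        from partial_eq_0_outside[OF test_fun_smooth[OF \<psi>] R1(2) this] have "partial i \<psi> x = 0" .
        then show ?thesis using D(1) by (simp add: E_def)
      qed
    qed
    also have "\<dots> \<le> D * \<tau>" using iE D by (simp add: mult_left_mono)
    also have "\<dots> \<le> e" by (rule \<tau>(3))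
    finally have b2: "\<bar>I - (\<integral>x. partial i \<psi> x * umol \<eta> j x \<partial>lborel)\<bar> \<le> e"
      unfolding I_def using i1 i2 by simp
    have "\<bar>I\<bar> \<le> s * Q + s * C + e" using b1 b2 by linarith
    also have "\<dots> \<le> s * Q + s * C + s" using e by simp
    finally show ?thesis by (simp add: algebra_simps)
  qed
  have "\<bar>I\<bar> \<le> 0"
  proof (rule field_le_epsilon)
    fix \<delta> :: real assume \<delta>: "\<delta> > 0"
    define B where "B = Q + C + 1"
    have B: "B > 0" using Q C by (simp add: B_def)
    define s where "s = min 1 (\<delta> / B)"
    have s: "0 < s" "s \<le> 1" "s \<le> \<delta> / B" using \<delta> B by (auto simp: s_def)
    have "\<bar>I\<bar> \<le> s * B" using key[OF s(1,2)] by (simp add: B_def)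
    also have "\<dots> \<le> \<delta> / B * B" using s B by (intro mult_right_mono) auto
    also have "\<dots> = \<delta>" using B by simp
    finally show "\<bar>I\<bar> \<le> 0 + \<delta>" by simp
  qed
  then show ?thesis by (simp add: I_def)
qed

text \<open>A vanishing weak gradient makes the mollified component a constant \<open>c\<close>, and
  |c|^3 lies below the mollified \<open>cubic\<close>. On the annulus from R to 2R the latter
  integrates to at most e R, while the volume grows like R^3, so c = 0.\<close>

lemma umol_eq_0:
  assumes \<eta>: "mollifier 1 \<eta>" shows "umol \<eta> j x = 0"
proof -
  have \<eta>t: "test_fun \<eta>" using mollifierD(1)[OF \<eta>] .
  have p0: "partial i (umol \<eta> j) x = 0" for i x
  proof -
    have "partial i (umol \<eta> j) x = (\<integral>y. partial i \<eta> (x - y) * u y $ j \<partial>lborel)"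
      by (simp add: umol_def partial_conv \<eta>t u_locint conv_def)
    also have "\<dots> = - (\<integral>y. u y $ j * partial i (\<lambda>y. \<eta> (x - y)) y \<partial>lborel)"
      by (simp add: partial_reflect test_fun_smooth[OF \<eta>t] mult.commute)
    finally show ?thesis using weak_gradient_eq_0[OF test_fun_reflect[OF \<eta>t, of x]] by simp
  qed
  define c where "c = umol \<eta> j 0"
  have const: "umol \<eta> j x = c" for x
  proof -
    obtain t where "umol \<eta> j (0 + x) - umol \<eta> j 0 = (\<Sum>i\<in>UNIV. x $ i * partial i (umol \<eta> j) (0 + t *\<^sub>R x))"
      using mvt_partial[OF smooth3_umol[OF \<eta>t], of j 0 x] by metis
    then show ?thesis by (simp add: p0 c_def)
  qed
  have c3: "\<bar>c\<bar> ^ 3 \<le> conv \<eta> cubic x" for x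
  proof -
    have "\<bar>c\<bar> ^ 3 \<le> conv \<eta> (\<lambda>x. norm (u x)) x ^ 3"
      using umol_le[OF cubic_loc \<eta>, of j x] by (intro power_mono) (auto simp: const)
    also have "\<dots> \<le> conv \<eta> cubic x" by (rule amol_cube[OF cubic_loc \<eta>])
    finally show ?thesis .
  qed
  obtain v where v: "v > 0" "\<And>r. r \<ge> 0 \<Longrightarrow> emeasure lborel (cball (0::real^3) r) = ennreal (v * r ^ 3)"
    using emeasure_ball3 by metis
  have "\<bar>c\<bar> ^ 3 * v \<le> 0"
  proof (rule field_le_epsilon)
    fix e :: real assume e: "e > 0"
    obtain R0 where R0: "\<And>R. R \<ge> R0 \<Longrightarrow>
      (\<integral>\<^sup>+x. ennreal (cubic x) * indicator (annulus (R / 2) (3 * R)) x \<partial>lborel) \<le> ennreal (e * R)"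
      using tail[OF e] by blast
    define R where "R = max R0 2"
    have R: "R \<ge> R0" "R \<ge> 2" by (auto simp: R_def)
    define A where "A = annulus R (2 * R)"
    have Am [measurable]: "A \<in> sets borel" unfolding A_def by measurable
    \<comment> \<open>A lower bound for the volume of the annulus by subadditivity, since the two
      balls and their volumes are known; it yields the factor 8 - 1 = 7 below.\<close>
    have "ennreal (v * (2 * R) ^ 3) \<le> emeasure lborel (cball (0::real^3) R \<union> A)"
    proof -
      have "cball (0::real^3) (2 * R) \<subseteq> cball 0 R \<union> A" by (auto simp: A_def)
      then have "emeasure lborel (cball (0::real^3) (2 * R)) \<le> emeasure lborel (cball 0 R \<union> A)"
        by (rule emeasure_mono) simp
      then show ?thesis using v(2)[of "2 * R"] R by simp
    qed
    also have "\<dots> \<le> emeasure lborel (cball (0::real^3) R) + emeasure lborel A"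
      by (rule emeasure_subadditive) auto
    also have "emeasure lborel (cball (0::real^3) R) = ennreal (v * R ^ 3)" using v(2)[of R] R by simp
    finally have vA: "ennreal (v * (2 * R) ^ 3) \<le> ennreal (v * R ^ 3) + emeasure lborel A" .
    have iA: "ennreal (\<bar>c\<bar> ^ 3) * emeasure lborel A \<le> ennreal (e * R)"
    proof -
      have "ennreal (\<bar>c\<bar> ^ 3) * emeasure lborel A = (\<integral>\<^sup>+x. ennreal (\<bar>c\<bar> ^ 3) * indicator A x \<partial>lborel)"
        by (simp add: nn_integral_cmult_indicator)
      also have "\<dots> \<le> (\<integral>\<^sup>+x. ennreal (conv \<eta> cubic x) * indicator A x \<partial>lborel)"
        by (intro nn_integral_mono mult_right_mono ennreal_leI c3) auto
      also have "\<dots> \<le> ennreal (e * R)"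
        unfolding A_def by (rule order_trans[OF cmol_annulus[OF cubic_loc \<eta> R(2)] R0[OF R(1)]])
      finally show ?thesis .
    qed
    have "ennreal (\<bar>c\<bar> ^ 3) * ennreal (v * (2 * R) ^ 3) \<le> ennreal (\<bar>c\<bar> ^ 3) * (ennreal (v * R ^ 3) + emeasure lborel A)"
      by (intro mult_left_mono vA) auto
    also have "\<dots> \<le> ennreal (\<bar>c\<bar> ^ 3) * ennreal (v * R ^ 3) + ennreal (e * R)"
      unfolding distrib_left by (intro add_left_mono iA)
    finally have "ennreal (\<bar>c\<bar> ^ 3 * (v * (2 * R) ^ 3)) \<le> ennreal (\<bar>c\<bar> ^ 3 * (v * R ^ 3) + e * R)"
      using v(1) R e by (simp add: ennreal_mult ennreal_plus)
    then have "\<bar>c\<bar> ^ 3 * (v * (2 * R) ^ 3) \<le> \<bar>c\<bar> ^ 3 * (v * R ^ 3) + e * R"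
      by (subst (asm) ennreal_le_iff) (use v(1) R e in \<open>auto intro!: add_nonneg_nonneg mult_nonneg_nonneg\<close>)
    then have "7 * (\<bar>c\<bar> ^ 3 * v) * R\<^sup>2 * R \<le> e * R"
      by (simp add: power_mult_distrib power2_eq_square power3_eq_cube algebra_simps)
    then have a: "7 * (\<bar>c\<bar> ^ 3 * v) * R\<^sup>2 \<le> e" using R by (simp add: mult_le_cancel_right)
    have "1 \<le> R\<^sup>2" using R by (simp add: one_le_power)
    then have "(\<bar>c\<bar> ^ 3 * v) * 1 \<le> (7 * (\<bar>c\<bar> ^ 3 * v)) * R\<^sup>2"
      using v(1) by (intro mult_mono[of "\<bar>c\<bar> ^ 3 * v" "7 * (\<bar>c\<bar> ^ 3 * v)"]) auto
    then show "\<bar>c\<bar> ^ 3 * v \<le> 0 + e" using a by simp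
  qed
  then have "\<bar>c\<bar> ^ 3 \<le> 0" using v(1) by (simp add: mult_le_0_iff)
  then have "c = 0" by (simp add: power_le_zero_eq)
  then show ?thesis by (simp add: const)
qed

text \<open>Every mollification with support in the unit ball vanishes, so the mollification error
  is |u_j| itself, and it can be made arbitrarily small in L^1 on each ball.\<close>

theorem u_eq_0_of_bounded: "AE x in lborel. u x = 0"
proof -
  have "AE x in lborel. u x $ j = 0" for j
  proof -
    have z: "(\<integral>\<^sup>+x. ennreal \<bar>u x $ j\<bar> * indicator (cball 0 (real n)) x \<partial>lborel) = 0" for n
    proof -
      have "(\<integral>\<^sup>+x. ennreal \<bar>u x $ j\<bar> * indicator (cball 0 (real n)) x \<partial>lborel) \<le> 0"
      proof (rule ennreal_le_epsilon)
        fix e :: real assume e: "e > 0"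
        obtain \<eta> where \<eta>: "mollifier 1 \<eta>"
          "\<And>i. (\<integral>\<^sup>+x. ennreal \<bar>umol \<eta> i x - u x $ i\<bar> * indicator (cball 0 (real n)) x \<partial>lborel) \<le> ennreal e"
          "\<And>i j. (\<integral>\<^sup>+x. ennreal \<bar>tmol \<eta> i j x - u x $ i * u x $ j\<bar> * indicator (cball 0 (real n)) x \<partial>lborel) \<le> ennreal e"
          using common_mollifier[OF e, of "real n"] by blast
        from \<eta>(2)[of j] show "(\<integral>\<^sup>+x. ennreal \<bar>u x $ j\<bar> * indicator (cball 0 (real n)) x \<partial>lborel) \<le> 0 + ennreal e"
          by (simp add: umol_eq_0[OF \<eta>(1)])
      qed
      then show ?thesis by simp
    qed
    have "AE x in lborel. ennreal \<bar>u x $ j\<bar> * indicator (cball 0 (real n)) x = 0" for n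
      using z[of n] by (subst (asm) nn_integral_0_iff_AE) measurable
    then have "AE x in lborel. \<forall>n. ennreal \<bar>u x $ j\<bar> * indicator (cball 0 (real n)) x = 0"
      unfolding AE_all_countable by blast
    then show ?thesis
    proof eventually_elim
      fix x assume a: "\<forall>n. ennreal \<bar>u x $ j\<bar> * indicator (cball 0 (real n)) x = 0"
      obtain n where "norm x \<le> real n" using real_arch_simple by blast
      then show "u x $ j = 0" using a[rule_format, of n] by simp
    qed
  qed
  then have "AE x in lborel. \<forall>j\<in>UNIV. u x $ j = 0" by (intro AE_finite_allI) auto
  then show ?thesis by eventually_elim (simp add: vec_eq_iff)
qed

end

end

subsection \<open>Consequences of the integrability assumptions\<close>

lemma vec_nth_borel [measurable]: "(\<lambda>x::real^3. x $ i) \<in> borel_measurable borel"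
  by (rule smooth3_borel[OF smooth3_coord])

lemma H_set_borel [measurable]: "H_set m \<in> sets borel"
  unfolding H_set_def by measurable

lemma prod_3: "prod f (UNIV :: 3 set) = f 1 * f 2 * f 3"
  unfolding UNIV_3 by (simp add: ac_simps)

section \<open>Volume of the thin set and the scaling inequality\<close>

lemma emeasure_slab:
  assumes "a \<ge> 0" "b \<ge> 0"
  shows "emeasure lborel (cbox (vector [0, - b, - b]) (vector [a, b, b]) :: (real^3) set) = ennreal (a * (2 * b) * (2 * b))"
proof -
  have le: "\<forall>i. (vector [0, - b, - b] :: real^3) $ i \<le> (vector [a, b, b] :: real^3) $ i"
    using assms by (simp add: forall_3 vector_3)
  have "measure lborel (cbox (vector [0, - b, - b]) (vector [a, b, b]) :: (real^3) set)
     = (\<Prod>i\<in>UNIV. (vector [a, b, b] :: real^3) $ i - (vector [0, - b, - b] :: real^3) $ i)"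
    by (rule content_cbox_cart) (use le in \<open>auto simp: interval_eq_empty_cart not_less\<close>)
  also have "\<dots> = a * (2 * b) * (2 * b)"
    unfolding prod_3 by (simp add: vector_3)
  finally have eq: "measure lborel (cbox (vector [0, - b, - b]) (vector [a, b, b]) :: (real^3) set) = a * (2 * b) * (2 * b)" .
  have "emeasure lborel (cbox (vector [0, - b, - b]) (vector [a, b, b]) :: (real^3) set) \<noteq> top"
    using less_imp_neq[OF emeasure_lborel_cbox_finite[of "vector [0, - b, - b] :: real^3" "vector [a, b, b]"]]
    by (simp only: infinity_ennreal_def not_False_eq_True)
  from emeasure_eq_ennreal_measure[OF this] show ?thesis unfolding eq .
qed

text \<open>The squared radius of the cross section tends to 0, since a power of a logarithm grows
  more slowly than its argument. Up to a height \<open>N\<close> the set lies in a fixed box; beyond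
  it, in a box whose cross section is as small as desired and whose length is at most
  \<open>R\<close>.\<close>

lemma H_set_thin:
  assumes e: "e > 0"
  shows "\<exists>R0. \<forall>R\<ge>R0. emeasure lborel (H_set m \<inter> cball 0 R) \<le> ennreal (e * R)"
proof -
  define f where "f t = (ln (1 + t)) ^ m / (1 + t)" for t :: real
  have lim: "(f \<longlongrightarrow> 0) at_top"
  proof -
    have "filterlim (\<lambda>t::real. ln (1 + t)) at_top at_top"
      by (intro filterlim_compose[OF ln_at_top] filterlim_tendsto_add_at_top[OF tendsto_const] filterlim_ident)
    from filterlim_compose[OF tendsto_power_div_exp_0 this]
    have "((\<lambda>t. (ln (1 + t)) ^ m / exp (ln (1 + t))) \<longlongrightarrow> 0) (at_top :: real filter)" .
    moreover have "\<forall>\<^sub>F t in at_top. (ln (1 + t)) ^ m / exp (ln (1 + t)) = f t"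
      using eventually_gt_at_top[of 0] by eventually_elim (simp add: f_def)
    ultimately show ?thesis by (rule Lim_transform_eventually)
  qed
  \<comment> \<open>The long box then has cross section (2b)^2 = e/2, half of the allowance.\<close>
  define b where "b = sqrt (e / 8)"
  have b: "b > 0" "b\<^sup>2 = e / 8" using e by (auto simp: b_def)
  have "\<forall>\<^sub>F t in at_top. f t < b\<^sup>2" using lim b e by (intro order_tendstoD) auto
  then obtain N0 where N0: "\<And>t. t \<ge> N0 \<Longrightarrow> f t < b\<^sup>2" unfolding eventually_at_top_linorder by blast
  define N where "N = max N0 1"
  have N: "N \<ge> 1" "\<And>t. t \<ge> N \<Longrightarrow> f t < b\<^sup>2" using N0 by (auto simp: N_def)
  define D where "D = sqrt ((ln (1 + N)) ^ m)"
  have lnN: "ln (1 + N) \<ge> 0" using N by simp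
  have D: "D \<ge> 0" "D\<^sup>2 = (ln (1 + N)) ^ m" using lnN by (auto simp: D_def)
  have fD: "f t \<le> D\<^sup>2" if "0 < t" "t \<le> N" for t
  proof -
    have "f t \<le> (ln (1 + t)) ^ m / 1"
      unfolding f_def using that by (intro divide_left_mono) auto
    also have "\<dots> \<le> (ln (1 + N)) ^ m" using that N by (auto intro!: power_mono)
    finally show ?thesis by (simp add: D)
  qed
  have sub: "H_set m \<inter> cball 0 R \<subseteq> cbox (vector [0, - D, - D]) (vector [N, D, D]) \<union> cbox (vector [0, - b, - b]) (vector [R, b, b])" for R
  proof
    fix x assume x: "x \<in> H_set m \<inter> cball 0 R"
    then have x1: "x $ 1 > 0" "(x $ 2)\<^sup>2 + (x $ 3)\<^sup>2 \<le> f (x $ 1)" "norm x \<le> R"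
      by (auto simp: H_set_def f_def)
    have xR: "x $ 1 \<le> R" using x1(3) abs_component_le_norm[of x 1] by linarith
    show "x \<in> cbox (vector [0, - D, - D]) (vector [N, D, D]) \<union> cbox (vector [0, - b, - b]) (vector [R, b, b])"
    proof (cases "x $ 1 \<le> N")
      case True
      have "(x $ 2)\<^sup>2 \<le> D\<^sup>2" "(x $ 3)\<^sup>2 \<le> D\<^sup>2"
        using x1(2) fD[OF x1(1) True] zero_le_power2[of "x $ 2"] zero_le_power2[of "x $ 3"] by linarith+
      then have "\<bar>x $ 2\<bar> \<le> D" "\<bar>x $ 3\<bar> \<le> D" using D(1) by (auto simp: abs_le_square_iff[symmetric])
      then show ?thesis using True x1(1) by (auto simp: mem_box_cart forall_3 vector_3)
    next
      case False
      have "(x $ 2)\<^sup>2 \<le> b\<^sup>2" "(x $ 3)\<^sup>2 \<le> b\<^sup>2"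
        using x1(2) N(2)[of "x $ 1"] False zero_le_power2[of "x $ 2"] zero_le_power2[of "x $ 3"] by linarith+
      then have "\<bar>x $ 2\<bar> \<le> b" "\<bar>x $ 3\<bar> \<le> b" using b(1) by (auto simp: abs_le_square_iff[symmetric])
      then show ?thesis using xR x1(1) by (auto simp: mem_box_cart forall_3 vector_3)
    qed
  qed
  \<comment> \<open>The threshold on \<open>R\<close> lets the fixed box, of volume 4 N D^2, fit
    into the other half e R / 2.\<close>
  have "emeasure lborel (H_set m \<inter> cball 0 R) \<le> ennreal (e * R)" if R: "R \<ge> max 1 (8 * N * D\<^sup>2 / e)" for R
  proof -
    have "emeasure lborel (H_set m \<inter> cball 0 R)
      \<le> emeasure lborel (cbox (vector [0, - D, - D]) (vector [N, D, D]) \<union> cbox (vector [0, - b, - b]) (vector [R, b, b]) :: (real^3) set)"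
      by (intro emeasure_mono sub) auto
    also have "\<dots> \<le> emeasure lborel (cbox (vector [0, - D, - D]) (vector [N, D, D]) :: (real^3) set) + emeasure lborel (cbox (vector [0, - b, - b]) (vector [R, b, b]) :: (real^3) set)"
      by (rule emeasure_subadditive) auto
    also have "\<dots> = ennreal (N * (2 * D) * (2 * D)) + ennreal (R * (2 * b) * (2 * b))"
      using N D b R by (simp add: emeasure_slab)
    also have "\<dots> = ennreal (N * (2 * D) * (2 * D) + R * (2 * b) * (2 * b))"
      using N D b R by (intro ennreal_plus[symmetric]) auto
    also have "\<dots> \<le> ennreal (e * R)"
    proof (rule ennreal_leI)
      have "R * (2 * b) * (2 * b) = R * (4 * b\<^sup>2)" by (simp add: power2_eq_square)
      also have "\<dots> = e * R / 2" by (simp add: b)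
      finally have "R * (2 * b) * (2 * b) = e * R / 2" .
      moreover have "N * (2 * D) * (2 * D) = 8 * N * D\<^sup>2 / 2" by (simp add: power2_eq_square)
      moreover have "8 * N * D\<^sup>2 \<le> e * R" using R e by (simp add: pos_divide_le_eq mult.commute)
      ultimately show "N * (2 * D) * (2 * D) + R * (2 * b) * (2 * b) \<le> e * R" by linarith
    qed
    finally show ?thesis .
  qed
  then show ?thesis by blast
qed

text \<open>Young's inequality behind the scaling condition \<open>p < 9/2\<close>: the last term integrates to
  \<open>O(R powr (3 - P / (P - 3)))\<close> over a ball of radius \<open>R\<close>.\<close>

lemma cube_le_powr_add:
  fixes t p P R :: real
  assumes t: "t \<ge> 0" and p: "3 < p" "p \<le> P" and R: "R \<ge> 1"
  shows "t ^ 3 \<le> R * (t powr p + R powr (- (P / (P - 3))))"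
proof -
  \<comment> \<open>The crossover value: \<open>t^3 = R t^p\<close> holds at t = \<tau>. Above it
    the power \<open>p\<close> dominates, below it the cube is at most \<tau>^3.\<close>
  define \<tau> where "\<tau> = R powr (- (1 / (p - 3)))"
  have \<tau>: "\<tau> > 0" using R by (simp add: \<tau>_def)
  show ?thesis
  proof (cases "t \<le> \<tau>")
    case True
    have "t ^ 3 \<le> \<tau> ^ 3" using True t by (intro power_mono) auto
    also have "\<dots> = \<tau> powr real 3" using \<tau> by (simp only: powr_realpow)
    also have "\<dots> = R powr (- (1 / (p - 3)) * real 3)" unfolding \<tau>_def by (rule powr_powr)
    also have "- (1 / (p - 3)) * real 3 = 1 + (- (p / (p - 3)))" using p by (simp add: field_simps)
    also have "R powr (1 + (- (p / (p - 3)))) = R * R powr (- (p / (p - 3)))"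
      unfolding powr_add using R by simp
    \<comment> \<open>p/(p-3) decreases in \<open>p\<close>, so with R \<ge> 1 the largest exponent
      \<open>P\<close> is the worst case and gives a bound uniform in \<open>p\<close>.\<close>
    also have "\<dots> \<le> R * R powr (- (P / (P - 3)))"
    proof (intro mult_left_mono powr_mono)
      have "P / (P - 3) = 1 + 3 / (P - 3)" "p / (p - 3) = 1 + 3 / (p - 3)"
        using p by (auto simp: field_simps)
      moreover have "3 / (P - 3) \<le> 3 / (p - 3)" using p by (intro divide_left_mono) auto
      ultimately show "- (p / (p - 3)) \<le> - (P / (P - 3))" by linarith
    qed (use R in auto)
    also have "\<dots> \<le> R * (t powr p + R powr (- (P / (P - 3))))"
      using R by (intro mult_left_mono) auto
    finally show ?thesis .
  next
    case False
    then have tt: "t > \<tau>" "t > 0" using \<tau> by auto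
    have "1 / R = \<tau> powr (p - 3)"
    proof -
      have "\<tau> powr (p - 3) = R powr (- (1 / (p - 3)) * (p - 3))" unfolding \<tau>_def by (rule powr_powr)
      also have "- (1 / (p - 3)) * (p - 3) = - 1" using p by simp
      also have "R powr (- 1) = 1 / R" using R by (simp add: powr_minus_divide)
      finally show ?thesis by simp
    qed
    also have "\<dots> \<le> t powr (p - 3)" using tt \<tau> p by (intro powr_mono2) auto
    finally have "1 \<le> R * t powr (p - 3)" using R by (simp add: field_simps)
    then have "t ^ 3 * 1 \<le> t ^ 3 * (R * t powr (p - 3))" using t by (intro mult_left_mono) auto
    also have "t ^ 3 = t powr real 3" using tt by (simp only: powr_realpow)
    also have "t powr real 3 * (R * t powr (p - 3)) = R * (t powr real 3 * t powr (p - 3))" by simp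
    also have "\<dots> = R * t powr p" unfolding powr_add[symmetric] by simp
    also have "\<dots> \<le> R * (t powr p + R powr (- (P / (P - 3))))" using R by (intro mult_left_mono) auto
    finally show ?thesis using tt by (simp add: powr_realpow)
  qed
qed

section \<open>Cubic integrals of a function with finite variable-exponent modular\<close>

context
  fixes w r :: "real^3 \<Rightarrow> real" and A q P :: real and m :: nat
  assumes w [measurable]: "w \<in> borel_measurable lebesgue" and w0: "\<And>x. 0 \<le> w x"
    and r [measurable]: "r \<in> borel_measurable lebesgue"
    and A: "A \<ge> 1" and q: "q > 3" and P: "P > 3" "P < 9/2"
    and on_H: "AE x in lebesgue. x \<in> H_set m \<longrightarrow> w x \<le> A"
    and off_H: "AE x in lebesgue. x \<notin> H_set m \<longrightarrow> q \<le> r x \<and> r x \<le> P"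
    and fin: "(\<integral>\<^sup>+x. ennreal (indicator (- H_set m) x * (w x / A) powr r x) \<partial>lebesgue) < \<infinity>"
begin

lemma H_lebesgue [measurable]: "H_set m \<in> sets lebesgue"
  using H_set_borel by (rule sets_completionI_sets[of _ lborel, simplified])

definition modular_density :: "real^3 \<Rightarrow> real" where "modular_density x = indicator (- H_set m) x * (w x / A) powr r x"

lemma modular_density_nonneg: "modular_density x \<ge> 0"
  by (simp add: modular_density_def)

lemma modular_density_measurable [measurable]: "modular_density \<in> borel_measurable lebesgue"
  unfolding modular_density_def[abs_def] by measurable

lemma modular_density_integrable: "integrable lebesgue modular_density"
  using fin modular_density_nonneg modular_density_measurable unfolding modular_density_def[symmetric] by (intro integrableI_nonneg) auto

text \<open>Where w > A the point is almost surely outside the thin set and w/A > 1, so raising the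
  exponent from \<open>q\<close> to \<open>r x\<close> only increases the power and the modular
  takes over.\<close>

lemma large_part_finite: "(\<integral>\<^sup>+x. ennreal (if w x > A then w x powr q else 0) \<partial>lebesgue) < \<infinity>"
proof -
  have "(\<integral>\<^sup>+x. ennreal (if w x > A then w x powr q else 0) \<partial>lebesgue) \<le> (\<integral>\<^sup>+x. ennreal (A powr q) * ennreal (modular_density x) \<partial>lebesgue)"
  proof (rule nn_integral_mono_AE)
    show "AE x in lebesgue. ennreal (if w x > A then w x powr q else 0) \<le> ennreal (A powr q) * ennreal (modular_density x)"
      using on_H off_H
    proof eventually_elim
      fix x assume h: "x \<in> H_set m \<longrightarrow> w x \<le> A" "x \<notin> H_set m \<longrightarrow> q \<le> r x \<and> r x \<le> P"
      show "ennreal (if w x > A then w x powr q else 0) \<le> ennreal (A powr q) * ennreal (modular_density x)"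
      proof (cases "w x > A")
        case True
        then have nH: "x \<notin> H_set m" using h by auto
        have "w x powr q = A powr q * (w x / A) powr q"
          using A w0 by (subst powr_mult[symmetric]) auto
        also have "\<dots> \<le> A powr q * (w x / A) powr r x"
          using True A h nH by (intro mult_left_mono powr_mono) auto
        also have "\<dots> = A powr q * modular_density x" using nH by (simp add: modular_density_def)
        finally show ?thesis using True by (simp add: ennreal_mult'[symmetric] ennreal_leI)
      qed simp
    qed
  qed
  also have "\<dots> = ennreal (A powr q) * (\<integral>\<^sup>+x. ennreal (modular_density x) \<partial>lebesgue)"
    by (intro nn_integral_cmult) measurable
  also have "\<dots> < \<infinity>" using fin by (simp add: modular_density_def ennreal_mult_less_top)
  finally show ?thesis .
qed

lemma cube_le: "AE x in lebesgue. w x ^ 3 \<le> A ^ 3 * (1 + modular_density x)"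
  using on_H off_H
proof eventually_elim
  fix x assume h: "x \<in> H_set m \<longrightarrow> w x \<le> A" "x \<notin> H_set m \<longrightarrow> q \<le> r x \<and> r x \<le> P"
  show "w x ^ 3 \<le> A ^ 3 * (1 + modular_density x)"
  proof (cases "w x \<le> A")
    case True
    then have "w x ^ 3 \<le> A ^ 3" using w0 by (intro power_mono)
    also have "\<dots> \<le> A ^ 3 * (1 + modular_density x)" using A modular_density_nonneg[of x] by simp
    finally show ?thesis .
  next
    case False
    then have nH: "x \<notin> H_set m" using h by auto
    have t1: "w x / A > 1" using False A by simp
    have "(w x / A) ^ 3 = (w x / A) powr real 3" using t1 by (subst powr_realpow) auto
    also have "\<dots> \<le> (w x / A) powr r x" using t1 h nH q by (intro powr_mono) auto
    also have "\<dots> \<le> 1 + modular_density x" using nH by (simp add: modular_density_def)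
    finally have "A ^ 3 * (w x / A) ^ 3 \<le> A ^ 3 * (1 + modular_density x)" using A by (intro mult_left_mono) auto
    then show ?thesis using A by (simp add: power_divide)
  qed
qed

lemma cube_local_finite: "(\<integral>\<^sup>+x. ennreal (w x ^ 3) * indicator (cball 0 R) x \<partial>lebesgue) < \<infinity>"
proof -
  have [measurable]: "cball (0::real^3) R \<in> sets lebesgue" by simp
  have "(\<integral>\<^sup>+x. ennreal (w x ^ 3) * indicator (cball 0 R) x \<partial>lebesgue)
    \<le> (\<integral>\<^sup>+x. ennreal (A ^ 3) * indicator (cball 0 R) x + ennreal (A ^ 3) * ennreal (modular_density x) \<partial>lebesgue)"
  proof (rule nn_integral_mono_AE)
    show "AE x in lebesgue. ennreal (w x ^ 3) * indicator (cball 0 R) x \<le> ennreal (A ^ 3) * indicator (cball 0 R) x + ennreal (A ^ 3) * ennreal (modular_density x)"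
      using cube_le
    proof eventually_elim
      fix x assume "w x ^ 3 \<le> A ^ 3 * (1 + modular_density x)"
      then have "ennreal (w x ^ 3) \<le> ennreal (A ^ 3 + A ^ 3 * modular_density x)" by (intro ennreal_leI) (simp add: distrib_left)
      then show "ennreal (w x ^ 3) * indicator (cball 0 R) x \<le> ennreal (A ^ 3) * indicator (cball 0 R) x + ennreal (A ^ 3) * ennreal (modular_density x)"
        using A modular_density_nonneg[of x] by (auto simp: indicator_def ennreal_plus ennreal_mult')
    qed
  qed
  also have "\<dots> = ennreal (A ^ 3) * emeasure lebesgue (cball (0::real^3) R) + ennreal (A ^ 3) * (\<integral>\<^sup>+x. ennreal (modular_density x) \<partial>lebesgue)"
    by (subst nn_integral_add) (auto simp: nn_integral_cmult_indicator nn_integral_cmult)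
  also have "\<dots> < \<infinity>"
    using fin emeasure_lborel_cball_finite[of "0::real^3" R] by (simp add: modular_density_def ennreal_mult_less_top)
  finally show ?thesis .
qed

lemma modular_density_tail:
  assumes e: "e > 0"
  shows "\<exists>R0. \<forall>R\<ge>R0. (\<integral>\<^sup>+x. ennreal (modular_density x) * indicator {x. R \<le> norm x} x \<partial>lebesgue) \<le> ennreal e"
proof -
  have [measurable]: "{x::real^3. R \<le> norm x} \<in> sets lebesgue" for R
    by (rule sets_completionI_sets[of _ lborel, simplified]) measurable
  have "((\<lambda>n. \<integral>x. modular_density x * indicator {x. real n \<le> norm x} x \<partial>lebesgue) \<longlonglongrightarrow> integral\<^sup>L lebesgue (\<lambda>x::real^3. 0 :: real))"
  proof (rule integral_dominated_convergence[OF _ _ modular_density_integrable])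
    show "AE x in lebesgue. (\<lambda>n. modular_density x * indicator {x. real n \<le> norm x} x) \<longlonglongrightarrow> 0"
    proof (rule AE_I2, rule tendsto_eventually)
      fix x :: "real^3"
      obtain N where N: "norm x < real N" using reals_Archimedean2 by blast
      show "\<forall>\<^sub>F n in sequentially. modular_density x * indicator {x. real n \<le> norm x} x = 0"
        unfolding eventually_sequentially using N by (intro exI[of _ N]) auto
    qed
    show "AE x in lebesgue. norm (modular_density x * indicator {x. real n \<le> norm x} x) \<le> modular_density x" for n
      using modular_density_nonneg by (auto simp: indicator_def)
  qed measurable
  then have "\<forall>\<^sub>F n in sequentially. (\<integral>x. modular_density x * indicator {x. real n \<le> norm x} x \<partial>lebesgue) < e"
    using e by (intro order_tendstoD) auto
  from eventually_happens'[OF sequentially_bot this]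
  obtain N where N: "(\<integral>x. modular_density x * indicator {x. real N \<le> norm x} x \<partial>lebesgue) < e" by blast
  have iN: "integrable lebesgue (\<lambda>x. modular_density x * indicator {x. real N \<le> norm x} x)"
  proof (rule Bochner_Integration.integrable_bound[OF modular_density_integrable])
    show "(\<lambda>x. modular_density x * indicator {x. real N \<le> norm x} x) \<in> borel_measurable lebesgue" by measurable
    show "AE x in lebesgue. norm (modular_density x * indicator {x. real N \<le> norm x} x) \<le> norm (modular_density x)"
      by (auto simp: indicator_def)
  qed
  have "(\<integral>\<^sup>+x. ennreal (modular_density x) * indicator {x. R \<le> norm x} x \<partial>lebesgue) \<le> ennreal e" if "R \<ge> real N" for R
  proof -
    have "(\<integral>\<^sup>+x. ennreal (modular_density x) * indicator {x. R \<le> norm x} x \<partial>lebesgue) \<le> (\<integral>\<^sup>+x. ennreal (modular_density x * indicator {x. real N \<le> norm x} x) \<partial>lebesgue)"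
      using that by (intro nn_integral_mono) (auto simp: indicator_def)
    also have "\<dots> = ennreal (\<integral>x. modular_density x * indicator {x. real N \<le> norm x} x \<partial>lebesgue)"
      using iN modular_density_nonneg by (intro nn_integral_eq_integral) auto
    also have "\<dots> \<le> ennreal e" using N by (intro ennreal_leI) auto
    finally show ?thesis .
  qed
  then show ?thesis by blast
qed

text \<open>Three contributions: on the thin set \<open>w\<close> is bounded and the volume is o(R);
  outside it the Young inequality leaves R times the tail of the modular and a term R^(1-s) on a
  volume of order R^3.\<close>

lemma cube_annulus_small:
  assumes e: "e > 0"
  shows "\<exists>R0. \<forall>R\<ge>R0. (\<integral>\<^sup>+x. ennreal (w x ^ 3) * indicator (annulus (R / 2) (3 * R)) x \<partial>lebesgue) \<le> ennreal (e * R)"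
proof -
  obtain v where v: "v > 0" "\<And>r. r \<ge> 0 \<Longrightarrow> emeasure lborel (cball (0::real^3) r) = ennreal (v * r ^ 3)"
    using emeasure_ball3 by metis
  \<comment> \<open>The factor 5 is 3 + 1 + 1: the thin set is measured in a ball of radius 3R, and
    the two remaining terms cost one unit each.\<close>
  define \<delta> where "\<delta> = e / (A ^ 3 * 5)"
  have \<delta>: "\<delta> > 0" "A ^ 3 * (5 * \<delta>) = e" using e A by (auto simp: \<delta>_def)
  obtain R1 where R1: "\<And>R. R \<ge> R1 \<Longrightarrow> emeasure lborel (H_set m \<inter> cball 0 R) \<le> ennreal (\<delta> * R)"
    using H_set_thin[OF \<delta>(1)] by blast
  obtain R2 where R2: "\<And>R. R \<ge> R2 \<Longrightarrow> (\<integral>\<^sup>+x. ennreal (modular_density x) * indicator {x. R \<le> norm x} x \<partial>lebesgue) \<le> ennreal \<delta>"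
    using modular_density_tail[OF \<delta>(1)] by blast
  \<comment> \<open>s > 3 is equivalent to P < 9/2 for P > 3; this makes R^(3-s) tend to 0, and 27
    is the factor from the radius 3R.\<close>
  define s where "s = P / (P - 3)"
  have s: "s > 3" using P by (simp add: s_def field_simps)
  have "((\<lambda>R. 27 * v * R powr (3 - s)) \<longlongrightarrow> 27 * v * 0) (at_top :: real filter)"
    using s by (intro tendsto_intros tendsto_neg_powr filterlim_ident) auto
  then have "\<forall>\<^sub>F R in at_top. 27 * v * R powr (3 - s) < \<delta>" using \<delta> by (intro order_tendstoD) auto
  then obtain R3 where R3: "\<And>R. R \<ge> R3 \<Longrightarrow> 27 * v * R powr (3 - s) < \<delta>"
    unfolding eventually_at_top_linorder by blast
  have "(\<integral>\<^sup>+x. ennreal (w x ^ 3) * indicator (annulus (R / 2) (3 * R)) x \<partial>lebesgue) \<le> ennreal (e * R)"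
    if "R \<ge> max (max 1 \<bar>R1\<bar>) (max (2 * \<bar>R2\<bar>) R3)" for R
  proof -
    have R: "R \<ge> 1" "3 * R \<ge> R1" "R / 2 \<ge> R2" "R \<ge> R3" using that by auto
    have [measurable]: "{x::real^3. R \<le> norm x} \<in> sets lebesgue" for R
      by (rule sets_completionI_sets[of _ lborel, simplified]) measurable
    have [measurable]: "cball (0::real^3) R \<in> sets lebesgue" for R by simp
    have "(\<integral>\<^sup>+x. ennreal (w x ^ 3) * indicator (annulus (R / 2) (3 * R)) x \<partial>lebesgue)
      \<le> (\<integral>\<^sup>+x. ennreal (A ^ 3) * indicator (H_set m \<inter> cball 0 (3 * R)) x
          + (ennreal (A ^ 3 * R) * (ennreal (modular_density x) * indicator {x. R / 2 \<le> norm x} x)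
          + ennreal (A ^ 3 * R * R powr (- s)) * indicator (cball 0 (3 * R)) x) \<partial>lebesgue)"
    proof (rule nn_integral_mono_AE)
      show "AE x in lebesgue. ennreal (w x ^ 3) * indicator (annulus (R / 2) (3 * R)) x
        \<le> ennreal (A ^ 3) * indicator (H_set m \<inter> cball 0 (3 * R)) x
          + (ennreal (A ^ 3 * R) * (ennreal (modular_density x) * indicator {x. R / 2 \<le> norm x} x)
          + ennreal (A ^ 3 * R * R powr (- s)) * indicator (cball 0 (3 * R)) x)"
        using on_H off_H
      proof eventually_elim
        fix x assume h: "x \<in> H_set m \<longrightarrow> w x \<le> A" "x \<notin> H_set m \<longrightarrow> q \<le> r x \<and> r x \<le> P"
        show "ennreal (w x ^ 3) * indicator (annulus (R / 2) (3 * R)) x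
        \<le> ennreal (A ^ 3) * indicator (H_set m \<inter> cball 0 (3 * R)) x
          + (ennreal (A ^ 3 * R) * (ennreal (modular_density x) * indicator {x. R / 2 \<le> norm x} x)
          + ennreal (A ^ 3 * R * R powr (- s)) * indicator (cball 0 (3 * R)) x)"
        proof (cases "R / 2 \<le> norm x \<and> norm x \<le> 3 * R")
          case ann: True
          show ?thesis
          proof (cases "x \<in> H_set m")
            case True
            then have "ennreal (w x ^ 3) \<le> ennreal (A ^ 3)" using h w0 by (intro ennreal_leI power_mono) auto
            then show ?thesis using True ann by (simp add: add_increasing2)
          next
            case False
            have "(w x / A) ^ 3 \<le> R * ((w x / A) powr r x + R powr (- (P / (P - 3))))"
              using h False w0[of x] A q R by (intro cube_le_powr_add) auto
            then have "A ^ 3 * (w x / A) ^ 3 \<le> A ^ 3 * (R * (modular_density x + R powr (- s)))"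
              using A False by (intro mult_left_mono) (auto simp: modular_density_def s_def)
            then have "w x ^ 3 \<le> A ^ 3 * R * modular_density x + A ^ 3 * R * R powr (- s)"
              using A by (simp add: power_divide algebra_simps)
            then have "ennreal (w x ^ 3) \<le> ennreal (A ^ 3 * R * modular_density x + A ^ 3 * R * R powr (- s))" by (rule ennreal_leI)
            also have "\<dots> = ennreal (A ^ 3 * R) * ennreal (modular_density x) + ennreal (A ^ 3 * R * R powr (- s))"
              using A R modular_density_nonneg[of x] by (subst ennreal_plus) (auto simp: ennreal_mult)
            finally show ?thesis using ann False by simp
          qed
        qed simp
      qed
    qed
    also have "\<dots> = ennreal (A ^ 3) * emeasure lebesgue (H_set m \<inter> cball 0 (3 * R))
       + (ennreal (A ^ 3 * R) * (\<integral>\<^sup>+x. ennreal (modular_density x) * indicator {x. R / 2 \<le> norm x} x \<partial>lebesgue)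
       + ennreal (A ^ 3 * R * R powr (- s)) * emeasure lebesgue (cball (0::real^3) (3 * R)))"
    proof -
      have HR: "H_set m \<inter> cball 0 (3 * R) \<in> sets lebesgue" by (intro sets.Int H_lebesgue) simp
      have m1: "(\<lambda>x. ennreal (A ^ 3) * indicator (H_set m \<inter> cball 0 (3 * R)) x) \<in> borel_measurable lebesgue"
        by (rule borel_measurable_times_ennreal[OF borel_measurable_const borel_measurable_indicator[OF HR]])
      have m2': "(\<lambda>x. ennreal (modular_density x) * indicator {x. R / 2 \<le> norm x} x) \<in> borel_measurable lebesgue"
        by measurable
      note m2 = borel_measurable_times_ennreal[OF borel_measurable_const m2', of "ennreal (A ^ 3 * R)"]
      have cR: "cball (0::real^3) (3 * R) \<in> sets lebesgue" by simp
      have m3: "(\<lambda>x. ennreal (A ^ 3 * R * R powr (- s)) * indicator (cball (0::real^3) (3 * R)) x) \<in> borel_measurable lebesgue"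
        by (rule borel_measurable_times_ennreal[OF borel_measurable_const borel_measurable_indicator[OF cR]])
      show ?thesis
        unfolding nn_integral_add[OF m1 borel_measurable_add[OF m2 m3]] nn_integral_add[OF m2 m3]
          nn_integral_cmult[OF m2'] nn_integral_cmult_indicator[OF HR] nn_integral_cmult_indicator[OF cR] ..
    qed
    also have "emeasure lebesgue (H_set m \<inter> cball 0 (3 * R)) = emeasure lborel (H_set m \<inter> cball 0 (3 * R))"
      by (simp add: H_set_borel)
    also have "emeasure lebesgue (cball (0::real^3) (3 * R)) = ennreal (v * (3 * R) ^ 3)"
      using v(2)[of "3 * R"] R by simp
    also have "ennreal (A ^ 3) * emeasure lborel (H_set m \<inter> cball 0 (3 * R))
       + (ennreal (A ^ 3 * R) * (\<integral>\<^sup>+x. ennreal (modular_density x) * indicator {x. R / 2 \<le> norm x} x \<partial>lebesgue)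
       + ennreal (A ^ 3 * R * R powr (- s)) * ennreal (v * (3 * R) ^ 3))
       \<le> ennreal (A ^ 3) * ennreal (\<delta> * (3 * R)) + (ennreal (A ^ 3 * R) * ennreal \<delta>
       + ennreal (A ^ 3 * R * R powr (- s)) * ennreal (v * (3 * R) ^ 3))"
      by (rule add_mono[OF mult_left_mono[OF R1[OF R(2)]] add_mono[OF mult_left_mono[OF R2[OF R(3)]] order_refl]]) auto
    also have "\<dots> = ennreal (A ^ 3 * (\<delta> * (3 * R)) + (A ^ 3 * R * \<delta> + A ^ 3 * R * R powr (- s) * (v * (3 * R) ^ 3)))"
    proof -
      have n: "0 \<le> A ^ 3" "0 \<le> \<delta> * (3 * R)" "0 \<le> A ^ 3 * R" "0 \<le> \<delta>" "0 \<le> A ^ 3 * R * R powr (- s)" "0 \<le> v * (3 * R) ^ 3"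
        using A \<delta>(1) R v(1) by auto
      have ep: "ennreal a + (ennreal b + ennreal c) = ennreal (a + (b + c))" if "0 \<le> a" "0 \<le> b" "0 \<le> c" for a b c
        using that by simp
      show ?thesis
        unfolding ennreal_mult[OF n(1,2), symmetric] ennreal_mult[OF n(3,4), symmetric] ennreal_mult[OF n(5,6), symmetric]
        by (intro ep mult_nonneg_nonneg n)
    qed
    also have "\<dots> \<le> ennreal (e * R)"
    proof (rule ennreal_leI)
      have "R powr (- s) * (v * (3 * R) ^ 3) = 27 * v * (R powr (- s) * R powr real 3)"
      proof -
        have "R powr real 3 = R ^ 3" using R by (subst powr_realpow) auto
        then show ?thesis by (simp only: power_mult_distrib) simp
      qed
      also have "R powr (- s) * R powr real 3 = R powr (3 - s)" unfolding powr_add[symmetric] by simp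
      finally have "R powr (- s) * (v * (3 * R) ^ 3) = 27 * v * R powr (3 - s)" .
      then have "R powr (- s) * (v * (3 * R) ^ 3) \<le> \<delta>" using R3[OF R(4)] by linarith
      then have "A ^ 3 * R * (R powr (- s) * (v * (3 * R) ^ 3)) \<le> A ^ 3 * R * \<delta>"
        by (rule mult_left_mono) (use A R(1) in auto)
      moreover have "A ^ 3 * R * R powr (- s) * (v * (3 * R) ^ 3) = A ^ 3 * R * (R powr (- s) * (v * (3 * R) ^ 3))"
        by (simp only: mult.assoc)
      moreover have "A ^ 3 * (\<delta> * (3 * R)) + (A ^ 3 * R * \<delta> + A ^ 3 * R * \<delta>) = (A ^ 3 * (5 * \<delta>)) * R"
        by (simp add: algebra_simps)
      ultimately show "A ^ 3 * (\<delta> * (3 * R)) + (A ^ 3 * R * \<delta> + A ^ 3 * R * R powr (- s) * (v * (3 * R) ^ 3)) \<le> e * R"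
        unfolding \<delta>(2) by linarith
    qed
    finally show ?thesis .
  qed
  then show ?thesis by blast
qed

end

section \<open>From the stated hypotheses to Borel representatives and real exponents\<close>

lemma locint_of_lebesgue:
  assumes g: "g \<in> borel_measurable borel"
    and f: "\<And>K. compact K \<Longrightarrow> set_integrable lebesgue K f"
    and ae: "AE x in lborel. f x = g x"
  shows "locint g"
  unfolding locint_def
proof (intro conjI allI g)
  fix R
  have m: "(\<lambda>x. indicator (cball 0 R) x * g x) \<in> borel_measurable lborel"
    using g by (intro borel_measurable_times borel_measurable_indicator) auto
  have "integrable lebesgue (\<lambda>x. indicator (cball 0 R) x * f x)"
    using f[of "cball 0 R"] by (simp add: set_integrable_def)
  then have "integrable lebesgue (\<lambda>x. indicator (cball 0 R) x * g x)"
  proof (rule integrable_cong_AE_imp)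
    show "(\<lambda>x. indicator (cball 0 R) x * g x) \<in> borel_measurable lebesgue"
      using m by (rule measurable_completion)
    show "AE x in lebesgue. indicator (cball 0 R) x * f x = indicator (cball 0 R) x * g x"
      using AE_completion[OF ae] by eventually_elim simp
  qed
  then show "integrable lborel (\<lambda>x. indicator (cball 0 R) x * g x)"
    using integrable_completion[OF m] by simp
qed

text \<open>Both summands of the modular are nonnegative, the second by the \<open>max 0\<close> in
  the norm, so for an admissible scaling each is at most 1. Where p = \<infinity>, the essential
  supremum bound becomes a pointwise bound by \<open>c\<close> almost everywhere.\<close>

lemma in_LvarD:
  assumes p [measurable]: "p \<in> borel_measurable lebesgue" and g: "in_Lvar p g"
  obtains c where "c > 0"
    "(\<integral>\<^sup>+x. ennreal ((\<bar>g x\<bar> / c) powr real_of_ereal (p x)) * indicator {x. p x < \<infinity>} x \<partial>lebesgue) \<le> 1"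
    "AE x in lebesgue. p x = \<infinity> \<longrightarrow> \<bar>g x\<bar> \<le> c"
proof -
  obtain c where c: "c > 0" "modular p (\<lambda>x. g x / c) \<le> 1" using g by (auto simp: in_Lvar_def)
  define I where "I = (\<integral>\<^sup>+x. ennreal ((\<bar>g x\<bar> / c) powr real_of_ereal (p x)) * indicator {x. p x < \<infinity>} x \<partial>lebesgue)"
  define L where "L = Linf_norm_on {x. p x = \<infinity>} (\<lambda>x. g x / c)"
  have L0: "L \<ge> 0" by (simp add: L_def Linf_norm_on_def)
  have IL: "enn2ereal I + L \<le> 1"
    using c unfolding modular_def I_def L_def by (simp add: abs_divide)
  have "enn2ereal I \<le> enn2ereal I + L" using L0 by (rule ereal_le_add_self)
  then have "enn2ereal I \<le> 1" using IL by (rule order_trans)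
  then have I1: "I \<le> 1" by (simp add: less_eq_ennreal.rep_eq one_ennreal.rep_eq)
  have "L \<le> enn2ereal I + L" by (rule ereal_le_add_self2) simp
  then have L1: "L \<le> 1" using IL by (rule order_trans)
  have S: "{x. p x = \<infinity>} \<inter> space lebesgue \<in> sets lebesgue"
  proof -
    have "p -` {\<infinity>} \<inter> space lebesgue \<in> sets lebesgue" by (rule measurable_sets[OF p]) simp
    moreover have "{x. p x = \<infinity>} \<inter> space lebesgue = p -` {\<infinity>} \<inter> space lebesgue" by auto
    ultimately show ?thesis by simp
  qed
  have "AE x in restrict_space lebesgue {x. p x = \<infinity>}. ereal \<bar>g x / c\<bar> \<le> esssup (restrict_space lebesgue {x. p x = \<infinity>}) (\<lambda>x. ereal \<bar>g x / c\<bar>)"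
    by (rule esssup_AE)
  then have "AE x in restrict_space lebesgue {x. p x = \<infinity>}. \<bar>g x\<bar> \<le> c"
  proof eventually_elim
    fix x assume "ereal \<bar>g x / c\<bar> \<le> esssup (restrict_space lebesgue {x. p x = \<infinity>}) (\<lambda>x. ereal \<bar>g x / c\<bar>)"
    also have "\<dots> \<le> L" by (simp add: L_def Linf_norm_on_def)
    also have "\<dots> \<le> 1" by (rule L1)
    finally have "\<bar>g x / c\<bar> \<le> 1" by simp
    then show "\<bar>g x\<bar> \<le> c" using c(1) by (simp add: abs_divide)
  qed
  then have "AE x in lebesgue. x \<in> {x. p x = \<infinity>} \<longrightarrow> \<bar>g x\<bar> \<le> c"
    unfolding AE_restrict_space_iff[OF S] .
  then show ?thesis using that[OF c(1) I1[unfolded I_def]] by simp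
qed

theorem theorem1p2:
  fixes m :: nat and p :: "real^3 \<Rightarrow> ereal"
    and u :: "real^3 \<Rightarrow> real^3" and \<pi> :: "real^3 \<Rightarrow> real"
  assumes "m > 0"
    and "var_exponent p"
    and "3 < ess_inf_on (UNIV - H_set m) p"
    and "ess_sup_on (UNIV - H_set m) p < 9 / 2"
    and "AE x in lebesgue. x \<notin> H_set m \<longrightarrow>
           ess_inf_on (UNIV - H_set m) p \<le> p x \<and> p x \<le> ess_sup_on (UNIV - H_set m) p"
    and "\<forall>x \<in> H_set m. p x = \<infinity>"
    and "L2_loc_vec u"
    and "L1_loc \<pi>"
    and "weak_stationary_NS u \<pi>"
    and "in_Lvar_vec p u"
    and "in_Lvar (\<lambda>x. p x / 2) \<pi>"
  shows "AE x in lebesgue. u x = 0"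
proof -
  have pm [measurable]: "p \<in> borel_measurable lebesgue" and p1: "\<And>x. 1 \<le> p x"
    using assms(2) by (auto simp: var_exponent_def)
  have um: "u \<in> borel_measurable lebesgue" using assms(7) by (simp add: L2_loc_vec_def)
  have uim [measurable]: "(\<lambda>x. u x $ i) \<in> borel_measurable lebesgue" for i
    using measurable_compose[OF um vec_nth_borel] .
  have num [measurable]: "(\<lambda>x. norm (u x)) \<in> borel_measurable lebesgue"
    unfolding norm_vec_def L2_set_def by measurable
  have \<pi>m [measurable]: "\<pi> \<in> borel_measurable lebesgue" using assms(8) by (simp add: L1_loc_def)
  have "\<forall>i. \<exists>g\<in>borel_measurable lborel. AE x in lborel. u x $ i = g x"
    using completion_ex_borel_measurable_real[OF uim] by blast
  then obtain h where h: "\<And>i. h i \<in> borel_measurable lborel" "\<And>i. AE x in lborel. u x $ i = h i x"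
    by metis
  obtain \<rho> where \<rho>: "\<rho> \<in> borel_measurable lborel" "AE x in lborel. \<pi> x = \<rho> x"
    using completion_ex_borel_measurable_real[OF \<pi>m] by blast
  \<comment> \<open>A Borel representative, assembled from components because the representation of
    functions measurable for the completion is applied to real functions.\<close>
  define v where "v x = (\<chi> i. h i x)" for x
  have vm [measurable]: "(\<lambda>x. v x $ i) \<in> borel_measurable borel" for i
    using h(1)[of i] by (simp add: v_def)
  have \<rho>m [measurable]: "\<rho> \<in> borel_measurable borel" using \<rho>(1) by simp
  have nvm [measurable]: "(\<lambda>x. norm (v x)) \<in> borel_measurable borel"
    unfolding norm_vec_def L2_set_def by measurable
  have "AE x in lborel. \<forall>i\<in>UNIV. u x $ i = h i x" by (intro AE_finite_allI h(2)) auto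
  then have uv: "AE x in lborel. u x = v x"
    by eventually_elim (simp add: v_def vec_eq_iff)
  have v_sq: "locint (\<lambda>x. (norm (v x))\<^sup>2)"
  proof (rule locint_of_lebesgue)
    show "set_integrable lebesgue K (\<lambda>x. (norm (u x))\<^sup>2)" if "compact K" for K
      using assms(7) that by (simp add: L2_loc_vec_def)
    show "AE x in lborel. (norm (u x))\<^sup>2 = (norm (v x))\<^sup>2" using uv by eventually_elim simp
  qed measurable
  \<comment> \<open>The weak formulation sees the fields only through integrals, so it is inherited
    by almost everywhere equal Borel representatives.\<close>
  interpret stationary_NS v \<rho>
  proof
    show "locint (\<lambda>x. v x $ i)" for i
    proof (rule locint_dominated[OF locint_add[OF locint_const[of 1] v_sq]])
      fix x
      have "0 \<le> (norm (v x) - 1)\<^sup>2" by simp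
      then have "2 * norm (v x) \<le> 1 + (norm (v x))\<^sup>2" by (simp add: power2_diff)
      then show "\<bar>v x $ i\<bar> \<le> 1 + (norm (v x))\<^sup>2"
        using abs_component_le_norm[of "v x" i] norm_ge_zero[of "v x"] by linarith
    qed measurable
    show "locint (\<lambda>x. v x $ i * v x $ j)" for i j
    proof (rule locint_dominated[OF v_sq])
      show "\<bar>v x $ i * v x $ j\<bar> \<le> (norm (v x))\<^sup>2" for x
        unfolding abs_mult power2_eq_square by (intro mult_mono abs_component_le_norm) auto
    qed measurable
    show "locint \<rho>"
      by (rule locint_of_lebesgue[OF \<rho>m _ \<rho>(2)]) (use assms(8) in \<open>simp add: L1_loc_def\<close>)
  next
    fix \<phi> :: "3 \<Rightarrow> real^3 \<Rightarrow> real" assume \<phi>: "\<And>j. test_fun (\<phi> j)"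
    have s: "smooth3 (\<phi> j)" for j using \<phi> by (rule test_fun_smooth)
    have pb [measurable]: "partial i (\<phi> j) \<in> borel_measurable borel" "lap (\<phi> j) \<in> borel_measurable borel" for i j
      by (intro smooth3_borel smooth3_partial smooth3_lap s)+
    have [measurable]: "partial i (\<phi> j) \<in> borel_measurable lebesgue" "lap (\<phi> j) \<in> borel_measurable lebesgue" for i j
      using pb by (auto intro: measurable_completion)
    define E where "E u \<pi> x = (\<Sum>j\<in>UNIV. u x $ j * lap (\<phi> j) x)
             + (\<Sum>i\<in>UNIV. \<Sum>j\<in>UNIV. u x $ i * u x $ j * partial i (\<phi> j) x)
             + \<pi> x * (\<Sum>j\<in>UNIV. partial j (\<phi> j) x)" for u :: "real^3 \<Rightarrow> real^3" and \<pi> :: "real^3 \<Rightarrow> real" and x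
    have "test_vfield (\<lambda>x. \<chi> j. \<phi> j x)" using \<phi> by (simp add: test_vfield_def)
    then have "(\<integral>x. E u \<pi> x \<partial>lebesgue) = 0"
      using assms(9) unfolding weak_stationary_NS_def E_def lap_def by fastforce
    moreover have "(\<integral>x. E u \<pi> x \<partial>lebesgue) = (\<integral>x. E v \<rho> x \<partial>lebesgue)"
    proof (rule integral_cong_AE)
      show "E u \<pi> \<in> borel_measurable lebesgue" unfolding E_def[abs_def] by measurable
      have "E v \<rho> \<in> borel_measurable lborel" unfolding E_def[abs_def] by measurable
      then show "E v \<rho> \<in> borel_measurable lebesgue" by (rule measurable_completion)
      show "AE x in lebesgue. E u \<pi> x = E v \<rho> x"
        using AE_completion[OF uv] AE_completion[OF \<rho>(2)] by eventually_elim (simp add: E_def)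
    qed
    moreover have "(\<integral>x. E v \<rho> x \<partial>lebesgue) = (\<integral>x. E v \<rho> x \<partial>lborel)"
      by (rule integral_completion) (unfold E_def[abs_def], measurable)
    ultimately show "(\<integral>x. (\<Sum>j\<in>UNIV. v x $ j * lap (\<phi> j) x)
             + (\<Sum>i\<in>UNIV. \<Sum>j\<in>UNIV. v x $ i * v x $ j * partial i (\<phi> j) x)
             + \<rho> x * (\<Sum>j\<in>UNIV. partial j (\<phi> j) x) \<partial>lborel) = 0"
      unfolding E_def by simp
  next
    fix \<psi> assume \<psi>: "test_fun \<psi>"
    have pb [measurable]: "partial i \<psi> \<in> borel_measurable borel" for i
      by (intro smooth3_borel smooth3_partial test_fun_smooth \<psi>)
    have [measurable]: "partial i \<psi> \<in> borel_measurable lebesgue" for i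
      using pb by (auto intro: measurable_completion)
    define E where "E u x = (\<Sum>i\<in>UNIV. u x $ i * partial i \<psi> x)" for u :: "real^3 \<Rightarrow> real^3" and x
    have "(\<integral>x. E u x \<partial>lebesgue) = 0"
      using assms(9) \<psi> unfolding weak_stationary_NS_def E_def by blast
    moreover have "(\<integral>x. E u x \<partial>lebesgue) = (\<integral>x. E v x \<partial>lebesgue)"
    proof (rule integral_cong_AE)
      show "E u \<in> borel_measurable lebesgue" unfolding E_def[abs_def] by measurable
      have "E v \<in> borel_measurable lborel" unfolding E_def[abs_def] by measurable
      then show "E v \<in> borel_measurable lebesgue" by (rule measurable_completion)
      show "AE x in lebesgue. E u x = E v x"
        using AE_completion[OF uv] by eventually_elim (simp add: E_def)
    qed
    moreover have "(\<integral>x. E v x \<partial>lebesgue) = (\<integral>x. E v x \<partial>lborel)"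
      by (rule integral_completion) (unfold E_def[abs_def], measurable)
    ultimately show "(\<integral>x. (\<Sum>i\<in>UNIV. v x $ i * partial i \<psi> x) \<partial>lborel) = 0"
      unfolding E_def by simp
  qed
  \<comment> \<open>Real exponents are placed strictly inside the gaps at 3 and 9/2, since the
    essential bounds are extended reals.\<close>
  obtain q where q: "3 < q" "ereal q \<le> ess_inf_on (UNIV - H_set m) p"
    using ereal_dense2[OF assms(3)] by (auto simp: less_imp_le)
  obtain P0 where "ess_sup_on (UNIV - H_set m) p < ereal P0" "ereal P0 < 9 / 2"
    using ereal_dense2[OF assms(4)] by blast
  then have P0: "ess_sup_on (UNIV - H_set m) p \<le> ereal P0" "P0 < 9 / 2" by auto
  \<comment> \<open>Taking the maximum with 4 ensures P > 3 directly, and 4 still lies below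
    9/2.\<close>
  define P where "P = max P0 4"
  have P: "P > 3" "P < 9 / 2" using P0 by (auto simp: P_def)
  define r where "r x = real_of_ereal (p x)" for x
  have rm [measurable]: "r \<in> borel_measurable lebesgue" unfolding r_def[abs_def] by measurable
  have offp: "AE x in lebesgue. x \<notin> H_set m \<longrightarrow> p x = ereal (r x) \<and> q \<le> r x \<and> r x \<le> P"
    using assms(5)
  proof eventually_elim
    fix x assume a: "x \<notin> H_set m \<longrightarrow> ess_inf_on (UNIV - H_set m) p \<le> p x \<and> p x \<le> ess_sup_on (UNIV - H_set m) p"
    show "x \<notin> H_set m \<longrightarrow> p x = ereal (r x) \<and> q \<le> r x \<and> r x \<le> P"
    proof
      assume "x \<notin> H_set m"
      then have b: "ereal q \<le> p x" "p x \<le> ereal P0" using a q P0 by (auto intro: order_trans)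
      then obtain s where "p x = ereal s" by (cases "p x") auto
      then show "p x = ereal (r x) \<and> q \<le> r x \<and> r x \<le> P" using b by (auto simp: r_def P_def)
    qed
  qed
  then have off_H: "AE x in lebesgue. x \<notin> H_set m \<longrightarrow> q \<le> r x \<and> r x \<le> P"
    by eventually_elim auto
  have il: "in_Lvar p (\<lambda>x. norm (u x))" using assms(10) by (simp add: in_Lvar_vec_def)
  obtain c where c: "c > 0"
    "(\<integral>\<^sup>+x. ennreal ((\<bar>norm (u x)\<bar> / c) powr real_of_ereal (p x)) * indicator {x. p x < \<infinity>} x \<partial>lebesgue) \<le> 1"
    "AE x in lebesgue. p x = \<infinity> \<longrightarrow> \<bar>norm (u x)\<bar> \<le> c"
    using in_LvarD[OF pm il] by blast
  have p2m: "(\<lambda>x. p x / 2) \<in> borel_measurable lebesgue" by measurable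
  have p2: "p x / 2 = \<infinity> \<longleftrightarrow> p x = \<infinity>" "p x / 2 < \<infinity> \<longleftrightarrow> p x < \<infinity>" "real_of_ereal (p x / 2) = r x / 2" for x
    using p1[of x] by (cases "p x"; simp add: r_def)+
  obtain c' where c': "c' > 0"
    "(\<integral>\<^sup>+x. ennreal ((\<bar>\<pi> x\<bar> / c') powr real_of_ereal (p x / 2)) * indicator {x. p x / 2 < \<infinity>} x \<partial>lebesgue) \<le> 1"
    "AE x in lebesgue. p x / 2 = \<infinity> \<longrightarrow> \<bar>\<pi> x\<bar> \<le> c'"
    using in_LvarD[OF p2m assms(11)] by blast
  \<comment> \<open>One constant both normalises the modular and bounds the speed on the thin set;
    being at least 1 is required by the power comparisons. \<open>A'\<close> plays this part for the
    square root of the pressure.\<close>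
  define A where "A = max 1 c"
  define A' where "A' = max 1 (sqrt c')"
  \<comment> \<open>The square root turns the exponent p/2 of the pressure into \<open>p\<close> and
    |\<pi>|^(3/2) into \<open>w^3\<close>, so velocity and pressure are handled by the same
    lemmas.\<close>
  define w where "w x = sqrt \<bar>\<pi> x\<bar>" for x
  have wm [measurable]: "w \<in> borel_measurable lebesgue" unfolding w_def[abs_def] by measurable
  have A: "A \<ge> 1" "A \<ge> c" "A' \<ge> 1" "A' \<ge> sqrt c'" by (auto simp: A_def A'_def)
  have on1: "AE x in lebesgue. x \<in> H_set m \<longrightarrow> norm (u x) \<le> A"
    using c(3) by eventually_elim (use assms(6) A in auto)
  have on2: "AE x in lebesgue. x \<in> H_set m \<longrightarrow> w x \<le> A'"
    using c'(3)
  proof eventually_elim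
    fix x assume a: "p x / 2 = \<infinity> \<longrightarrow> \<bar>\<pi> x\<bar> \<le> c'"
    show "x \<in> H_set m \<longrightarrow> w x \<le> A'"
    proof
      assume "x \<in> H_set m"
      then have "\<bar>\<pi> x\<bar> \<le> c'" using a assms(6) p2(1) by auto
      then have "w x \<le> sqrt c'" unfolding w_def by (rule real_sqrt_le_mono)
      then show "w x \<le> A'" using A by simp
    qed
  qed
  have fin1: "(\<integral>\<^sup>+x. ennreal (indicator (- H_set m) x * (norm (u x) / A) powr r x) \<partial>lebesgue) < \<infinity>"
  proof -
    have "(\<integral>\<^sup>+x. ennreal (indicator (- H_set m) x * (norm (u x) / A) powr r x) \<partial>lebesgue)
       \<le> (\<integral>\<^sup>+x. ennreal ((\<bar>norm (u x)\<bar> / c) powr real_of_ereal (p x)) * indicator {x. p x < \<infinity>} x \<partial>lebesgue)"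
    proof (rule nn_integral_mono_AE)
      show "AE x in lebesgue. ennreal (indicator (- H_set m) x * (norm (u x) / A) powr r x)
        \<le> ennreal ((\<bar>norm (u x)\<bar> / c) powr real_of_ereal (p x)) * indicator {x. p x < \<infinity>} x"
        using offp
      proof eventually_elim
        fix x assume a: "x \<notin> H_set m \<longrightarrow> p x = ereal (r x) \<and> q \<le> r x \<and> r x \<le> P"
        show "ennreal (indicator (- H_set m) x * (norm (u x) / A) powr r x)
          \<le> ennreal ((\<bar>norm (u x)\<bar> / c) powr real_of_ereal (p x)) * indicator {x. p x < \<infinity>} x"
        proof (cases "x \<in> H_set m")
          case False
          \<comment> \<open>Enlarging the denominator from \<open>c\<close> to \<open>A\<close>
            lowers a nonnegative base, and the exponent is positive, so the modular bound
            survives.\<close>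
          have "(norm (u x) / A) powr r x \<le> (norm (u x) / c) powr r x"
            using a False q c(1) A by (intro powr_mono2 divide_left_mono) auto
          then show ?thesis using a False by (auto intro!: ennreal_leI)
        qed simp
      qed
    qed
    also have "\<dots> < \<infinity>" using c(2) by (rule le_less_trans) simp
    finally show ?thesis .
  qed
  have fin2: "(\<integral>\<^sup>+x. ennreal (indicator (- H_set m) x * (w x / A') powr r x) \<partial>lebesgue) < \<infinity>"
  proof -
    have "(\<integral>\<^sup>+x. ennreal (indicator (- H_set m) x * (w x / A') powr r x) \<partial>lebesgue)
       \<le> (\<integral>\<^sup>+x. ennreal ((\<bar>\<pi> x\<bar> / c') powr real_of_ereal (p x / 2)) * indicator {x. p x / 2 < \<infinity>} x \<partial>lebesgue)"
    proof (rule nn_integral_mono_AE)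
      show "AE x in lebesgue. ennreal (indicator (- H_set m) x * (w x / A') powr r x)
        \<le> ennreal ((\<bar>\<pi> x\<bar> / c') powr real_of_ereal (p x / 2)) * indicator {x. p x / 2 < \<infinity>} x"
        using offp
      proof eventually_elim
        fix x assume a: "x \<notin> H_set m \<longrightarrow> p x = ereal (r x) \<and> q \<le> r x \<and> r x \<le> P"
        show "ennreal (indicator (- H_set m) x * (w x / A') powr r x)
          \<le> ennreal ((\<bar>\<pi> x\<bar> / c') powr real_of_ereal (p x / 2)) * indicator {x. p x / 2 < \<infinity>} x"
        proof (cases "x \<in> H_set m")
          case False
          have "(w x / A') powr r x \<le> (w x / sqrt c') powr r x"
            using a False q c'(1) A by (intro powr_mono2 divide_left_mono) (auto simp: w_def)
          also have "w x / sqrt c' = (\<bar>\<pi> x\<bar> / c') powr (1/2)"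
            using c'(1) by (simp add: w_def powr_half_sqrt real_sqrt_divide)
          also have "((\<bar>\<pi> x\<bar> / c') powr (1/2)) powr r x = (\<bar>\<pi> x\<bar> / c') powr (r x / 2)"
            by (simp add: powr_powr)
          finally show ?thesis using a False by (auto simp: p2 intro!: ennreal_leI)
        qed simp
      qed
    qed
    also have "\<dots> < \<infinity>" using c'(2) by (rule le_less_trans) simp
    finally show ?thesis .
  qed
  have w0: "w x \<ge> 0" for x by (simp add: w_def)
  note u_facts = num norm_ge_zero rm A(1) q(1) P on1 off_H fin1
  note w_facts = wm w0 rm A(3) q(1) P on2 off_H fin2
  have cubic_ae: "AE x in lebesgue. ennreal (cubic x) = ennreal (norm (u x) ^ 3) + ennreal (w x ^ 3)"
    using AE_completion[OF uv] AE_completion[OF \<rho>(2)]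
  proof eventually_elim
    fix x assume a: "u x = v x" "\<pi> x = \<rho> x"
    have "\<bar>\<pi> x\<bar> powr (3/2) = (\<bar>\<pi> x\<bar> powr (1/2)) powr real 3" by (simp add: powr_powr)
    also have "\<dots> = w x ^ 3"
    proof (cases "\<pi> x = 0")
      case False
      then show ?thesis by (subst powr_realpow) (auto simp: w_def powr_half_sqrt)
    qed (simp add: w_def)
    finally show "ennreal (cubic x) = ennreal (norm (u x) ^ 3) + ennreal (w x ^ 3)"
      using a w0[of x] by (simp add: cubic_def ennreal_plus)
  qed
  have cubic_int: "(\<integral>\<^sup>+x. ennreal (cubic x) * indicator S x \<partial>lborel)
      = (\<integral>\<^sup>+x. ennreal (norm (u x) ^ 3) * indicator S x \<partial>lebesgue) + (\<integral>\<^sup>+x. ennreal (w x ^ 3) * indicator S x \<partial>lebesgue)"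
    if "S \<in> sets borel" for S
  proof -
    have [measurable]: "S \<in> sets lebesgue" using that by simp
    have "(\<integral>\<^sup>+x. ennreal (cubic x) * indicator S x \<partial>lborel) = (\<integral>\<^sup>+x. ennreal (cubic x) * indicator S x \<partial>lebesgue)"
      by (simp add: nn_integral_completion)
    also have "\<dots> = (\<integral>\<^sup>+x. ennreal (norm (u x) ^ 3) * indicator S x + ennreal (w x ^ 3) * indicator S x \<partial>lebesgue)"
    proof (rule nn_integral_cong_AE)
      show "AE x in lebesgue. ennreal (cubic x) * indicator S x = ennreal (norm (u x) ^ 3) * indicator S x + ennreal (w x ^ 3) * indicator S x"
        using cubic_ae by eventually_elim (simp add: distrib_right)
    qed
    also have "\<dots> = (\<integral>\<^sup>+x. ennreal (norm (u x) ^ 3) * indicator S x \<partial>lebesgue) + (\<integral>\<^sup>+x. ennreal (w x ^ 3) * indicator S x \<partial>lebesgue)"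
      by (intro nn_integral_add) measurable
    finally show ?thesis .
  qed
  have loc: "locint cubic"
    unfolding locint_def
  proof (intro conjI allI cubic_borel)
    fix R :: real
    show "integrable lborel (\<lambda>x. indicator (cball 0 R) x * cubic x)"
    proof (rule integrableI_nonneg)
      show "(\<lambda>x. indicator (cball 0 R) x * cubic x) \<in> borel_measurable lborel"
        by (intro borel_measurable_times borel_measurable_indicator) auto
      have "(\<integral>\<^sup>+x. ennreal (indicator (cball 0 R) x * cubic x) \<partial>lborel) = (\<integral>\<^sup>+x. ennreal (cubic x) * indicator (cball 0 R) x \<partial>lborel)"
        by (intro nn_integral_cong) (auto simp: indicator_def)
      also have "\<dots> < \<infinity>"
        using cube_local_finite[OF u_facts, of R] cube_local_finite[OF w_facts, of R] by (simp add: cubic_int)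
      finally show "(\<integral>\<^sup>+x. ennreal (indicator (cball 0 R) x * cubic x) \<partial>lborel) < \<infinity>" .
    qed (auto simp: cubic_nonneg)
  qed
  have tail: "\<exists>R0. \<forall>R\<ge>R0. (\<integral>\<^sup>+x. ennreal (cubic x) * indicator (annulus (R / 2) (3 * R)) x \<partial>lborel) \<le> ennreal (e * R)"
    if e: "e > 0" for e
  proof -
    obtain R1 where R1: "\<And>R. R \<ge> R1 \<Longrightarrow> (\<integral>\<^sup>+x. ennreal (norm (u x) ^ 3) * indicator (annulus (R / 2) (3 * R)) x \<partial>lebesgue) \<le> ennreal (e / 2 * R)"
      using cube_annulus_small[OF u_facts, of "e / 2"] e by auto
    obtain R2 where R2: "\<And>R. R \<ge> R2 \<Longrightarrow> (\<integral>\<^sup>+x. ennreal (w x ^ 3) * indicator (annulus (R / 2) (3 * R)) x \<partial>lebesgue) \<le> ennreal (e / 2 * R)"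
      using cube_annulus_small[OF w_facts, of "e / 2"] e by auto
    have "(\<integral>\<^sup>+x. ennreal (cubic x) * indicator (annulus (R / 2) (3 * R)) x \<partial>lborel) \<le> ennreal (e * R)"
      if R: "R \<ge> max 0 (max R1 R2)" for R
    proof -
      have S: "annulus (R / 2) (3 * R) \<in> sets borel" by measurable
      have "(\<integral>\<^sup>+x. ennreal (cubic x) * indicator (annulus (R / 2) (3 * R)) x \<partial>lborel) \<le> ennreal (e / 2 * R) + ennreal (e / 2 * R)"
        unfolding cubic_int[OF S] using R by (intro add_mono R1 R2) auto
      also have "\<dots> = ennreal (e / 2 * R + e / 2 * R)" using e R by (intro ennreal_plus[symmetric]) auto
      also have "e / 2 * R + e / 2 * R = e * R" by simp
      finally show ?thesis .
    qed
    then show ?thesis by blast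
  qed
  \<comment> \<open>The integrability needed for boundedness is known for \<open>u\<close> over
    \<open>lebesgue\<close>; it is transferred to the representative \<open>v\<close> over
    \<open>lborel\<close>.\<close>
  have "(\<integral>\<^sup>+x. ennreal (if norm (v x) > A then norm (v x) powr q else 0) \<partial>lborel)
     = (\<integral>\<^sup>+x. ennreal (if norm (v x) > A then norm (v x) powr q else 0) \<partial>lebesgue)"
    by (simp add: nn_integral_completion)
  also have "\<dots> = (\<integral>\<^sup>+x. ennreal (if norm (u x) > A then norm (u x) powr q else 0) \<partial>lebesgue)"
    using AE_completion[OF uv] by (intro nn_integral_cong_AE) (auto elim!: eventually_mono)
  also have "\<dots> < \<infinity>" by (rule large_part_finite[OF u_facts])
  finally obtain M where "AE x in lborel. norm (v x) \<le> M"
    using essentially_bounded[OF q(1) A(1)] by blast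
  from u_eq_0_of_bounded[OF this loc tail] have "AE x in lborel. v x = 0" by blast
  then have "AE x in lborel. u x = 0" using uv by eventually_elim simp
  then show ?thesis by (rule AE_completion)
qed

end
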